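(* Let $K=\mathbb{Q}(\sqrt{-7})$ and let $\mathcal{D}$ be any prime ideal of $\mathcal{O}_K$ of prime norm congruent to $3$ modulo $4$, with norm different from $7$. Let $\psi_{\mathcal{D}}$ be the Hecke character of $K$ attached to $\mathcal{D}$. Then $L(\psi_{\mathcal{D}},1)\neq 0$.
   Context: $\mathcal{O}_K$ is a principal ideal domain with units $\pm1$. Let $p=N(\mathcal{D})$ and let $\varepsilon_{\mathcal{D}}:(\mathcal{O}_K/\mathcal{D})^\times\cong(\mathbb{Z}/p\mathbb{Z})^\times\to\{\pm1\}$ be the composite of the natural isomorphism with the Legendre symbol $(\frac{\cdot}{p})$. Then $\psi_{\mathcal{D}}(\langle\alpha\rangle)=\varepsilon_{\mathcal{D}}(\alpha)\,\alpha$ for $\alpha\in\mathcal{O}_K$ prime to $\mathcal{D}$ (well defined because $\varepsilon_{\mathcal{D}}(-1)=-1$), and $\psi_{\mathcal{D}}$ is $0$ on ideals not prime to $\mathcal{D}$. $L(\psi_{\mathcal{D}},s)$ is the analytic continuation of $\sum_{\mathcal{C}}\psi_{\mathcal{D}}(\mathcal{C})(N\mathcal{C})^{-s}$, the sum being over nonzero integral ideals of $\mathcal{O}_K$. *)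

theory Defs
  imports
    "HOL-Algebra.QuotRing"
    "HOL-Number_Theory.Number_Theory"
    "HOL-Complex_Analysis.Complex_Analysis"
begin

definition K :: "complex set" where
  "K = {of_rat a + of_rat b * csqrt (-7) | a b. True}"

definition OK :: "complex ring" where
  "OK = \<lparr>carrier = {x \<in> K. algebraic_int x}, monoid.mult = (*), one = 1, zero = 0, add = (+)\<rparr>"

text \<open>Infinite quotients get norm 0, so the zero ideal has norm 0.\<close>

definition ideal_norm :: "complex set \<Rightarrow> nat" where
  "ideal_norm C = card (carrier (OK Quot C))"

text \<open>
  If the norm of the prime ideal \<open>D\<close> is a prime number \<open>p\<close>, the integers \<open>a\<close> congruent to \<open>\<alpha>\<close>
  modulo \<open>D\<close> form exactly one residue class modulo \<open>p\<close>, namely the image of \<open>\<alpha>\<close> under the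
  natural isomorphism from \<open>OK / D\<close> to the integers modulo \<open>p\<close>.
\<close>

definition eps :: "complex set \<Rightarrow> complex \<Rightarrow> int" where
  "eps D \<alpha> = (THE e. \<exists>a::int. \<alpha> - of_int a \<in> D \<and> e = Legendre a (int (ideal_norm D)))"

text \<open>
  Every ideal of \<open>OK\<close> is principal, and its generator is unique up to sign. For ideal norm
  congruent to 3 modulo 4, \<open>eps D (- \<alpha>) = - eps D \<alpha>\<close>, so the value below does not depend on the
  generator.
\<close>

definition psi :: "complex set \<Rightarrow> complex set \<Rightarrow> complex" where
  "psi D C =
     (if C <+>\<^bsub>OK\<^esub> D = carrier OK
      then THE c. \<exists>\<alpha>\<in>carrier OK. C = PIdl\<^bsub>OK\<^esub> \<alpha> \<and> c = of_int (eps D \<alpha>) * \<alpha>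
      else 0)"

text \<open>
  \<open>hecke_L \<phi> s\<close> is the value at \<open>s\<close> of the holomorphic continuation of the Dirichlet series of
  \<open>\<phi>\<close> to an open right half-plane containing \<open>s\<close>. Half-planes are connected and nested, so by
  the identity theorem this value depends neither on the half-plane nor on the continuation.
\<close>

definition hecke_L :: "(complex set \<Rightarrow> complex) \<Rightarrow> complex \<Rightarrow> complex" where
  "hecke_L \<phi> s =
     (THE v. \<exists>f \<sigma> c.
        \<sigma> < Re s \<and> f holomorphic_on {z. \<sigma> < Re z} \<and>
        (\<forall>z. c < Re z \<longrightarrow>
           ((\<lambda>C. \<phi> C * of_nat (ideal_norm C) powr (- z)) has_sum f z)
             {C. ideal C OK \<and> C \<noteq> {0}}) \<and>
        v = f s)"

end

theory Submission
  imports Defs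
begin

text \<open>
  Let \<open>\<omega> = (1 + sqrt (-7)) / 2\<close>, let \<open>\<O>\<close> be the ring of integers and \<open>D = \<pi>\<O>\<close>, and let \<open>\<kappa>\<close> be the character of
  \<open>\<O>\<close> with kernel \<open>\<omega>\<O>\<close>. The conditionally convergent sum of \<open>\<kappa>(x) / (z + x)\<close> over \<open>x\<close> in \<open>\<O>\<close>,
  regularised by second differences, is an odd meromorphic function \<open>H\<close> with
  \<open>H(z + x) = \<kappa>(x) H(z)\<close>, and up to an Euler factor at \<open>\<omega>\<close> and conjugation the value \<open>L(1)\<close> is the
  sum of \<open>\<epsilon>(a) H(\<omega> a / \<pi>)\<close> over the residues \<open>a\<close> modulo \<open>p\<close>. Write \<open>\<omega>'\<close> for the conjugate of \<open>\<omega>\<close>.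
  Multiplication by \<open>\<omega>'\<close> acts on \<open>H\<close> by a rational function:
  \<open>H(\<omega>' z) H(z) = H(z)\<^sup>2 / \<omega>' + c\<close> with \<open>c \<noteq> 0\<close>. After scaling, \<open>H = l (1 + 2 w)\<close>, this reads
  \<open>w(\<omega>' z) (1 + 2 w(z)) = w(z) (\<omega> w(z) - \<omega>')\<close>, a map that expands outside the unit disc at any place
  above \<open>\<omega>'\<close>. The points \<open>\<omega> a / \<pi>\<close> are periodic under it, so \<open>w\<close> is integral there. Since \<open>\<epsilon>\<close> and \<open>H\<close> are
  odd, \<open>L(1) = 0\<close> would make a sum of \<open>(p - 1) / 2\<close> terms \<open>1 + 2 u\<close> with integral \<open>u\<close> vanish, which
  is impossible because \<open>(p - 1) / 2\<close> is odd and \<open>\<omega>'\<close> divides 2.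
\<close>

section \<open>Valuation rings\<close>

text \<open>A sum over a plane lattice of terms of size \<open>1 / norm x\<close> does not converge
  absolutely. Because \<open>\<kappa> 1 = - 1\<close>, the second difference of
  \<open>\<kappa>\<close> in direction 1 is \<open>- 4 * \<kappa>\<close>, so moving the difference
  onto \<open>1 / (z + x)\<close> costs only a factor -1/4 and gains two powers of decay. The same
  summation by parts, applied to a second antidifference of the Legendre symbol, continues the
  L-series to \<open>Re s > 1/2\<close>, so that both objects can be compared at
  \<open>s = 1\<close>. The twist by \<open>\<kappa>\<close> is what allows a holomorphic sum with a
  single simple pole modulo \<open>\<O>\<close>: an untwisted \<open>\<O>\<close>-periodic function
  of that kind does not exist. Multiplication by \<open>1 - \<omega>\<close>, and not by
  \<open>\<omega>\<close>, is the right endomorphism because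
  \<open>\<kappa> ((1 - \<omega>) y) = \<kappa> y\<close>. Integrality is tested in a valuation ring
  of the whole complex field, so that the torsion values need not first be shown algebraic or placed
  in a number field. The constant \<open>c\<close> enters only through \<open>c \<noteq> 0\<close>,
  since its value is absorbed into the scaling \<open>l\<close>.\<close>

definition is_subring :: "'a::field set \<Rightarrow> bool" where
  "is_subring R \<longleftrightarrow> 1 \<in> R \<and> (\<forall>x\<in>R. \<forall>y\<in>R. x - y \<in> R \<and> x * y \<in> R)"

lemma
  assumes "is_subring R"
  shows is_subring_one: "1 \<in> R"
    and is_subring_diff: "x \<in> R \<Longrightarrow> y \<in> R \<Longrightarrow> x - y \<in> R"
    and is_subring_mult: "x \<in> R \<Longrightarrow> y \<in> R \<Longrightarrow> x * y \<in> R"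
    and is_subring_zero: "0 \<in> R"
    and is_subring_minus: "x \<in> R \<Longrightarrow> - x \<in> R"
    and is_subring_add: "x \<in> R \<Longrightarrow> y \<in> R \<Longrightarrow> x + y \<in> R"
proof -
  show 1: "1 \<in> R" and d: "x \<in> R \<Longrightarrow> y \<in> R \<Longrightarrow> x - y \<in> R"
    and "x \<in> R \<Longrightarrow> y \<in> R \<Longrightarrow> x * y \<in> R" for x y
    using assms by (auto simp: is_subring_def)
  show 0: "0 \<in> R" using d[OF 1 1] by simp
  show m: "- x \<in> R" if "x \<in> R" for x using d[OF 0 that] by simp
  show "x + y \<in> R" if "x \<in> R" "y \<in> R" for x y using d[OF that(1) m[OF that(2)]] by simp
qed

lemmas is_subring_intros =
  is_subring_one is_subring_diff is_subring_mult is_subring_zero is_subring_minus is_subring_add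

lemma is_subring_power: "is_subring R \<Longrightarrow> x \<in> R \<Longrightarrow> x ^ n \<in> R"
  by (induction n) (auto intro: is_subring_intros)

lemma is_subring_sum: "is_subring R \<Longrightarrow> (\<And>i. i \<in> A \<Longrightarrow> f i \<in> R) \<Longrightarrow> sum f A \<in> R"
  by (induction A rule: infinite_finite_induct) (auto intro: is_subring_intros)

lemma is_subring_adjoin:
  fixes x :: "'a::field"
  assumes "is_subring R"
  shows "is_subring {poly q x | q. \<forall>i. coeff q i \<in> R}"
  unfolding is_subring_def
proof (intro conjI ballI)
  show "1 \<in> {poly q x | q. \<forall>i. coeff q i \<in> R}"
    by (rule CollectI, rule exI[of _ 1])
       (auto simp: coeff_1 is_subring_one[OF assms] is_subring_zero[OF assms])
next
  fix a b assume "a \<in> {poly q x | q. \<forall>i. coeff q i \<in> R}" "b \<in> {poly q x | q. \<forall>i. coeff q i \<in> R}"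
  then obtain q r where q: "a = poly q x" "\<And>i. coeff q i \<in> R" and r: "b = poly r x" "\<And>i. coeff r i \<in> R"
    by auto
  show "a - b \<in> {poly q x | q. \<forall>i. coeff q i \<in> R}"
    by (rule CollectI, rule exI[of _ "q - r"]) (auto simp: q r is_subring_diff[OF assms])
  have "coeff (q * r) i \<in> R" for i
    unfolding coeff_mult by (intro is_subring_sum[OF assms] is_subring_mult[OF assms] q r)
  thus "a * b \<in> {poly q x | q. \<forall>i. coeff q i \<in> R}"
    by (intro CollectI exI[of _ "q * r"]) (auto simp: q r)
qed

text \<open>Chevalley's extension of places. Zorn's lemma gives a ring \<open>R\<close> maximal
  among the overrings of \<open>A\<close> that omit \<open>1 / c\<close>. If \<open>x\<close> and
  \<open>1 / x\<close> both lay outside \<open>R\<close>, then by maximality \<open>1 / c\<close>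
  would be a polynomial over \<open>R\<close> in each of them, and eliminating leading powers
  between the two relations would shorten them indefinitely.\<close>

lemma exists_valuation_ring:
  fixes c :: "'a::field"
  assumes A: "is_subring A" "c \<in> A" "inverse c \<notin> A" and "c \<noteq> 0"
  obtains R where "is_subring R" "A \<subseteq> R" "inverse c \<notin> R" "\<And>x. x \<in> R \<or> inverse x \<in> R"
proof -
  define \<R> where "\<R> = {R. is_subring R \<and> A \<subseteq> R \<and> inverse c \<notin> R}"
  have "A \<in> \<R>" using A by (simp add: \<R>_def)
  moreover have "\<Union>\<C> \<in> \<R>" if "\<C> \<noteq> {}" and ch: "subset.chain \<R> \<C>" for \<C>
  proof -
    have in_R: "X \<in> \<R>" if "X \<in> \<C>" for X using ch that by (auto simp: subset.chain_def)
    have "is_subring (\<Union>\<C>)"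
      unfolding is_subring_def
    proof (intro conjI ballI)
      show "1 \<in> \<Union>\<C>" using \<open>\<C> \<noteq> {}\<close> in_R by (auto simp: \<R>_def is_subring_def)
      fix x y assume "x \<in> \<Union>\<C>" "y \<in> \<Union>\<C>"
      then obtain X Y where XY: "X \<in> \<C>" "x \<in> X" "Y \<in> \<C>" "y \<in> Y" by auto
      then have "X \<subseteq> Y \<or> Y \<subseteq> X" using ch unfolding subset.chain_def by blast
      then obtain Z where "Z \<in> \<C>" "x \<in> Z" "y \<in> Z" using XY by blast
      moreover from this have "is_subring Z" using in_R by (auto simp: \<R>_def)
      ultimately show "x - y \<in> \<Union>\<C>" "x * y \<in> \<Union>\<C>"
        by (meson UnionI is_subring_diff is_subring_mult)+
    qed
    moreover have "A \<subseteq> \<Union>\<C>" using \<open>\<C> \<noteq> {}\<close> in_R by (auto simp: \<R>_def)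
    moreover have "inverse c \<notin> \<Union>\<C>" using in_R by (auto simp: \<R>_def)
    ultimately show ?thesis by (simp add: \<R>_def)
  qed
  ultimately obtain R where R: "R \<in> \<R>" and max: "\<And>X. X \<in> \<R> \<Longrightarrow> R \<subseteq> X \<Longrightarrow> X = R"
    using subset_Zorn_nonempty[of \<R>] by (metis empty_iff)
  have sub: "is_subring R" and AR: "A \<subseteq> R" and cR: "c \<in> R" and ninv: "inverse c \<notin> R"
    using R A by (auto simp: \<R>_def)
  note intros = is_subring_intros[OF sub]
  have no1: False if "1 = c * r" "r \<in> R" for r
  proof -
    have "inverse c = r" using that \<open>c \<noteq> 0\<close> by (simp add: field_simps)
    thus False using that ninv by simp
  qed
  \<comment> \<open>\<open>P n x\<close> says that \<open>1 / c\<close> is a polynomial in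
    \<open>x\<close> of degree at most \<open>n\<close> over \<open>R\<close>, multiplied through by
    \<open>c\<close>.\<close>
  define P where "P = (\<lambda>n x. \<exists>a. (\<forall>i. a i \<in> R) \<and> 1 = c * (\<Sum>i\<le>n. a i * x ^ i))"
  have adj: "\<exists>n. P n x" if "x \<notin> R" for x
  proof -
    let ?X = "{poly q x | q. \<forall>i. coeff q i \<in> R}"
    have "r \<in> ?X" if "r \<in> R" for r
      by (rule CollectI, rule exI[of _ "[:r:]"])
         (use that in \<open>auto simp: coeff_pCons intro: intros split: nat.split\<close>)
    hence RX: "R \<subseteq> ?X" by blast
    have "x \<in> ?X"
      by (rule CollectI, rule exI[of _ "[:0, 1:]"])
         (auto simp: coeff_pCons intro: intros split: nat.split)
    hence "?X \<noteq> R" using that by blast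
    hence "?X \<notin> \<R>" using max RX by blast
    hence "inverse c \<in> ?X" using is_subring_adjoin[OF sub, of x] RX AR by (auto simp: \<R>_def)
    then obtain q where q: "inverse c = poly q x" "\<And>i. coeff q i \<in> R" by auto
    have "1 = c * (\<Sum>i\<le>degree q. coeff q i * x ^ i)"
      using q(1) \<open>c \<noteq> 0\<close> by (simp add: poly_altdef[symmetric] field_simps)
    thus ?thesis using q(2) unfolding P_def by blast
  qed
  \<comment> \<open>\<open>c\<close> lies in the Jacobson radical: a relation for the inverse of
    \<open>1 - c * b\<close>, multiplied by \<open>(1 - c * b) ^ n\<close>, puts this power into
    \<open>c R\<close>. As it is also 1 modulo \<open>c R\<close>, the element 1 would lie in
    \<open>c R\<close>.\<close>
  have unit: "inverse (1 - c * b) \<in> R" if b: "b \<in> R" for b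
  proof (rule ccontr)
    assume "inverse (1 - c * b) \<notin> R"
    then obtain n a where a: "\<And>i. a i \<in> R" and eq: "1 = c * (\<Sum>i\<le>n. a i * inverse (1 - c * b) ^ i)"
      using adj[of "inverse (1 - c * b)"] unfolding P_def by blast
    have ne: "1 - c * b \<noteq> 0" using no1[of b] b by auto
    have uR: "1 - c * b \<in> R" by (intro intros b cR)
    have "(1 - c * b) ^ n = c * (\<Sum>i\<le>n. a i * (1 - c * b) ^ (n - i))"
    proof -
      have "(1 - c * b) ^ n = c * (\<Sum>i\<le>n. a i * inverse (1 - c * b) ^ i) * (1 - c * b) ^ n"
        using eq by simp
      also have "\<dots> = c * (\<Sum>i\<le>n. a i * (inverse (1 - c * b) ^ i * (1 - c * b) ^ n))"
        by (simp add: sum_distrib_left sum_distrib_right mult_ac)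
      also have "(\<Sum>i\<le>n. a i * (inverse (1 - c * b) ^ i * (1 - c * b) ^ n)) =
          (\<Sum>i\<le>n. a i * (1 - c * b) ^ (n - i))"
        using ne by (intro sum.cong refl) (auto simp: power_diff field_simps)
      finally show ?thesis .
    qed
    moreover have "(\<Sum>i\<le>n. a i * (1 - c * b) ^ (n - i)) \<in> R"
      by (intro is_subring_sum[OF sub] is_subring_mult[OF sub] is_subring_power[OF sub] a uR)
    moreover have "\<exists>r\<in>R. (1 - c * b) ^ n = 1 - c * r"
    proof (induction n)
      case 0 show ?case using intros(4) by auto
    next
      case (Suc n)
      then obtain r where "r \<in> R" "(1 - c * b) ^ n = 1 - c * r" by auto
      have "(1 - c * b) ^ Suc n = (1 - c * b) * (1 - c * r)" by (simp add: \<open>(1 - c * b) ^ n = _\<close>)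
      hence "(1 - c * b) ^ Suc n = 1 - c * (r + b - c * b * r)" by (simp add: algebra_simps)
      moreover have "r + b - c * b * r \<in> R" using \<open>r \<in> R\<close> by (intro intros b cR)
      ultimately show ?case by blast
    qed
    ultimately obtain r s where "r \<in> R" "s \<in> R" "1 - c * r = c * s" by metis
    thus False using no1[of "r + s"] intros(6) by (simp add: algebra_simps)
  qed
  \<comment> \<open>In the relation for \<open>1 / x\<close> the constant part
    \<open>1 - c * b 0\<close> is a unit, so \<open>x ^ n\<close> becomes a combination of lower
    powers and can be substituted into the relation for \<open>x\<close>. Coefficients beyond
    \<open>m\<close> are padded with 0.\<close>
  have descent: "\<exists>k. n = Suc k \<and> P k x" if "P n x" "P m (inverse x)" "m \<le> n" "x \<noteq> 0" for n m x
  proof -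
    from that(1) obtain a where a: "\<And>i. a i \<in> R" "1 = c * (\<Sum>i\<le>n. a i * x ^ i)" unfolding P_def by blast
    from that(2) obtain b' where b': "\<And>i. b' i \<in> R" "1 = c * (\<Sum>i\<le>m. b' i * inverse x ^ i)"
      unfolding P_def by blast
    define b where "b = (\<lambda>i. if i \<le> m then b' i else 0)"
    have bR: "b i \<in> R" for i using b' intros by (auto simp: b_def)
    have "(\<Sum>i\<le>m. b' i * inverse x ^ i) = (\<Sum>i\<le>n. b i * inverse x ^ i)"
      using \<open>m \<le> n\<close> by (intro sum.mono_neutral_cong_left) (auto simp: b_def)
    hence b: "1 = c * (\<Sum>i\<le>n. b i * inverse x ^ i)" using b' by simp
    have "n \<noteq> 0"
    proof
      assume "n = 0"
      hence "1 = c * a 0" using a(2) by simp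
      thus False using no1 a(1) by blast
    qed
    then obtain k where k: "n = Suc k" by (cases n) auto
    let ?u = "1 - c * b 0"
    have ne: "?u \<noteq> 0" using no1[of "b 0"] bR by auto
    have "?u = c * (\<Sum>i\<le>k. b (Suc i) * inverse x ^ Suc i)"
      using b unfolding k sum.atMost_Suc_shift by (simp add: algebra_simps)
    hence "?u * x ^ n = c * (\<Sum>i\<le>k. b (Suc i) * (inverse x ^ Suc i * x ^ n))"
      by (simp add: sum_distrib_left sum_distrib_right mult_ac)
    also have "(\<Sum>i\<le>k. b (Suc i) * (inverse x ^ Suc i * x ^ n)) = (\<Sum>i\<le>k. b (Suc i) * x ^ (k - i))"
      using \<open>x \<noteq> 0\<close> by (intro sum.cong refl) (auto simp: power_diff k field_simps)
    also have "\<dots> = (\<Sum>i\<le>k. b (n - i) * x ^ i)"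
      by (rule sum.reindex_bij_witness[of _ "\<lambda>i. k - i" "\<lambda>i. k - i"]) (auto simp: k Suc_diff_le)
    finally have xn: "x ^ n = inverse ?u * c * (\<Sum>i\<le>k. b (n - i) * x ^ i)"
      using ne by (simp add: field_simps)
    define a' where "a' = (\<lambda>i. a i + a n * inverse ?u * c * b (n - i))"
    have "(\<Sum>i\<le>n. a i * x ^ i) = (\<Sum>i\<le>k. a i * x ^ i) + a n * x ^ n" by (simp add: k)
    also have "\<dots> = (\<Sum>i\<le>k. a' i * x ^ i)"
      unfolding xn a'_def by (simp add: sum.distrib sum_distrib_left algebra_simps)
    finally have "1 = c * (\<Sum>i\<le>k. a' i * x ^ i)" using a by simp
    moreover have "a' i \<in> R" for i unfolding a'_def by (intro intros a bR unit cR)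
    ultimately show ?thesis unfolding P_def k by blast
  qed
  \<comment> \<open>The longer of the two relations is the one to shorten. As \<open>x\<close> and
    \<open>1 / x\<close> play symmetric roles, the induction runs on the sum of the degrees.\<close>
  have contra: False if "P n x" "P m (inverse x)" "x \<noteq> 0" for n m x
    using that
  proof (induction "n + m" arbitrary: n m rule: less_induct)
    case less
    show ?case
    proof (cases "m \<le> n")
      case True
      from descent[OF less.prems(1,2) this less.prems(3)] obtain k where "n = Suc k" "P k x" by blast
      thus False using less.hyps[of k m] less.prems by simp
    next
      case False
      with descent[of m "inverse x" n] less.prems obtain k where "m = Suc k" "P k (inverse x)" by auto
      thus False using less.hyps[of n k] less.prems by simp
    qed
  qed
  have "x \<in> R \<or> inverse x \<in> R" for x
  proof (rule ccontr)
    assume *: "\<not> (x \<in> R \<or> inverse x \<in> R)"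
    hence "x \<noteq> 0" using intros(4) by auto
    with * show False using adj contra by blast
  qed
  with sub AR ninv show ?thesis using that by blast
qed

section \<open>The lattice of integers\<close>

definition \<omega> :: complex where "\<omega> = Complex (1/2) (sqrt 7 / 2)"

definition \<O> :: "complex set" where "\<O> = {of_int m + of_int n * \<omega> | m n. True}"

lemma omega_sq: "\<omega> * \<omega> = \<omega> - 2"
  by (auto simp: \<omega>_def complex_eq_iff field_simps)

lemma cnj_omega: "cnj \<omega> = 1 - \<omega>"
  by (auto simp: \<omega>_def complex_eq_iff)

lemma omega_mult_conj: "\<omega> * (1 - \<omega>) = 2"
  using omega_sq by (simp add: algebra_simps)

lemma omega_nz [simp]: "\<omega> \<noteq> 0" "1 - \<omega> \<noteq> 0" "\<omega> \<noteq> 1"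
  using omega_mult_conj by auto

lemma norm_omega: "norm \<omega> = sqrt 2" "norm (1 - \<omega>) = sqrt 2"
  by (simp_all add: \<omega>_def cmod_def power2_eq_square field_simps)

lemma in_O_I [intro]: "of_int m + of_int n * \<omega> \<in> \<O>"
  by (auto simp: \<O>_def)

lemma in_O_E: assumes "x \<in> \<O>" obtains m n where "x = of_int m + of_int n * \<omega>"
  using assms by (auto simp: \<O>_def)

lemma is_subring_O: "is_subring \<O>"
  unfolding is_subring_def
proof (intro conjI ballI)
  show "1 \<in> \<O>" using in_O_I[of 1 0] by simp
  fix x y assume "x \<in> \<O>" "y \<in> \<O>"
  then obtain m n k l where xy: "x = of_int m + of_int n * \<omega>" "y = of_int k + of_int l * \<omega>"
    by (metis in_O_E)
  have "x - y = of_int (m - k) + of_int (n - l) * \<omega>" by (simp add: xy algebra_simps)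
  thus "x - y \<in> \<O>" by (metis in_O_I)
  have "x * y = of_int (m * k) + of_int (m * l + n * k) * \<omega> + of_int (n * l) * (\<omega> * \<omega>)"
    by (simp add: xy algebra_simps)
  also have "\<dots> = of_int (m * k - 2 * n * l) + of_int (m * l + n * k + n * l) * \<omega>"
    unfolding omega_sq by (simp add: algebra_simps)
  finally show "x * y \<in> \<O>" by (metis in_O_I)
qed

lemmas O_intros [intro, simp] = is_subring_intros[OF is_subring_O]

lemma O_of_int [intro, simp]: "of_int n \<in> \<O>"
  using in_O_I[of n 0] by simp

lemma O_of_nat [intro, simp]: "of_nat n \<in> \<O>"
  using O_of_int[of "int n"] by simp

lemma O_numeral [intro, simp]: "numeral n \<in> \<O>"
  using O_of_int[of "numeral n"] by simp

lemma O_omega [intro, simp]: "\<omega> \<in> \<O>"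
  using in_O_I[of 0 1] by simp

lemma O_cnj: "x \<in> \<O> \<Longrightarrow> cnj x \<in> \<O>"
  by (elim in_O_E) (auto simp: cnj_omega)

lemma O_power [intro, simp]: "x \<in> \<O> \<Longrightarrow> x ^ n \<in> \<O>"
  by (rule is_subring_power[OF is_subring_O])

lemma O_coeffs_eq_iff:
  "of_int m + of_int n * \<omega> = of_int k + of_int l * \<omega> \<longleftrightarrow> m = k \<and> n = l"
  by (auto simp: complex_eq_iff \<omega>_def)

lemma norm_sq_O: "(norm (of_int m + of_int n * \<omega>))\<^sup>2 = real_of_int (m\<^sup>2 + m * n + 2 * n\<^sup>2)"
proof -
  have "(norm (of_int m + of_int n * \<omega>))\<^sup>2 = (m + n / 2)\<^sup>2 + (n * sqrt 7 / 2)\<^sup>2"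
    unfolding cmod_power2 by (simp add: \<omega>_def)
  also have "(n * sqrt 7 / 2)\<^sup>2 = n\<^sup>2 * 7 / 4"
    by (simp add: power_mult_distrib power_divide)
  finally show ?thesis by (simp add: power2_eq_square field_simps)
qed

text \<open>Completing the square: the difference of the two sides is
  \<open>(m + n)^2 + 2 n^2\<close>. This transfers counting and summation from the coordinates to
  the lattice.\<close>

lemma norm_sq_O_bound: "real_of_int (m\<^sup>2 + n\<^sup>2) \<le> 2 * (norm (of_int m + of_int n * \<omega>))\<^sup>2"
proof -
  have "2 * real_of_int (m\<^sup>2 + m * n + 2 * n\<^sup>2) - real_of_int (m\<^sup>2 + n\<^sup>2)
      = (real_of_int m + n)\<^sup>2 + 2 * (real_of_int n)\<^sup>2"
    by (simp add: power2_eq_square algebra_simps)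
  also have "\<dots> \<ge> 0" by simp
  finally show ?thesis unfolding norm_sq_O by linarith
qed

lemma norm_O_ge_1:
  assumes "x \<in> \<O>" "x \<noteq> 0"
  shows "norm x \<ge> 1"
proof -
  obtain m n where x: "x = of_int m + of_int n * \<omega>" using assms(1) by (rule in_O_E)
  define k where "k = m\<^sup>2 + m * n + 2 * n\<^sup>2"
  have k: "norm x ^ 2 = of_int k" unfolding x k_def by (rule norm_sq_O)
  have "norm x ^ 2 > 0" using assms by simp
  hence "k \<ge> 1" unfolding k by simp
  hence "norm x ^ 2 \<ge> 1" unfolding k by simp
  thus ?thesis using power2_le_imp_le[of 1 "norm x"] by simp
qed

lemma finite_O_norm_le: "finite {x\<in>\<O>. norm x \<le> r}"
proof (rule finite_subset)
  let ?N = "\<lceil>2 * r\<^sup>2\<rceil>"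
  let ?f = "\<lambda>(m, n). of_int m + of_int n * \<omega>"
  show "finite (?f ` ({-?N..?N} \<times> {-?N..?N}))" by simp
  show "{x\<in>\<O>. norm x \<le> r} \<subseteq> ?f ` ({-?N..?N} \<times> {-?N..?N})"
  proof safe
    fix x assume x: "x \<in> \<O>" "norm x \<le> r"
    then obtain m n where mn: "x = of_int m + of_int n * \<omega>" by (metis in_O_E)
    have "real_of_int (m\<^sup>2 + n\<^sup>2) \<le> 2 * r\<^sup>2"
      using norm_sq_O_bound[of m n] x(2) power_mono[of "norm x" r 2] unfolding mn by simp
    hence *: "m\<^sup>2 + n\<^sup>2 \<le> ?N" by linarith
    have "\<bar>k\<bar> \<le> k\<^sup>2" for k :: int
      by (cases "k = 0") (auto simp: power2_eq_square abs_mult_self_eq intro: self_le_power[of "\<bar>k\<bar>" 2, unfolded power2_eq_square abs_mult_self_eq])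
    from this[of m] this[of n] * have "\<bar>m\<bar> \<le> ?N" "\<bar>n\<bar> \<le> ?N"
      by (smt (verit) zero_le_power2)+
    thus "x \<in> ?f ` ({-?N..?N} \<times> {-?N..?N})"
      unfolding mn by (intro image_eqI[of _ _ "(m, n)"]) auto
  qed
qed

section \<open>Absolutely convergent sums over the lattice\<close>

lemma summable_on_int_powr:
  assumes "u > 1"
  shows "(\<lambda>m::int. (1 + real_of_int \<bar>m\<bar>) powr (-u)) summable_on UNIV"
proof -
  have "summable (\<lambda>n. real (Suc n) powr (-u))"
    by (subst summable_Suc_iff) (use assms in \<open>simp add: summable_real_powr_iff\<close>)
  hence "(\<lambda>n. real (Suc n) powr (-u)) summable_on UNIV"
    by (intro summable_nonneg_imp_summable_on) auto
  hence *: "(\<lambda>n::nat. (1 + real n) powr (-u)) summable_on UNIV" by (simp add: add.commute)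
  have "(\<lambda>m::int. (1 + real_of_int \<bar>m\<bar>) powr (-u)) summable_on range int"
    by (subst summable_on_reindex) (use * in \<open>auto simp: o_def\<close>)
  moreover have "(\<lambda>m::int. (1 + real_of_int \<bar>m\<bar>) powr (-u)) summable_on range (\<lambda>n. - int n)"
    by (subst summable_on_reindex) (use * in \<open>auto simp: o_def inj_on_def\<close>)
  ultimately have "(\<lambda>m::int. (1 + real_of_int \<bar>m\<bar>) powr (-u)) summable_on range int \<union> range (\<lambda>n. - int n)"
    by (rule summable_on_union)
  also have "range int \<union> range (\<lambda>n. - int n) = UNIV"
    by (auto simp: image_iff) (metis int_cases2)
  finally show ?thesis .
qed

text \<open>For nonzero \<open>x\<close> with coordinates \<open>m\<close>, \<open>n\<close> one has
  \<open>(1 + |m|) (1 + |n|) \<le> 8 |x|^2\<close>, so the sum is dominated by a product of two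
  one-dimensional sums with exponent \<open>t / 2 > 1\<close>.\<close>

lemma summable_on_O_powr:
  assumes "t > 2"
  shows "(\<lambda>x. norm x powr (-t)) summable_on \<O>"
proof -
  let ?f = "\<lambda>(m, n). of_int m + of_int n * \<omega>"
  let ?h = "\<lambda>m::int. (1 + real_of_int \<bar>m\<bar>) powr (- (t / 2))"
  have h: "?h summable_on UNIV" using summable_on_int_powr[of "t / 2"] assms by simp
  have "(\<lambda>x. norm x powr (-t)) summable_on range ?f"
  proof (subst summable_on_reindex)
    show "inj ?f" by (auto simp: inj_on_def O_coeffs_eq_iff)
    have "(\<lambda>(m, n). ?h m * ?h n) summable_on UNIV \<times> UNIV"
    proof (rule summable_on_SigmaI[where g = "\<lambda>m. ?h m * infsum ?h UNIV"])
      show "((\<lambda>n. case (m, n) of (m, n) \<Rightarrow> ?h m * ?h n) has_sum ?h m * infsum ?h UNIV) UNIV" for m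
        using has_sum_cmult_right[OF has_sum_infsum[OF h]] by simp
      show "(\<lambda>m. ?h m * infsum ?h UNIV) summable_on UNIV"
        by (rule summable_on_cmult_left[OF h])
    qed auto
    hence "(\<lambda>x. 8 powr (t / 2) * (case x of (m, n) \<Rightarrow> ?h m * ?h n)) summable_on UNIV"
      by (intro summable_on_cmult_right) simp
    thus "((\<lambda>x. norm x powr - t) \<circ> ?f) summable_on UNIV"
    proof (rule summable_on_comparison_test, goal_cases)
      case (1 x)
      obtain m n where x: "x = (m, n)" by force
      show ?case
      proof (cases "x = (0, 0)")
        case False
        let ?a = "real_of_int \<bar>m\<bar>" and ?b = "real_of_int \<bar>n\<bar>"
        let ?N = "norm (of_int m + of_int n * \<omega>)"
        have nz: "?N > 0" using False O_coeffs_eq_iff[of m n 0 0] by (auto simp: x)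
        have "(1 + ?a) * (1 + ?b) \<le> 4 * (?a\<^sup>2 + ?b\<^sup>2)"
        proof -
          have "\<bar>m\<bar> \<ge> 1 \<or> \<bar>n\<bar> \<ge> 1" using False by (auto simp: x)
          hence "?a \<ge> 1 \<or> ?b \<ge> 1" by linarith
          hence "?a\<^sup>2 \<ge> 1 \<or> ?b\<^sup>2 \<ge> 1" using one_le_power[of ?a 2] one_le_power[of ?b 2] by argo
          hence "?a\<^sup>2 + ?b\<^sup>2 \<ge> 1" by (smt (verit) zero_le_power2)
          moreover have "2 * ?a \<le> ?a\<^sup>2 + 1" "2 * ?b \<le> ?b\<^sup>2 + 1" "2 * (?a * ?b) \<le> ?a\<^sup>2 + ?b\<^sup>2"
            using sum_squares_bound[of ?a 1] sum_squares_bound[of ?b 1] sum_squares_bound[of ?a ?b]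
            by auto
          ultimately show ?thesis by (simp add: algebra_simps)
        qed
        also have "\<dots> \<le> 8 * ?N\<^sup>2" using norm_sq_O_bound[of m n] by simp
        finally have le: "(1 + ?a) * (1 + ?b) \<le> 8 * ?N\<^sup>2" .
        have "?N powr (-t) = (?N powr 2) powr (-(t/2))" by (subst powr_powr) simp
        also have "?N powr 2 = ?N\<^sup>2" using nz by simp
        also have "(?N\<^sup>2) powr (-(t/2)) = 8 powr (t / 2) * (8 * ?N\<^sup>2) powr (-(t/2))"
          by (subst powr_mult) (auto simp: powr_minus field_simps)
        also have "\<dots> \<le> 8 powr (t / 2) * ((1 + ?a) * (1 + ?b)) powr (-(t/2))"
          by (intro mult_left_mono powr_mono2' le mult_pos_pos) (use assms in auto)
        also have "\<dots> = 8 powr (t / 2) * (?h m * ?h n)"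
          by (subst powr_mult) auto
        finally show ?thesis by (simp add: x)
      qed (auto simp: x)
    qed auto
  qed
  also have "range ?f = \<O>" by (auto simp: \<O>_def image_iff)
  finally show ?thesis .
qed

text \<open>A majorant for sums over a shifted lattice: \<open>norm x - r / 2\<close> bounds
  \<open>norm (z + x)\<close> from below when \<open>norm z \<le> r / 2\<close>, and it is at least
  \<open>norm x / 2\<close> once \<open>norm x > r\<close>.\<close>

lemma summable_on_O_shift:
  assumes "t > 2" "r > 0"
  shows "(\<lambda>x. (if norm x \<le> r then 0 else (norm x - r/2) powr (-t))) summable_on \<O>"
proof (rule summable_on_comparison_test[OF summable_on_cmult_right[OF summable_on_O_powr[OF assms(1)], of "2 powr t"]])
  fix x assume "x \<in> \<O>"
  have "(norm x - r/2) powr (-t) \<le> (norm x / 2) powr (-t)" if "\<not> norm x \<le> r"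
    using that \<open>r > 0\<close> assms by (intro powr_mono2') auto
  also have "(norm x / 2) powr (-t) = 2 powr t * norm x powr (-t)"
    by (subst powr_divide) (auto simp: powr_minus field_simps)
  finally show "(if norm x \<le> r then 0 else (norm x - r/2) powr (-t)) \<le> 2 powr t * norm x powr (-t)"
    by auto
qed auto

text \<open>A local Weierstrass test. The finite set \<open>F\<close> takes up the lattice points
  near \<open>z\<close>, where decay estimates fail; their terms are bounded by continuity on the
  compact disc.\<close>

lemma holomorphic_on_infsum:
  fixes f :: "'a \<Rightarrow> complex \<Rightarrow> complex"
  assumes "open S" and hol: "\<And>i. i \<in> I \<Longrightarrow> f i holomorphic_on S"
    and bound: "\<And>z. z \<in> S \<Longrightarrow> \<exists>r>0. \<exists>F M. cball z r \<subseteq> S \<and> finite F \<and> M summable_on I \<and>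
                  (\<forall>i\<in>I - F. \<forall>w\<in>cball z r. norm (f i w) \<le> M i)"
  shows "(\<lambda>z. \<Sum>\<^sub>\<infinity>i\<in>I. f i z) holomorphic_on S"
    and "z \<in> S \<Longrightarrow> (\<lambda>i. f i z) summable_on I"
proof -
  have *: "(\<lambda>z. \<Sum>\<^sub>\<infinity>i\<in>I. f i z) holomorphic_on ball z r \<and> (\<lambda>i. f i z) summable_on I"
    if z: "z \<in> S" and r: "r > 0" "cball z r \<subseteq> S" and FM: "finite F" "M summable_on I"
      "\<forall>i\<in>I - F. \<forall>w\<in>cball z r. norm (f i w) \<le> M i" for z r F M
  proof -
    have "\<exists>B. \<forall>w\<in>cball z r. norm (f i w) \<le> B" if "i \<in> I" for i
    proof -
      have "continuous_on (cball z r) (f i)"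
        using hol[OF that] r(2) holomorphic_on_imp_continuous_on continuous_on_subset by blast
      hence "bounded (f i ` cball z r)" by (intro compact_imp_bounded compact_continuous_image) auto
      thus ?thesis by (auto simp: bounded_iff)
    qed
    then obtain B where B: "\<And>i w. i \<in> I \<Longrightarrow> w \<in> cball z r \<Longrightarrow> norm (f i w) \<le> B i" by metis
    define M' where "M' = (\<lambda>i. if i \<in> F then B i else M i)"
    have le: "norm (f i w) \<le> M' i" if "i \<in> I" "w \<in> cball z r" for i w
      using that B FM(3) by (auto simp: M'_def)
    have "M' summable_on I"
    proof -
      have "M' summable_on (I - F)"
        by (subst summable_on_cong[of _ _ M]) (auto simp: M'_def intro: summable_on_subset[OF FM(2)])
      moreover have "M' summable_on (I \<inter> F)" using FM by (intro summable_on_finite) auto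
      ultimately have "M' summable_on (I - F) \<union> (I \<inter> F)" by (rule summable_on_union)
      moreover have "(I - F) \<union> (I \<inter> F) = I" by blast
      ultimately show ?thesis by simp
    qed
    have ul: "uniform_limit (cball z r) (\<lambda>X y. \<Sum>i\<in>X. f i y) (\<lambda>y. \<Sum>\<^sub>\<infinity>i\<in>I. f i y) (finite_subsets_at_top I)"
      by (rule Weierstrass_m_test_general[OF le \<open>M' summable_on I\<close>])
    have "\<forall>\<^sub>F X in finite_subsets_at_top I. continuous_on (cball z r) (\<lambda>y. \<Sum>i\<in>X. f i y) \<and>
            (\<lambda>y. \<Sum>i\<in>X. f i y) holomorphic_on ball z r"
    proof (rule eventually_finite_subsets_at_top_weakI)
      fix X assume "finite X" "X \<subseteq> I"
      hence "(\<lambda>y. \<Sum>i\<in>X. f i y) holomorphic_on S" by (intro holomorphic_intros hol) auto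
      from holomorphic_on_subset[OF this r(2)]
        holomorphic_on_subset[OF this order_trans[OF ball_subset_cball r(2)]]
      show "continuous_on (cball z r) (\<lambda>y. \<Sum>i\<in>X. f i y) \<and> (\<lambda>y. \<Sum>i\<in>X. f i y) holomorphic_on ball z r"
        by (blast intro: holomorphic_on_imp_continuous_on)
    qed
    from holomorphic_uniform_limit[OF this ul] have "(\<lambda>z. \<Sum>\<^sub>\<infinity>i\<in>I. f i z) holomorphic_on ball z r"
      by simp
    moreover have "(\<lambda>i. norm (f i z)) summable_on I"
      by (rule summable_on_comparison_test[OF \<open>M' summable_on I\<close>]) (use le r(1) in auto)
    hence "(\<lambda>i. f i z) summable_on I" by (rule abs_summable_summable)
    ultimately show ?thesis by blast
  qed
  show "z \<in> S \<Longrightarrow> (\<lambda>i. f i z) summable_on I" using bound[of z] * by blast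
  have "\<exists>e>0. (\<lambda>z. \<Sum>\<^sub>\<infinity>i\<in>I. f i z) holomorphic_on ball z e" if "z \<in> S" for z
    using bound[OF that] *[OF that] by blast
  hence "(\<lambda>z. \<Sum>\<^sub>\<infinity>i\<in>I. f i z) analytic_on S" by (auto simp: analytic_on_def)
  thus "(\<lambda>z. \<Sum>\<^sub>\<infinity>i\<in>I. f i z) holomorphic_on S" by (rule analytic_imp_holomorphic)
qed

section \<open>An odd elliptic function\<close>

text \<open>Rounding the imaginary coordinate first and then the real one leaves a squared distance
  of at most 7/16 + 1/4. This serves both as Euclidean division and as the compact fundamental
  domain for Liouville's theorem.\<close>

lemma euclid_O: "\<exists>x\<in>\<O>. norm (z - x) < 1"
proof -
  define n where "n = round (2 * Im z / sqrt 7)"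
  define m where "m = round (Re z - n / 2)"
  let ?x = "of_int m + of_int n * \<omega>"
  have "\<bar>2 * Im z / sqrt 7 - n\<bar> \<le> 1/2" unfolding n_def using of_int_round_abs_le[of "2 * Im z / sqrt 7"] by linarith
  hence "\<bar>2 * Im z / sqrt 7 - n\<bar>\<^sup>2 \<le> (1/2)\<^sup>2" by (intro power_mono) auto
  moreover have "\<bar>2 * Im z / sqrt 7 - n\<bar>\<^sup>2 = 4/7 * (Im z - n * sqrt 7 / 2)\<^sup>2"
    by (simp add: power2_eq_square field_simps)
  ultimately have 1: "(Im z - n * sqrt 7 / 2)\<^sup>2 \<le> 7 / 16" by (simp add: power2_eq_square)
  have "\<bar>Re z - n / 2 - m\<bar> \<le> 1/2" unfolding m_def using of_int_round_abs_le[of "Re z - n / 2"] by linarith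
  hence "\<bar>Re z - n / 2 - m\<bar>\<^sup>2 \<le> (1/2)\<^sup>2" by (intro power_mono) auto
  hence 2: "(Re z - n / 2 - m)\<^sup>2 \<le> 1/4" by (simp add: power2_eq_square)
  have "(norm (z - ?x))\<^sup>2 = (Re z - n / 2 - m)\<^sup>2 + (Im z - n * sqrt 7 / 2)\<^sup>2"
    unfolding cmod_power2 by (simp add: \<omega>_def algebra_simps)
  also have "\<dots> < 1\<^sup>2" using 1 2 by simp
  finally have "norm (z - ?x) < 1" by (rule power2_less_imp_less) simp
  thus ?thesis by blast
qed

lemma open_Compl_O: "open (- \<O>)"
proof (rule Topological_Spaces.openI)
  fix z assume "z \<in> - \<O>"
  let ?F = "{x\<in>\<O>. norm x \<le> norm z + 1}"
  have "open (ball z 1 - ?F)" by (intro open_Diff finite_imp_closed finite_O_norm_le) auto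
  moreover have "z \<in> ball z 1 - ?F" using \<open>z \<in> - \<O>\<close> by simp
  moreover have "ball z 1 - ?F \<subseteq> - \<O>"
  proof (rule subsetI)
    fix w assume "w \<in> ball z 1 - ?F"
    moreover have "norm w \<le> norm z + dist z w" using norm_triangle_ineq3[of w z] by (simp add: dist_norm norm_minus_commute)
    ultimately show "w \<in> - \<O>" by auto
  qed
  ultimately show "\<exists>T. open T \<and> z \<in> T \<and> T \<subseteq> - \<O>" by (intro exI[of _ "ball z 1 - ?F"] conjI)
qed

section \<open>The sign character and second differences\<close>

definition \<kappa> :: "complex \<Rightarrow> complex" where
  "\<kappa> x = (if \<exists>m n. x = of_int m + of_int n * \<omega> \<and> even m then 1 else -1)"

lemma kappa_eq: "\<kappa> (of_int m + of_int n * \<omega>) = (if even m then 1 else -1)"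
  unfolding \<kappa>_def O_coeffs_eq_iff by auto

lemma kappa_add: "x \<in> \<O> \<Longrightarrow> y \<in> \<O> \<Longrightarrow> \<kappa> (x + y) = \<kappa> x * \<kappa> y"
proof (elim in_O_E)
  fix m n k l assume xy: "x = of_int m + of_int n * \<omega>" "y = of_int k + of_int l * \<omega>"
  have "x + y = of_int (m + k) + of_int (n + l) * \<omega>" by (simp add: xy algebra_simps)
  thus ?thesis unfolding xy by (simp only: kappa_eq) auto
qed

text \<open>The residue field modulo \<open>\<omega>\<close> has two elements, so a product lies in
  \<open>\<omega> \<O>\<close> exactly if a factor does. In coordinates: \<open>m k - 2 n l\<close>
  has the parity of \<open>m k\<close>.\<close>

lemma kappa_mult: "x \<in> \<O> \<Longrightarrow> y \<in> \<O> \<Longrightarrow> \<kappa> (x * y) = (if \<kappa> x = 1 then 1 else \<kappa> y)"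
proof (elim in_O_E)
  fix m n k l assume xy: "x = of_int m + of_int n * \<omega>" "y = of_int k + of_int l * \<omega>"
  have "x * y = of_int (m * k) + of_int (m * l + n * k) * \<omega> + of_int (n * l) * (\<omega> * \<omega>)"
    by (simp add: xy algebra_simps)
  also have "\<dots> = of_int (m * k - 2 * n * l) + of_int (m * l + n * k + n * l) * \<omega>"
    unfolding omega_sq by (simp add: algebra_simps)
  finally show ?thesis unfolding xy by (simp only: kappa_eq) auto
qed

lemma kappa_cases: "\<kappa> x = 1 \<or> \<kappa> x = -1" and norm_kappa [simp]: "norm (\<kappa> x) = 1"
  and kappa_sq [simp]: "\<kappa> x * \<kappa> x = 1"
  by (auto simp: \<kappa>_def)

lemma kappa_of_int: "\<kappa> (of_int m) = (if even m then 1 else -1)"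
  using kappa_eq[of m 0] by simp

lemma kappa_simps [simp]: "\<kappa> 0 = 1" "\<kappa> 1 = -1" "\<kappa> (-1) = -1" "\<kappa> \<omega> = 1" "\<kappa> (1 - \<omega>) = -1"
  using kappa_eq[of 0 0] kappa_eq[of 1 0] kappa_eq[of "-1" 0] kappa_eq[of 0 1] kappa_eq[of 1 "-1"] by simp_all

lemma kappa_minus: "x \<in> \<O> \<Longrightarrow> \<kappa> (- x) = \<kappa> x"
  using kappa_mult[of "-1" x] by simp

definition second_diff :: "(complex \<Rightarrow> complex) \<Rightarrow> complex \<Rightarrow> complex" where
  "second_diff f u = f (u + 1) - 2 * f u + f (u - 1)"

lemma second_diff_inverse_minus: "second_diff inverse (- u) = - second_diff inverse u"
proof -
  have "- u + 1 = - (u - 1)" "- u - 1 = - (u + 1)" by simp_all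
  thus ?thesis by (simp only: second_diff_def inverse_minus_eq) (simp add: algebra_simps)
qed

text \<open>The second difference is exactly \<open>2 / (u (u^2 - 1))\<close>. The exponent 3
  exceeds 2, the threshold for absolute convergence over the lattice.\<close>

lemma norm_second_diff_inverse:
  assumes "norm u \<ge> 2"
  shows "norm (second_diff inverse u) \<le> 4 * norm u powr (-3)"
proof -
  have "u \<noteq> 0" "u \<noteq> 1" "u \<noteq> -1" using assms by auto
  hence *: "u + 1 \<noteq> 0" "u - 1 \<noteq> 0" "u \<noteq> 0" by (auto simp: eq_neg_iff_add_eq_0)
  have sq: "norm (u\<^sup>2 - 1) \<ge> norm u ^ 2 / 2"
  proof -
    have "norm u ^ 2 \<ge> 2 ^ 2" using assms by (intro power_mono) auto
    moreover have "norm (u\<^sup>2 - 1) \<ge> norm (u\<^sup>2) - norm (1::complex)" by (rule norm_triangle_ineq2)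
    ultimately show ?thesis by (simp add: norm_power)
  qed
  have "u\<^sup>2 - 1 = (u + 1) * (u - 1)" by (simp add: power2_eq_square algebra_simps)
  hence ne: "u\<^sup>2 - 1 \<noteq> 0" using * by simp
  have "second_diff inverse u * (u * (u\<^sup>2 - 1)) = 2"
  proof -
    have "second_diff inverse u * (u * (u\<^sup>2 - 1)) = (inverse (u + 1) * (u + 1)) * (u * (u - 1))
        - 2 * (inverse u * u) * ((u + 1) * (u - 1)) + (inverse (u - 1) * (u - 1)) * (u * (u + 1))"
      unfolding second_diff_def \<open>u\<^sup>2 - 1 = _\<close> by (simp only: algebra_simps)
    also have "\<dots> = 2"
      by (simp only: left_inverse[OF *(1)] left_inverse[OF *(2)] left_inverse[OF *(3)])
         (simp add: algebra_simps)
    finally show ?thesis .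
  qed
  hence "second_diff inverse u = 2 / (u * (u\<^sup>2 - 1))" using * ne by (simp add: field_simps)
  hence "norm (second_diff inverse u) = 2 / (norm u * norm (u\<^sup>2 - 1))"
    by (simp add: norm_divide norm_mult)
  also have "\<dots> \<le> 2 / (norm u * (norm u ^ 2 / 2))"
    using * sq by (intro divide_left_mono mult_left_mono mult_pos_pos) (auto intro: less_le_trans[OF _ sq])
  also have "\<dots> = 4 * norm u powr (-3)"
    using * by (simp add: powr_minus field_simps power2_eq_square power3_eq_cube)
  finally show ?thesis .
qed

section \<open>The regularised lattice sum\<close>

definition H_sum :: "complex set \<Rightarrow> complex \<Rightarrow> complex" where
  "H_sum I z = (\<Sum>\<^sub>\<infinity>x\<in>I. \<kappa> x * second_diff inverse (z + x))"

text \<open>The factor normalises the principal part at 0 to \<open>1 / z\<close>: the second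
  differences at the lattice points 0, 1 and -1 contribute \<open>- 4 / z\<close> in total.\<close>

definition H :: "complex \<Rightarrow> complex" where
  "H z = - (1/4) * H_sum \<O> z"

text \<open>The index set is left free so that terms with poles at a given point can be split off.
  The excluded values 0, 1, -1 of \<open>z + x\<close> are the poles of the second
  difference.\<close>

lemma
  assumes "open S" "I \<subseteq> \<O>" and avoid: "\<And>x z. x \<in> I \<Longrightarrow> z \<in> S \<Longrightarrow> z + x \<notin> {0, 1, -1}"
  shows holomorphic_H_sum: "H_sum I holomorphic_on S"
    and summable_H_sum: "z \<in> S \<Longrightarrow> (\<lambda>x. \<kappa> x * second_diff inverse (z + x)) summable_on I"
proof -
  have hol: "(\<lambda>z. \<kappa> x * second_diff inverse (z + x)) holomorphic_on S" if "x \<in> I" for x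
    unfolding second_diff_def
    by (intro holomorphic_intros) (use avoid[OF that] in \<open>auto simp: add_eq_0_iff2 algebra_simps\<close>)
  have bnd: "\<exists>r>0. \<exists>F M. cball z r \<subseteq> S \<and> finite F \<and> M summable_on I \<and>
          (\<forall>x\<in>I - F. \<forall>w\<in>cball z r. norm (\<kappa> x * second_diff inverse (w + x)) \<le> M x)" if zS: "z \<in> S" for z
  proof -
    obtain r where r: "r > 0" "cball z r \<subseteq> S" using \<open>open S\<close> zS open_contains_cball by blast
    \<comment> \<open>With this \<open>t\<close> every \<open>w\<close> in the disc has
      \<open>norm w \<le> t / 2\<close>, so \<open>norm x > t\<close> gives
      \<open>norm (w + x) > t / 2 \<ge> 2\<close>, the range of the decay estimate.\<close>
    define t where "t = 2 * (norm z + r) + 4"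
    have t: "t \<ge> 4" using add_nonneg_pos[OF norm_ge_zero r(1), of z] by (simp add: t_def)
    define M where "M = (\<lambda>x::complex. 4 * (if norm x \<le> t then 0 else (norm x - t/2) powr (-3)))"
    have "(\<lambda>x. if norm x \<le> t then 0 else (norm x - t/2) powr (-3)) summable_on \<O>"
      by (rule summable_on_O_shift) (use t in auto)
    from summable_on_cmult_right[OF this, of 4] have "M summable_on \<O>"
      unfolding M_def .
    hence "M summable_on I" using assms(2) by (rule summable_on_subset)
    moreover have "norm (\<kappa> x * second_diff inverse (w + x)) \<le> M x"
      if "x \<in> I - {x\<in>\<O>. norm x \<le> t}" "w \<in> cball z r" for x w
    proof -
      have x: "norm x > t" using that assms(2) by auto
      have "norm w \<le> norm z + dist z w" using norm_triangle_ineq3[of w z] by (simp add: dist_norm norm_minus_commute)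
      hence "norm w \<le> t / 2" using that by (auto simp: t_def)
      moreover have "norm (w + x) \<ge> norm x - norm w" using norm_diff_ineq[of x w] by (simp add: add.commute)
      ultimately have ge: "norm (w + x) \<ge> norm x - t / 2" by linarith
      have "norm (\<kappa> x * second_diff inverse (w + x)) = norm (second_diff inverse (w + x))"
        by (simp add: norm_mult)
      also have "\<dots> \<le> 4 * norm (w + x) powr (-3)"
        by (rule norm_second_diff_inverse) (use ge x t in linarith)
      also have "\<dots> \<le> 4 * (norm x - t / 2) powr (-3)"
        by (intro mult_left_mono powr_mono2' ge) (use x t in auto)
      finally show ?thesis using x by (simp add: M_def)
    qed
    ultimately have "cball z r \<subseteq> S \<and> finite {x\<in>\<O>. norm x \<le> t} \<and> M summable_on I \<and>
        (\<forall>x\<in>I - {x\<in>\<O>. norm x \<le> t}. \<forall>w\<in>cball z r. norm (\<kappa> x * second_diff inverse (w + x)) \<le> M x)"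
      by (intro conjI ballI r finite_O_norm_le)
    with r(1) show ?thesis by (intro exI[of _ r] conjI[OF r(1)] exI[of _ "{x\<in>\<O>. norm x \<le> t}"] exI[of _ M])
  qed
  show "H_sum I holomorphic_on S"
    unfolding H_sum_def[abs_def] by (rule holomorphic_on_infsum[OF \<open>open S\<close> hol bnd])
  show "z \<in> S \<Longrightarrow> (\<lambda>x. \<kappa> x * second_diff inverse (z + x)) summable_on I"
    by (rule holomorphic_on_infsum(2)[OF \<open>open S\<close> hol bnd])
qed

lemma O_avoid: "x \<in> \<O> \<Longrightarrow> z \<in> - \<O> \<Longrightarrow> z + x \<notin> {0, 1, -1}"
proof
  assume *: "x \<in> \<O>" "z \<in> - \<O>" "z + x \<in> {0, 1, -1}"
  have "z = (z + x) - x" by simp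
  also have "\<dots> \<in> \<O>" using * by (intro O_intros(2)) auto
  finally show False using * by simp
qed

lemma holomorphic_H: "H holomorphic_on - \<O>"
  unfolding H_def[abs_def]
  by (intro holomorphic_intros holomorphic_H_sum[OF open_Compl_O]) (use O_avoid in auto)

lemma H_add:
  assumes "y \<in> \<O>"
  shows "H (z + y) = \<kappa> y * H z"
proof -
  have "H_sum \<O> (z + y) = (\<Sum>\<^sub>\<infinity>x\<in>\<O>. \<kappa> (x - y) * second_diff inverse (z + x))"
    unfolding H_sum_def
    by (rule infsum_reindex_bij_witness[of _ "\<lambda>x. x - y" "\<lambda>x. x + y"])
       (use assms in \<open>auto simp: algebra_simps\<close>)
  also have "\<dots> = (\<Sum>\<^sub>\<infinity>x\<in>\<O>. \<kappa> y * (\<kappa> x * second_diff inverse (z + x)))"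
  proof (rule infsum_cong)
    fix x assume "x \<in> \<O>"
    hence "\<kappa> (x + (-y)) = \<kappa> x * \<kappa> y" using assms by (subst kappa_add) (auto simp: kappa_minus)
    thus "\<kappa> (x - y) * second_diff inverse (z + x) = \<kappa> y * (\<kappa> x * second_diff inverse (z + x))"
      by simp
  qed
  also have "\<dots> = \<kappa> y * H_sum \<O> z" unfolding H_sum_def by (rule infsum_cmult_right')
  finally show ?thesis by (simp add: H_def)
qed

lemma H_minus: "H (- z) = - H z"
proof -
  have "H_sum \<O> (- z) = (\<Sum>\<^sub>\<infinity>x\<in>\<O>. - (\<kappa> x * second_diff inverse (z + x)))"
    unfolding H_sum_def
  proof (rule infsum_reindex_bij_witness[of _ "\<lambda>x. - x" "\<lambda>x. - x"])
    fix x assume "x \<in> \<O>"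
    thus "- (\<kappa> (- x) * second_diff inverse (z + - x)) = \<kappa> x * second_diff inverse (- z + x)"
      using second_diff_inverse_minus[of "z - x"] by (simp add: kappa_minus)
  qed auto
  also have "\<dots> = - H_sum \<O> z" unfolding H_sum_def by (rule infsum_uminus)
  finally show ?thesis by (simp add: H_def)
qed

text \<open>Only the terms at 0, 1 and -1 have poles at 0. Oddness removes the constant term of the
  remainder, whence the form \<open>z * Q z\<close>; in the multiplication formula this zero absorbs
  a further simple pole.\<close>

lemma H_near_0:
  obtains Q where "Q holomorphic_on ball 0 1"
    "\<And>z. z \<in> ball 0 1 \<Longrightarrow> z \<noteq> 0 \<Longrightarrow> H z = 1 / z + z * Q z"
proof -
  let ?I = "\<O> - {0, 1, -1}"
  have avoid: "z + x \<notin> {0, 1, -1}" if "x \<in> ?I" "z \<in> ball 0 1" for x z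
  proof
    assume zx: "z + x \<in> {0, 1, -1}"
    hence "z + x \<in> \<O>" by auto
    hence "z + x - x \<in> \<O>" using that by (intro O_intros(2)) auto
    hence "z \<in> \<O>" by simp
    with that norm_O_ge_1[of z] have "z = 0" by fastforce
    with that zx show False by auto
  qed
  define R where "R = (\<lambda>z. - (1/4) * (3 / (z + 1) + 3 / (z - 1) - 1 / (z + 2) - 1 / (z - 2) + H_sum ?I z))"
  have ne: "z + 1 \<noteq> 0" "z - 1 \<noteq> 0" "z + 2 \<noteq> 0" "z - 2 \<noteq> 0" if "z \<in> ball 0 1" for z :: complex
    using that by (auto simp: add_eq_0_iff2)
  have hol: "R holomorphic_on ball 0 1"
    unfolding R_def
    by (intro holomorphic_intros holomorphic_H_sum avoid ne) (auto simp: ne)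
  have HR: "H z = 1 / z + R z" if z: "z \<in> ball 0 1" "z \<noteq> 0" for z
  proof -
    let ?t = "\<lambda>x. \<kappa> x * second_diff inverse (z + x)"
    have sm: "?t summable_on ?I" by (rule summable_H_sum[OF open_ball[of 0 1] _ avoid]) (use z in auto)
    have "H_sum \<O> z = infsum ?t ({0, 1, -1} \<union> ?I)"
      unfolding H_sum_def by (rule arg_cong[of _ _ "infsum ?t"]) auto
    also have "\<dots> = infsum ?t {0, 1, -1} + infsum ?t ?I"
      using sm by (intro infsum_Un_disjoint) auto
    also have "infsum ?t {0, 1, -1} = second_diff inverse z - second_diff inverse (z + 1) - second_diff inverse (z - 1)"
      by simp
    also have "\<dots> = -4 / z + 3 / (z + 1) + 3 / (z - 1) - 1 / (z + 2) - 1 / (z - 2)"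
      by (simp add: second_diff_def divide_inverse algebra_simps)
    finally have "H_sum \<O> z =
        -4 / z + 3 / (z + 1) + 3 / (z - 1) - 1 / (z + 2) - 1 / (z - 2) + H_sum ?I z"
      by (simp only: H_sum_def)
    moreover have "- (1/4) * (-4 / z + a + b - c - d + e) = 1 / z + - (1/4) * (a + b - c - d + e)"
      for a b c d e :: complex by (simp add: algebra_simps)
    ultimately show ?thesis unfolding H_def R_def by metis
  qed
  have "R 0 = 0"
  proof -
    have "isCont R 0" using hol by (meson centre_in_ball holomorphic_on_imp_continuous_on continuous_on_eq_continuous_at open_ball zero_less_one)
    moreover have "isCont (\<lambda>z. R (- z)) 0"
    proof (rule isCont_o2[where g = R])
      show "isCont uminus (0::complex)" by (intro continuous_intros)
    qed (use \<open>isCont R 0\<close> in simp)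
    ultimately have "((\<lambda>z. R z + R (- z)) \<longlongrightarrow> R 0 + R (- 0)) (at 0)"
      unfolding isCont_def by (rule tendsto_add)
    moreover have "\<forall>\<^sub>F z in at 0. R z + R (- z) = 0"
    proof -
      have "\<forall>\<^sub>F z in at 0. z \<in> ball 0 1 - {0::complex}" by (rule eventually_at_in_open) auto
      thus ?thesis
      proof eventually_elim
        case (elim z)
        hence "R z = H z - 1 / z" "R (- z) = H (- z) - 1 / (- z)" using HR[of z] HR[of "- z"] by auto
        thus ?case by (simp add: H_minus)
      qed
    qed
    ultimately have "((\<lambda>z::complex. 0::complex) \<longlongrightarrow> R 0 + R (- 0)) (at 0)" by (rule Lim_transform_eventually)
    hence "0 = R 0 + R (- 0)" by (intro tendsto_unique[OF _ tendsto_const]) auto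
    thus ?thesis by simp
  qed
  let ?Q = "\<lambda>z. if z = 0 then deriv R 0 else (R z - R 0) / (z - 0)"
  have "?Q holomorphic_on ball 0 1" by (rule pole_lemma_open[OF hol]) simp
  thus ?thesis by (rule that) (use HR \<open>R 0 = 0\<close> in auto)
qed


section \<open>Liouville's theorem and multiplication by the conjugate of omega\<close>

lemma remove_sings_entire:
  assumes "\<And>a. \<exists>r>0. \<exists>g. g holomorphic_on ball a r \<and> (\<forall>z\<in>ball a r - {a}. f z = g z)"
  shows "remove_sings f holomorphic_on UNIV"
proof -
  have "\<exists>r>0. remove_sings f holomorphic_on ball a r" for a
  proof -
    obtain r g where r: "r > 0" and g: "g holomorphic_on ball a r" "\<forall>z\<in>ball a r - {a}. f z = g z"
      using assms by blast
    have "remove_sings f w = g w" if w: "w \<in> ball a r" for w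
    proof (rule remove_sings_eqI)
      have "isCont g w"
        using g(1) w holomorphic_on_imp_continuous_on continuous_on_eq_continuous_at open_ball by blast
      hence "(g \<longlongrightarrow> g w) (at w)" by (simp add: isCont_def)
      moreover have "\<forall>\<^sub>F z in at w. g z = f z"
      proof -
        have "\<forall>\<^sub>F z in at w. z \<in> ball a r - {w}" by (rule eventually_at_in_open) (use w in auto)
        moreover have "\<forall>\<^sub>F z in at w. z \<noteq> a"
          by (cases "w = a") (auto intro: eventually_neq_at_within)
        ultimately show ?thesis by eventually_elim (use g(2) in auto)
      qed
      ultimately show "(f \<longlongrightarrow> g w) (at w)" by (rule Lim_transform_eventually)
    qed
    hence "remove_sings f holomorphic_on ball a r \<longleftrightarrow> g holomorphic_on ball a r"
      by (intro holomorphic_cong) auto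
    thus ?thesis using g r by blast
  qed
  hence "remove_sings f analytic_on UNIV" by (auto simp: analytic_on_def)
  thus ?thesis by (rule analytic_imp_holomorphic)
qed

text \<open>\<open>\<omega> / 2\<close> and \<open>- \<omega> / 2\<close> differ by
  \<open>\<omega>\<close>, a period since \<open>\<kappa> \<omega> = 1\<close>, while
  \<open>H\<close> is odd.\<close>

lemma H_half_period: "H (\<omega> / 2) = 0"
  using H_add[of \<omega> "- (\<omega> / 2)"] H_minus[of "\<omega> / 2"] by simp

lemma half_omega_notin_O: "\<omega> / 2 \<notin> \<O>"
proof
  assume "\<omega> / 2 \<in> \<O>"
  with norm_O_ge_1[OF this] show False by (simp add: norm_divide norm_omega)
     (use sqrt2_less_2 in linarith)
qed

text \<open>As \<open>1 / (1 - \<omega>) = \<omega> / 2\<close>, the possible poles of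
  \<open>H ((1 - \<omega>) * z)\<close> form a lattice in which \<open>\<O>\<close> has index two,
  with \<open>\<omega> / 2\<close> representing the other coset.\<close>

lemma singular_cases:
  assumes "(1 - \<omega>) * z \<in> \<O>"
  obtains y where "y \<in> \<O>" "z = y" | y where "y \<in> \<O>" "z = \<omega> / 2 + y"
proof -
  obtain m n where mn: "(1 - \<omega>) * z = of_int m + of_int n * \<omega>" using assms by (rule in_O_E)
  have "2 * z = \<omega> * ((1 - \<omega>) * z)" by (simp only: mult.assoc[symmetric] omega_mult_conj)
  also have "\<dots> = of_int m * \<omega> + of_int n * (\<omega> * \<omega>)" unfolding mn by (simp add: algebra_simps)
  also have "\<dots> = of_int (m + n) * \<omega> - 2 * of_int n" unfolding omega_sq by (simp add: algebra_simps)
  finally have "2 * z / 2 = (of_int (m + n) * \<omega> - 2 * of_int n) / 2" by simp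
  hence z: "z = of_int (m + n) * \<omega> / 2 - of_int n" by (simp only: diff_divide_distrib) simp
  show ?thesis
  proof (cases "even (m + n)")
    case True
    then obtain k where "m + n = 2 * k" by (elim evenE)
    hence "z = of_int (- n) + of_int k * \<omega>" unfolding z by simp
    thus ?thesis using that(1) in_O_I by metis
  next
    case False
    then obtain k where "m + n = 2 * k + 1" using oddE by blast
    hence "z = \<omega> / 2 + (of_int (- n) + of_int k * \<omega>)" unfolding z by (simp add: field_simps)
    thus ?thesis using that(2) in_O_I by metis
  qed
qed

text \<open>
  The product below is \<open>\<O>\<close>-periodic; the poles of its first factor at \<open>\<omega> / 2 + \<O>\<close> are cancelled
  by zeros of \<open>H\<close>, so it is constant by Liouville's theorem.
\<close>

lemma H_isogeny:
  obtains c where "c \<noteq> 0"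
    "\<And>z. (1 - \<omega>) * z \<notin> \<O> \<Longrightarrow> H ((1 - \<omega>) * z) * H z = H z ^ 2 / (1 - \<omega>) + c"
proof -
  \<comment> \<open>At 0 the functions \<open>H ((1 - \<omega>) * z)\<close> and
    \<open>H z / (1 - \<omega>)\<close> have the same principal part, and their difference vanishes
    there. That zero absorbs the pole of the second factor.\<close>
  define P where "P = (\<lambda>z. (H ((1 - \<omega>) * z) - H z / (1 - \<omega>)) * H z)"
  obtain Q where Q: "Q holomorphic_on ball 0 1"
    "\<And>z. z \<in> ball 0 1 \<Longrightarrow> z \<noteq> 0 \<Longrightarrow> H z = 1 / z + z * Q z" using H_near_0 by metis
  let ?u = "1 - \<omega>"
  have u_small: "?u * z \<in> ball 0 1" if "z \<in> ball 0 (1/2)" for z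
  proof -
    have "norm (?u * z) \<le> sqrt 2 * (1/2)"
      unfolding norm_mult norm_omega by (intro mult_left_mono) (use that in auto)
    also have "\<dots> < 1" using sqrt2_less_2 by simp
    finally show ?thesis by simp
  qed
  have Qu: "(\<lambda>z. Q (?u * z)) holomorphic_on ball 0 r" if "r \<le> 1/2" for r
  proof -
    have "(Q \<circ> (\<lambda>z. ?u * z)) holomorphic_on ball 0 r"
      by (rule holomorphic_on_compose_gen[OF _ Q(1)]) (use u_small that in \<open>auto intro!: holomorphic_intros\<close>)
    thus ?thesis by (simp add: o_def)
  qed
  have P_add: "P (z + y) = P z" if "y \<in> \<O>" for z y
  proof -
    \<comment> \<open>\<open>1 - \<omega>\<close> lies outside the kernel, so both factors of
      \<open>P\<close> pick up the same sign \<open>\<kappa> y\<close>, and the signs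
      cancel.\<close>
    have "H (?u * (z + y)) = \<kappa> y * H (?u * z)"
      using that kappa_mult[of ?u y] H_add[of "?u * y" "?u * z"] by (simp add: algebra_simps)
    moreover have "H (z + y) = \<kappa> y * H z" using that by (rule H_add)
    ultimately have "P (z + y) = (\<kappa> y * \<kappa> y) * P z" unfolding P_def by (simp add: algebra_simps)
    thus ?thesis by simp
  qed
  have P_near_0: "P z = (?u * Q (?u * z) - Q z / ?u) * (1 + z\<^sup>2 * Q z)" if "z \<in> ball 0 (1/2) - {0}" for z
  proof -
    have 1: "H (?u * z) = 1 / (?u * z) + ?u * z * Q (?u * z)" using u_small[of z] that by (intro Q(2)) auto
    have 2: "H z = 1 / z + z * Q z" using that by (intro Q(2)) auto
    have "(1 / (u * z) + u * z * a - (1 / z + z * b) / u) * (1 / z + z * b) = (u * a - b / u) * (1 + z\<^sup>2 * b)"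
      if "u \<noteq> 0" "z \<noteq> 0" for u a b z :: complex
      using that by (simp add: field_simps power2_eq_square)
    from this[of ?u z] show ?thesis using that unfolding P_def 1 2 by simp
  qed
  obtain e K where e: "e > 0" "e \<le> 1/2" and K: "K holomorphic_on ball 0 e"
    "\<And>z. z \<in> ball 0 e \<Longrightarrow> H (\<omega> / 2 + z) = z * K z"
  proof -
    obtain e' where e': "e' > 0" "ball (\<omega> / 2) e' \<subseteq> - \<O>"
      using open_Compl_O half_omega_notin_O by (metis ComplI openE)
    define e where "e = min e' (1/2)"
    have "(H \<circ> (\<lambda>z. \<omega> / 2 + z)) holomorphic_on ball 0 e"
    proof (rule holomorphic_on_compose_gen[OF _ holomorphic_H])
      show "(\<lambda>z. \<omega> / 2 + z) ` ball 0 e \<subseteq> - \<O>"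
        using e'(2) by (force simp: e_def dist_norm)
    qed (intro holomorphic_intros)
    hence hol: "(\<lambda>z. H (\<omega> / 2 + z)) holomorphic_on ball 0 e" by (simp add: o_def)
    show ?thesis
    proof (rule that[of e])
      show "(\<lambda>z. if z = 0 then deriv (\<lambda>z. H (\<omega> / 2 + z)) 0 else (H (\<omega> / 2 + z) - H (\<omega> / 2 + 0)) / (z - 0))
        holomorphic_on ball 0 e" by (rule pole_lemma_open[OF hol]) simp
    qed (use e' in \<open>auto simp: e_def H_half_period\<close>)
  qed
  have Hu: "H (?u * (\<omega> / 2 + z)) = - (1 / (?u * z) + ?u * z * Q (?u * z))" if "z \<in> ball 0 e - {0}" for z
  proof -
    \<comment> \<open>\<open>(1 - \<omega>) \<omega> / 2 = 1\<close> is a lattice point of sign -1,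
      so the pole of \<open>H\<close> at 0 reappears at \<open>\<omega> / 2\<close> with the
      opposite sign.\<close>
    have "?u * (\<omega> / 2 + z) = ?u * z + 1" using omega_mult_conj by (simp add: algebra_simps)
    hence "H (?u * (\<omega> / 2 + z)) = - H (?u * z)" using H_add[of 1 "?u * z"] by simp
    also have "H (?u * z) = 1 / (?u * z) + ?u * z * Q (?u * z)" using u_small[of z] that e by (intro Q(2)) auto
    finally show ?thesis .
  qed
  have P_near_half: "P (\<omega> / 2 + z) = - (1 / ?u + ?u * z\<^sup>2 * Q (?u * z) + z\<^sup>2 * K z / ?u) * K z"
    if "z \<in> ball 0 e - {0}" for z
  proof -
    have 2: "H (\<omega> / 2 + z) = z * K z" using that by (intro K(2)) auto
    have "(- (1 / (u * z) + u * z * a) - z * b / u) * (z * b) = - (1 / u + u * z\<^sup>2 * a + z\<^sup>2 * b / u) * b"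
      if "u \<noteq> 0" "z \<noteq> 0" for u a b z :: complex
      using that by (simp add: field_simps power2_eq_square)
    from this[of ?u z] show ?thesis using that unfolding P_def Hu[OF that] 2 by simp
  qed
  define X where "X = {z. ?u * z \<in> \<O>}"
  have "open (- X)"
  proof -
    have "- X = (\<lambda>z. ?u * z) -` (- \<O>)" by (auto simp: X_def)
    thus ?thesis using open_Compl_O by (auto intro!: open_vimage continuous_intros)
  qed
  have X_O: "z \<notin> \<O>" if "z \<in> - X" for z using that by (auto simp: X_def)
  have P_hol: "P holomorphic_on - X"
  proof -
    have "(H \<circ> (\<lambda>z. ?u * z)) holomorphic_on - X"
      by (rule holomorphic_on_compose_gen[OF _ holomorphic_H]) (auto simp: X_def intro!: holomorphic_intros)
    moreover have "H holomorphic_on - X" using X_O by (intro holomorphic_on_subset[OF holomorphic_H]) auto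
    ultimately show ?thesis unfolding P_def o_def by (intro holomorphic_intros) auto
  qed
  define F where "F = remove_sings P"
  have "F holomorphic_on UNIV"
    unfolding F_def
  proof (rule remove_sings_entire)
    fix a
    show "\<exists>r>0. \<exists>g. g holomorphic_on ball a r \<and> (\<forall>z\<in>ball a r - {a}. P z = g z)"
    proof (cases "a \<in> X")
      case False
      then obtain r where "r > 0" "ball a r \<subseteq> - X" using \<open>open (- X)\<close> by (metis ComplI openE)
      thus ?thesis using holomorphic_on_subset[OF P_hol] by blast
    next
      case True
      have shift: "?thesis" if r: "r > 0" and g: "g holomorphic_on ball 0 r"
        and eq: "\<And>z. z \<in> ball 0 r - {0} \<Longrightarrow> P (a + z) = g z" for r g
      proof -
        have "(g \<circ> (\<lambda>z. z - a)) holomorphic_on ball a r"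
          by (rule holomorphic_on_compose_gen[OF _ g]) (auto intro!: holomorphic_intros simp: dist_norm norm_minus_commute)
        moreover have "\<forall>z\<in>ball a r - {a}. P z = (g \<circ> (\<lambda>z. z - a)) z"
          using eq[of "z - a" for z] by (auto simp: dist_norm norm_minus_commute)
        ultimately show ?thesis using r by blast
      qed
      from True have "?u * a \<in> \<O>" by (simp add: X_def)
      thus ?thesis
      proof (cases rule: singular_cases)
        case (1 y)
        show ?thesis
        proof (rule shift)
          show "(\<lambda>z. (?u * Q (?u * z) - Q z / ?u) * (1 + z\<^sup>2 * Q z)) holomorphic_on ball 0 (1/2)"
            by (intro holomorphic_intros Qu holomorphic_on_subset[OF Q(1)]) auto
          show "P (a + z) = (?u * Q (?u * z) - Q z / ?u) * (1 + z\<^sup>2 * Q z)" if "z \<in> ball 0 (1/2) - {0}" for z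
            using P_near_0[OF that] P_add[of y z] 1 by (simp add: add.commute)
        qed simp
      next
        case (2 y)
        show ?thesis
        proof (rule shift)
          show "(\<lambda>z. - (1 / ?u + ?u * z\<^sup>2 * Q (?u * z) + z\<^sup>2 * K z / ?u) * K z) holomorphic_on ball 0 e"
            by (intro holomorphic_intros Qu K e) auto
          show "P (a + z) = - (1 / ?u + ?u * z\<^sup>2 * Q (?u * z) + z\<^sup>2 * K z / ?u) * K z" if "z \<in> ball 0 e - {0}" for z
            using P_near_half[OF that] P_add[of y "\<omega> / 2 + z"] 2 by (simp add: algebra_simps)
        qed (use e in simp)
      qed
    qed
  qed
  moreover have "bounded (range F)"
  proof -
    have "F (z + y) = F z" if "y \<in> \<O>" for z y
    proof -
      have "(\<lambda>w. P (z + y + w)) = (\<lambda>w. P (z + w))"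
        using P_add[OF that, of "z + w" for w] by (intro ext) (simp add: add_ac)
      thus ?thesis unfolding F_def using remove_sings_shift_0[of P "z + y"] remove_sings_shift_0[of P z] by simp
    qed
    hence "range F \<subseteq> F ` cball 0 1"
    proof safe
      fix z
      obtain x where x: "x \<in> \<O>" "norm (z - x) < 1" using euclid_O by blast
      hence "F z = F (z - x)" using \<open>\<And>z y. y \<in> \<O> \<Longrightarrow> F (z + y) = F z\<close>[of x "z - x"] by simp
      thus "F z \<in> F ` cball 0 1" using x by auto
    qed
    moreover have "compact (F ` cball 0 1)"
      using \<open>F holomorphic_on UNIV\<close>
      by (intro compact_continuous_image holomorphic_on_imp_continuous_on) (auto intro: holomorphic_on_subset)
    ultimately show ?thesis using bounded_subset compact_imp_bounded by blast
  qed
  ultimately obtain c where c: "\<And>z. F z = c" using Liouville_theorem by (metis UNIV_I constant_on_def)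
  have Pc: "P z = c" if "z \<in> - X" for z
  proof -
    have "P analytic_on {z}" using P_hol that \<open>open (- X)\<close> by (meson analytic_on_holomorphic analytic_on_subset empty_subsetI insert_subset order_refl)
    thus ?thesis using c[of z] by (simp add: F_def)
  qed
  \<comment> \<open>If the product were identically 0, then near \<open>\<omega> / 2\<close>, where
    its first factor has a genuine pole, the second factor \<open>H\<close> would vanish. By the
    identity theorem \<open>H\<close> would be 0 off the lattice, against its pole at 0.\<close>
  have "c \<noteq> 0"
  proof
    assume "c = 0"
    have near: "\<forall>\<^sub>F z in at 0. H (\<omega> / 2 + z) = 0"
    proof -
      let ?g = "\<lambda>z. - (1 / ?u + ?u * z\<^sup>2 * Q (?u * z) + z\<^sup>2 * K z / ?u)"
      have "?g holomorphic_on ball 0 e" by (intro holomorphic_intros Qu K e) auto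
      hence "isCont ?g 0" using e(1)
        by (meson centre_in_ball holomorphic_on_imp_continuous_on continuous_on_eq_continuous_at open_ball)
      hence "(?g \<longlongrightarrow> ?g 0) (at 0)" by (simp add: isCont_def)
      moreover have "?g 0 \<noteq> 0" by simp
      ultimately have "\<forall>\<^sub>F z in at 0. ?g z \<noteq> 0" by (rule tendsto_imp_eventually_ne)
      moreover have "\<forall>\<^sub>F z in at 0. z \<in> ball 0 e - {0::complex}" by (rule eventually_at_in_open) (use e in auto)
      ultimately show ?thesis
      proof eventually_elim
        case (elim z)
        have "\<omega> / 2 + z \<notin> X"
        proof
          assume "\<omega> / 2 + z \<in> X"
          hence *: "?u * (\<omega> / 2 + z) \<in> \<O>" by (simp add: X_def)
          have "?u * z = ?u * (\<omega> / 2 + z) - 1" using omega_mult_conj by (simp add: algebra_simps)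
          also have "\<dots> \<in> \<O>" using * by blast
          finally have "norm (?u * z) \<ge> 1" using elim by (intro norm_O_ge_1) auto
          thus False using u_small[of z] elim e by auto
        qed
        hence "P (\<omega> / 2 + z) = 0" using Pc \<open>c = 0\<close> by simp
        hence "K z = 0" using P_near_half[of z] elim by auto
        thus ?case using K(2)[of z] elim by auto
      qed
    qed
    have "H w = 0" if "w \<in> - \<O>" for w
    proof -
      from near obtain d where d: "d > 0" "\<And>z. z \<noteq> 0 \<Longrightarrow> norm z < d \<Longrightarrow> H (\<omega> / 2 + z) = 0"
        by (auto simp: eventually_at dist_norm)
      have zero: "H z = 0" if "z \<in> ball (\<omega> / 2) d" for z
      proof (cases "z = \<omega> / 2")
        case True
        thus ?thesis by (simp only: H_half_period)
      next
        case False
        thus ?thesis using d(2)[of "z - \<omega> / 2"] that by (auto simp: dist_norm norm_minus_commute)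
      qed
      have "countable \<O>"
      proof -
        have "\<O> = (\<lambda>(m, n). of_int m + of_int n * \<omega>) ` UNIV" by (auto simp: \<O>_def image_iff)
        thus ?thesis by (metis countableI_type countable_image)
      qed
      hence "connected (- \<O>)" by (intro path_connected_imp_connected path_connected_complement_countable) auto
      moreover have "\<omega> / 2 islimpt (ball (\<omega> / 2) d \<inter> - \<O>)"
        using d(1) open_Compl_O half_omega_notin_O
        by (intro interior_limit_point) (simp add: interior_open open_Int)
      ultimately show ?thesis
        by (intro analytic_continuation[OF holomorphic_H open_Compl_O, of "ball (\<omega> / 2) d \<inter> - \<O>" "\<omega> / 2" w])
           (use zero half_omega_notin_O that in auto)
    qed
    moreover have "\<exists>z. z \<notin> \<O> \<and> H z \<noteq> 0"
    proof -
      have "isCont Q 0" using Q(1)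
        by (meson centre_in_ball holomorphic_on_imp_continuous_on continuous_on_eq_continuous_at open_ball zero_less_one)
      hence "((\<lambda>z. 1 + z\<^sup>2 * Q z) \<longlongrightarrow> 1 + 0\<^sup>2 * Q 0) (at 0)"
        unfolding isCont_def by (intro tendsto_intros)
      hence "\<forall>\<^sub>F z in at 0. 1 + z\<^sup>2 * Q z \<noteq> 0" by (rule tendsto_imp_eventually_ne) simp
      moreover have "\<forall>\<^sub>F z in at 0. z \<in> ball 0 1 - {0::complex}" by (rule eventually_at_in_open) auto
      ultimately have "\<forall>\<^sub>F z in at (0::complex). z \<notin> \<O> \<and> H z \<noteq> 0"
      proof eventually_elim
        case (elim z)
        hence "H z = (1 + z\<^sup>2 * Q z) / z" using Q(2)[of z] by (auto simp: field_simps power2_eq_square)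
        thus ?case using elim norm_O_ge_1[of z] by auto
      qed
      thus ?thesis using eventually_happens' at_neq_bot by blast
    qed
    ultimately show False by auto
  qed
  moreover have "H (?u * z) * H z = H z ^ 2 / ?u + c" if "?u * z \<notin> \<O>" for z
    using Pc[of z] that unfolding P_def X_def by (simp add: algebra_simps power2_eq_square)
  ultimately show ?thesis by (rule that)
qed

section \<open>Ideals and norms\<close>

definition princ :: "complex \<Rightarrow> complex set" where "princ \<alpha> = (\<lambda>x. x * \<alpha>) ` \<O>"

lemma in_princ_iff: "y \<in> princ \<alpha> \<longleftrightarrow> (\<exists>x\<in>\<O>. y = x * \<alpha>)"
  by (auto simp: princ_def)

text \<open>Euclidean division by a nonzero element of least norm. Stated for bare subsets of
  \<open>\<O>\<close> because it is applied before \<open>\<O>\<close> is known to be the carrier of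
  \<open>OK\<close>.\<close>

lemma O_subset_closed_principal:
  assumes "I \<subseteq> \<O>" "0 \<in> I" and diff: "\<And>x y. x \<in> I \<Longrightarrow> y \<in> I \<Longrightarrow> x - y \<in> I"
    and mult: "\<And>x y. x \<in> \<O> \<Longrightarrow> y \<in> I \<Longrightarrow> x * y \<in> I"
  obtains \<alpha> where "\<alpha> \<in> I" "I = princ \<alpha>"
proof (cases "I = {0}")
  case True
  thus ?thesis using that[of 0] by (auto simp: princ_def intro!: image_eqI[of _ _ 0])
next
  case False
  then obtain x0 where x0: "x0 \<in> I" "x0 \<noteq> 0" using \<open>0 \<in> I\<close> by auto
  let ?F = "{x\<in>I. x \<noteq> 0 \<and> norm x \<le> norm x0}"
  have "finite ?F" by (rule finite_subset[OF _ finite_O_norm_le[of "norm x0"]]) (use assms(1) in auto)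
  moreover have "?F \<noteq> {}" using x0 by auto
  ultimately obtain \<alpha> where \<alpha>: "\<alpha> \<in> ?F" "\<And>x. x \<in> ?F \<Longrightarrow> norm \<alpha> \<le> norm x"
    using ex_min_if_finite[of "norm ` ?F"] by (metis (no_types, lifting) arg_min_if_finite linorder_not_less)
  have min: "norm \<alpha> \<le> norm x" if "x \<in> I" "x \<noteq> 0" for x
    using \<alpha>(1) \<alpha>(2)[of x] that by (cases "norm x \<le> norm x0") auto
  have "I \<subseteq> princ \<alpha>"
  proof
    fix y assume y: "y \<in> I"
    obtain q where q: "q \<in> \<O>" "norm (y / \<alpha> - q) < 1" using euclid_O by blast
    have "y - q * \<alpha> = (y / \<alpha> - q) * \<alpha>" using \<alpha>(1) by (simp add: algebra_simps)
    hence "norm (y - q * \<alpha>) < norm \<alpha>" using q(2) \<alpha>(1) by (simp add: norm_mult)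
    moreover have "y - q * \<alpha> \<in> I" using y q \<alpha>(1) by (intro diff mult) auto
    ultimately have "y - q * \<alpha> = 0" using min by force
    thus "y \<in> princ \<alpha>" using q by (auto simp: in_princ_iff)
  qed
  moreover have "princ \<alpha> \<subseteq> I" using \<alpha>(1) mult by (auto simp: princ_def)
  ultimately show ?thesis using that[of \<alpha>] \<alpha>(1) by auto
qed

section \<open>Identification of the ring of integers\<close>

lemma csqrt_minus_7: "csqrt (-7) = 2 * \<omega> - 1"
  by (subst csqrt_of_real_nonpos) (auto simp: \<omega>_def complex_eq_iff)

lemma K_common_denominator:
  assumes "x \<in> K"
  obtains N :: int where "N \<noteq> 0" "of_int N * x \<in> \<O>"
proof -
  obtain a b where x: "x = of_rat a + of_rat b * csqrt (-7)" using assms by (auto simp: K_def)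
  obtain a1 a2 b1 b2 where ab: "a = Fract a1 a2" "a2 > 0" "b = Fract b1 b2" "b2 > 0"
    by (metis Rat_cases)
  have "of_int (a2 * b2) * x = of_int (a1 * b2 - b1 * a2) + of_int (2 * b1 * a2) * \<omega>"
    using ab(2,4) unfolding x ab csqrt_minus_7 by (simp add: of_rat_rat field_simps)
  thus ?thesis using that[of "a2 * b2"] ab by (metis in_O_I less_irrefl mult_pos_pos)
qed

text \<open>For a common denominator \<open>c\<close> of all powers of \<open>x\<close>, the set
  \<open>J = c \<O>[x]\<close> is an ideal of \<open>\<O>\<close> stable under multiplication by
  \<open>x\<close>. It has a generator \<open>\<delta>\<close>, and
  \<open>x * \<delta> = y * \<delta>\<close> with \<open>y\<close> in \<open>\<O>\<close> gives
  \<open>x = y\<close>.\<close>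

lemma O_integrally_closed:
  assumes "x \<in> K" "algebraic_int x"
  shows "x \<in> \<O>"
proof -
  obtain N where N: "N \<noteq> 0" "of_int N * x \<in> \<O>" using K_common_denominator assms(1) .
  obtain p where p: "lead_coeff p = 1" "\<And>i. coeff p i \<in> \<int>" "poly p x = 0"
    using assms(2) by (auto elim: algebraic_int.cases)
  let ?n = "degree p"
  \<comment> \<open>This power of \<open>N\<close> clears the denominators of \<open>x ^ i\<close>
    for \<open>i\<close> below the degree; the monic equation reduces all higher powers to
    these.\<close>
  define c :: complex where "c = of_int N ^ ?n"
  have c: "c \<noteq> 0" "c \<in> \<O>" using N by (auto simp: c_def)
  have pc: "coeff p i \<in> \<O>" for i using p(2)[of i] by (auto elim: Ints_cases)
  have pow: "c * x ^ i \<in> \<O>" for i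
  proof (induction i rule: less_induct)
    case (less i)
    show ?case
    proof (cases "i < ?n")
      case True
      hence "c * x ^ i = of_int N ^ (?n - i) * (of_int N * x) ^ i"
        by (simp add: c_def power_mult_distrib power_add[symmetric])
      thus ?thesis using N by auto
    next
      case False
      have "poly p x = (\<Sum>j<?n. coeff p j * x ^ j) + x ^ ?n"
        using p(1) by (simp add: poly_altdef lessThan_Suc_atMost[symmetric])
      hence "x ^ ?n = - (\<Sum>j<?n. coeff p j * x ^ j)" using p(3) by (simp add: eq_neg_iff_add_eq_0 add.commute)
      moreover have "x ^ i = x ^ (i - ?n) * x ^ ?n" using False by (simp add: power_add[symmetric])
      ultimately have "c * x ^ i = - (\<Sum>j<?n. coeff p j * (c * x ^ (i - ?n + j)))"
        by (simp add: sum_distrib_left power_add mult_ac)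
      also have "\<dots> \<in> \<O>"
        by (intro O_intros is_subring_sum[OF is_subring_O] pc less) (use False in auto)
      finally show ?thesis .
    qed
  qed
  define J where "J = {c * poly q x | q. \<forall>i. coeff q i \<in> \<O>}"
  have "J \<subseteq> \<O>"
  proof
    fix y assume "y \<in> J"
    then obtain q where q: "y = c * poly q x" "\<And>i. coeff q i \<in> \<O>" by (auto simp: J_def)
    have "y = (\<Sum>i\<le>degree q. coeff q i * (c * x ^ i))"
      unfolding q poly_altdef by (simp add: sum_distrib_left mult_ac)
    thus "y \<in> \<O>" using q pow by (auto intro!: is_subring_sum[OF is_subring_O])
  qed
  moreover have "0 \<in> J" unfolding J_def by (intro CollectI exI[of _ 0]) auto
  moreover have "y - z \<in> J" if "y \<in> J" "z \<in> J" for y z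
  proof -
    from that obtain q r where "y = c * poly q x" "\<forall>i. coeff q i \<in> \<O>" "z = c * poly r x" "\<forall>i. coeff r i \<in> \<O>"
      by (auto simp: J_def)
    thus ?thesis unfolding J_def by (intro CollectI exI[of _ "q - r"]) (auto simp: algebra_simps)
  qed
  moreover have "a * y \<in> J" if "a \<in> \<O>" "y \<in> J" for a y
  proof -
    from that obtain q where "y = c * poly q x" "\<forall>i. coeff q i \<in> \<O>" by (auto simp: J_def)
    thus ?thesis using that(1) unfolding J_def by (intro CollectI exI[of _ "smult a q"]) auto
  qed
  ultimately obtain \<delta> where \<delta>: "\<delta> \<in> J" "J = princ \<delta>" by (rule O_subset_closed_principal)
  have "c \<in> J" unfolding J_def by (intro CollectI exI[of _ 1]) (auto simp: coeff_1)
  hence "\<delta> \<noteq> 0" using \<delta> c by (auto simp: in_princ_iff)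
  from \<delta>(1) obtain q where q: "\<delta> = c * poly q x" "\<forall>i. coeff q i \<in> \<O>" by (auto simp: J_def)
  have "x * \<delta> \<in> J" unfolding J_def
    by (rule CollectI, rule exI[of _ "pCons 0 q"]) (use q in \<open>auto simp: coeff_pCons split: nat.split\<close>)
  then obtain y where "y \<in> \<O>" "x * \<delta> = y * \<delta>" unfolding \<delta>(2) by (auto simp: in_princ_iff)
  thus ?thesis using \<open>\<delta> \<noteq> 0\<close> by simp
qed

lemma carrier_OK [simp]: "carrier OK = \<O>"
proof
  show "carrier OK \<subseteq> \<O>" using O_integrally_closed by (auto simp: OK_def)
  show "\<O> \<subseteq> carrier OK"
  proof
    fix x assume "x \<in> \<O>"
    then obtain m n where x: "x = of_int m + of_int n * \<omega>" by (rule in_O_E)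
    have "of_rat (of_int m + of_int n / 2) + of_rat (of_int n / 2) * csqrt (-7) = x"
      unfolding x csqrt_minus_7 by (simp add: of_rat_add of_rat_divide of_rat_mult field_simps)
    hence "x \<in> K" unfolding K_def by (smt (verit) mem_Collect_eq)
    moreover have "algebraic_int x"
    proof
      \<comment> \<open>The characteristic polynomial of \<open>x\<close>, with constant term the
        norm and linear coefficient minus the trace \<open>2 m + n\<close>.\<close>
      let ?p = "[:of_int (m\<^sup>2 + m * n + 2 * n\<^sup>2), of_int (- 2 * m - n), 1:] :: complex poly"
      show "lead_coeff ?p = 1" by simp
      show "\<forall>i. coeff ?p i \<in> \<int>" by (auto simp: coeff_pCons split: nat.split)
      have "poly ?p x = of_int n * of_int n * (\<omega> * \<omega> - \<omega> + 2)"
        by (simp add: x power2_eq_square algebra_simps)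
      thus "poly ?p x = 0" by (simp add: omega_sq)
    qed
    ultimately show "x \<in> carrier OK" by (simp add: OK_def)
  qed
qed

lemma OK_ops [simp]: "x \<otimes>\<^bsub>OK\<^esub> y = x * y" "x \<oplus>\<^bsub>OK\<^esub> y = x + y" "\<one>\<^bsub>OK\<^esub> = 1" "\<zero>\<^bsub>OK\<^esub> = 0"
  by (simp_all add: OK_def)

lemma cring_OK: "cring OK"
proof (rule cringI)
  show "abelian_group OK"
  proof (rule abelian_groupI)
    fix x assume "x \<in> carrier OK"
    thus "\<exists>y\<in>carrier OK. y \<oplus>\<^bsub>OK\<^esub> x = \<zero>\<^bsub>OK\<^esub>" by (auto intro!: bexI[of _ "- x"])
  qed auto
  show "comm_monoid OK" by (rule comm_monoidI) auto
qed (auto simp: algebra_simps)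

lemma PIdl_OK: "PIdl\<^bsub>OK\<^esub> \<alpha> = princ \<alpha>"
  by (auto simp: cgenideal_def princ_def)

lemma ideal_princ: "\<alpha> \<in> \<O> \<Longrightarrow> ideal (princ \<alpha>) OK"
  using cring.cgenideal_ideal[OF cring_OK, of \<alpha>] by (simp add: PIdl_OK)

lemma ideal_OK_principal:
  assumes "ideal I OK"
  obtains \<alpha> where "\<alpha> \<in> \<O>" "I = princ \<alpha>"
proof -
  interpret ideal I OK by fact
  have sub: "I \<subseteq> \<O>" using a_subset by simp
  have 0: "0 \<in> I" using additive_subgroup.zero_closed[OF is_additive_subgroup] by simp
  have mult: "x * y \<in> I" if "x \<in> \<O>" "y \<in> I" for x y using I_l_closed[of y x] that by simp
  have "x - y \<in> I" if "x \<in> I" "y \<in> I" for x y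
  proof -
    have "x + (-1) * y \<in> I" using additive_subgroup.a_closed[OF is_additive_subgroup, of x "-1 * y"] mult[of "-1" y] that by simp
    thus ?thesis by simp
  qed
  from O_subset_closed_principal[OF sub 0 this mult] show ?thesis using that sub by blast
qed

lemma
  assumes "\<alpha> \<in> \<O>"
  shows princ_subset: "princ \<alpha> \<subseteq> \<O>"
    and princ_zero: "0 \<in> princ \<alpha>"
    and princ_self: "\<alpha> \<in> princ \<alpha>"
    and princ_diff: "x \<in> princ \<alpha> \<Longrightarrow> y \<in> princ \<alpha> \<Longrightarrow> x - y \<in> princ \<alpha>"
    and princ_add: "x \<in> princ \<alpha> \<Longrightarrow> y \<in> princ \<alpha> \<Longrightarrow> x + y \<in> princ \<alpha>"
    and princ_minus: "x \<in> princ \<alpha> \<Longrightarrow> - x \<in> princ \<alpha>"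
    and princ_mult: "z \<in> \<O> \<Longrightarrow> x \<in> princ \<alpha> \<Longrightarrow> z * x \<in> princ \<alpha>"
proof -
  show "princ \<alpha> \<subseteq> \<O>" using assms by (auto simp: princ_def)
  show "0 \<in> princ \<alpha>" unfolding in_princ_iff by (rule bexI[of _ 0]) auto
  show "\<alpha> \<in> princ \<alpha>" unfolding in_princ_iff by (rule bexI[of _ 1]) auto
  show "x \<in> princ \<alpha> \<Longrightarrow> y \<in> princ \<alpha> \<Longrightarrow> x - y \<in> princ \<alpha>"
    unfolding in_princ_iff by (metis left_diff_distrib O_intros(2))
  show "x \<in> princ \<alpha> \<Longrightarrow> y \<in> princ \<alpha> \<Longrightarrow> x + y \<in> princ \<alpha>"
    unfolding in_princ_iff by (metis distrib_right O_intros(6))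
  show "x \<in> princ \<alpha> \<Longrightarrow> - x \<in> princ \<alpha>"
    unfolding in_princ_iff by (metis mult_minus_left O_intros(5))
  show "z \<in> \<O> \<Longrightarrow> x \<in> princ \<alpha> \<Longrightarrow> z * x \<in> princ \<alpha>"
    unfolding in_princ_iff by (metis mult.assoc O_intros(3))
qed

section \<open>Residue systems and norms of principal ideals\<close>

definition residue_system :: "complex \<Rightarrow> complex set \<Rightarrow> bool" where
  "residue_system \<alpha> S \<longleftrightarrow> S \<subseteq> \<O> \<and> (\<forall>x\<in>\<O>. \<exists>!s. s \<in> S \<and> x - s \<in> princ \<alpha>)"

lemma a_r_coset_OK: "princ \<alpha> +>\<^bsub>OK\<^esub> x = (\<lambda>y. y + x) ` princ \<alpha>"
  by (auto simp: a_r_coset_def r_coset_def OK_def)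

lemma coset_eq_iff:
  assumes "\<alpha> \<in> \<O>"
  shows "(\<lambda>z. z + x) ` princ \<alpha> = (\<lambda>z. z + y) ` princ \<alpha> \<longleftrightarrow> x - y \<in> princ \<alpha>"
proof
  assume "(\<lambda>z. z + x) ` princ \<alpha> = (\<lambda>z. z + y) ` princ \<alpha>"
  moreover have "x \<in> (\<lambda>z. z + x) ` princ \<alpha>" using princ_zero[OF assms] by (auto intro: image_eqI[of _ _ 0])
  ultimately show "x - y \<in> princ \<alpha>" by auto
next
  assume *: "x - y \<in> princ \<alpha>"
  show "(\<lambda>z. z + x) ` princ \<alpha> = (\<lambda>z. z + y) ` princ \<alpha>"
  proof safe
    fix z assume z: "z \<in> princ \<alpha>"
    show "z + x \<in> (\<lambda>z. z + y) ` princ \<alpha>"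
      by (rule image_eqI[of _ _ "z + (x - y)"]) (use princ_add[OF assms z *] in auto)
    show "z + y \<in> (\<lambda>z. z + x) ` princ \<alpha>"
      by (rule image_eqI[of _ _ "z - (x - y)"]) (use princ_diff[OF assms z *] in auto)
  qed
qed

lemma carrier_Quot_OK: "carrier (OK Quot princ \<alpha>) = (\<lambda>x. (\<lambda>y. y + x) ` princ \<alpha>) ` \<O>"
proof -
  have "carrier (OK Quot princ \<alpha>) = (\<Union>x\<in>\<O>. {princ \<alpha> +>\<^bsub>OK\<^esub> x})"
    by (simp add: FactRing_def A_RCOSETS_def RCOSETS_def a_r_coset_def)
  thus ?thesis unfolding a_r_coset_OK by blast
qed

lemma ideal_norm_eq_card:
  assumes "\<alpha> \<in> \<O>" "residue_system \<alpha> S"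
  shows "ideal_norm (princ \<alpha>) = card S"
proof -
  have "bij_betw (\<lambda>x. (\<lambda>y. y + x) ` princ \<alpha>) S (carrier (OK Quot princ \<alpha>))"
    unfolding carrier_Quot_OK bij_betw_def
  proof
    show "inj_on (\<lambda>x. (\<lambda>y. y + x) ` princ \<alpha>) S"
    proof (rule inj_onI)
      fix x y assume xy: "x \<in> S" "y \<in> S" "(\<lambda>z. z + x) ` princ \<alpha> = (\<lambda>z. z + y) ` princ \<alpha>"
      hence "x - y \<in> princ \<alpha>" using coset_eq_iff[OF assms(1)] by blast
      moreover have "x - x \<in> princ \<alpha>" using princ_zero[OF assms(1)] by simp
      ultimately show "x = y" using assms(2) xy unfolding residue_system_def by blast
    qed
    show "(\<lambda>x. (\<lambda>y. y + x) ` princ \<alpha>) ` S = (\<lambda>x. (\<lambda>y. y + x) ` princ \<alpha>) ` \<O>"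
    proof (rule equalityI)
      show "(\<lambda>x. (\<lambda>y. y + x) ` princ \<alpha>) ` S \<subseteq> (\<lambda>x. (\<lambda>y. y + x) ` princ \<alpha>) ` \<O>"
        using assms(2) by (intro image_mono) (simp add: residue_system_def)
      show "(\<lambda>x. (\<lambda>y. y + x) ` princ \<alpha>) ` \<O> \<subseteq> (\<lambda>x. (\<lambda>y. y + x) ` princ \<alpha>) ` S"
      proof (rule image_subsetI)
        fix x assume "x \<in> \<O>"
        then obtain s where "s \<in> S" "x - s \<in> princ \<alpha>" using assms(2) unfolding residue_system_def by blast
        thus "(\<lambda>y. y + x) ` princ \<alpha> \<in> (\<lambda>x. (\<lambda>y. y + x) ` princ \<alpha>) ` S"
          using coset_eq_iff[OF assms(1), of x s] by blast
      qed
    qed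
  qed
  thus ?thesis unfolding ideal_norm_def using bij_betw_same_card by metis
qed

lemma ex_residue_system:
  assumes "\<alpha> \<in> \<O>"
  obtains S where "residue_system \<alpha> S"
proof -
  define r where "r = (\<lambda>x. SOME s. s \<in> \<O> \<and> x - s \<in> princ \<alpha>)"
  have r: "r x \<in> \<O> \<and> x - r x \<in> princ \<alpha>" if "x \<in> \<O>" for x
    unfolding r_def by (rule someI[of _ x]) (use that princ_zero[OF assms] in auto)
  have r_eq: "r x = r y" if "x - y \<in> princ \<alpha>" for x y
  proof -
    have "x - s \<in> princ \<alpha> \<longleftrightarrow> y - s \<in> princ \<alpha>" for s
      using princ_add[OF assms that, of "y - s"] princ_diff[OF assms _ that, of "x - s"] by auto
    thus ?thesis by (simp add: r_def)
  qed
  have "residue_system \<alpha> (r ` \<O>)"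
    unfolding residue_system_def
  proof (intro conjI ballI ex_ex1I)
    show "r ` \<O> \<subseteq> \<O>" using r by auto
    fix x assume x: "x \<in> \<O>"
    show "\<exists>s. s \<in> r ` \<O> \<and> x - s \<in> princ \<alpha>" using r[OF x] x by blast
    fix s t assume "s \<in> r ` \<O> \<and> x - s \<in> princ \<alpha>" "t \<in> r ` \<O> \<and> x - t \<in> princ \<alpha>"
    then obtain y z where yz: "s = r y" "t = r z" "y \<in> \<O>" "z \<in> \<O>" "x - r y \<in> princ \<alpha>" "x - r z \<in> princ \<alpha>" by auto
    have "x - r y - (y - r y) \<in> princ \<alpha>" "x - r z - (z - r z) \<in> princ \<alpha>"
      by (intro princ_diff[OF assms] yz r[THEN conjunct2])+
    hence "r x = r y" "r x = r z" using r_eq[of x y] r_eq[of x z] by simp_all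
    thus "s = t" using yz by simp
  qed
  thus ?thesis by (rule that)
qed

text \<open>Digits in mixed radix: divide by \<open>\<alpha>\<close>, then divide the quotient by
  \<open>\<beta>\<close>. Together with injectivity this is the multiplicativity of the
  norm.\<close>

lemma residue_system_mult:
  assumes "\<alpha> \<in> \<O>" "\<alpha> \<noteq> 0" "\<beta> \<in> \<O>" and S: "residue_system \<alpha> S" and T: "residue_system \<beta> T"
  shows "residue_system (\<alpha> * \<beta>) ((\<lambda>(s, t). s + t * \<alpha>) ` (S \<times> T))" (is ?th1)
    and "inj_on (\<lambda>(s, t). s + t * \<alpha>) (S \<times> T)" (is ?th2)
proof -
  have SO: "S \<subseteq> \<O>" and TO: "T \<subseteq> \<O>" using S T by (auto simp: residue_system_def)
  have uniq: "s = s' \<and> t = t'"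
    if "s \<in> S" "s' \<in> S" "t \<in> T" "t' \<in> T" "(s + t * \<alpha>) - (s' + t' * \<alpha>) \<in> princ (\<alpha> * \<beta>)" for s s' t t'
  proof -
    from that(5) obtain z where z: "z \<in> \<O>" "(s + t * \<alpha>) - (s' + t' * \<alpha>) = z * (\<alpha> * \<beta>)" by (auto simp: in_princ_iff)
    hence "s - s' = (z * \<beta> - t + t') * \<alpha>" by (simp add: algebra_simps)
    moreover have "z * \<beta> - t + t' \<in> \<O>" using z assms that SO TO by blast
    ultimately have "s - s' \<in> princ \<alpha>" by (auto simp: in_princ_iff)
    moreover have "s - s \<in> princ \<alpha>" using princ_zero assms by auto
    ultimately have ss: "s = s'" using S that SO unfolding residue_system_def by blast
    hence "(t - t') * \<alpha> = (z * \<beta>) * \<alpha>" using z by (simp add: algebra_simps)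
    hence "t - t' = z * \<beta>" using assms(2) by simp
    hence "t - t' \<in> princ \<beta>" using z by (auto simp: in_princ_iff)
    moreover have "t - t \<in> princ \<beta>" using princ_zero assms by auto
    ultimately have "t = t'" using T that TO unfolding residue_system_def by blast
    with ss show ?thesis by simp
  qed
  have ab: "\<alpha> * \<beta> \<in> \<O>" using assms by blast
  show ?th2
  proof (rule inj_onI, clarify)
    fix s t s' t' assume *: "s \<in> S" "t \<in> T" "s' \<in> S" "t' \<in> T" "s + t * \<alpha> = s' + t' * \<alpha>"
    have "(s + t * \<alpha>) - (s' + t' * \<alpha>) \<in> princ (\<alpha> * \<beta>)" using * princ_zero[OF ab] by simp
    thus "s = s' \<and> t = t'" using uniq * by blast
  qed
  show ?th1
    unfolding residue_system_def
  proof (intro conjI ballI ex_ex1I)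
    show "(\<lambda>(s, t). s + t * \<alpha>) ` (S \<times> T) \<subseteq> \<O>" using SO TO assms by auto
    fix x assume x: "x \<in> \<O>"
    then obtain s y where s: "s \<in> S" "y \<in> \<O>" "x - s = y * \<alpha>" using S unfolding residue_system_def in_princ_iff by blast
    then obtain t z where t: "t \<in> T" "z \<in> \<O>" "y - t = z * \<beta>" using T unfolding residue_system_def in_princ_iff by blast
    have "x - (s + t * \<alpha>) = (x - s) - t * \<alpha>" by simp
    also have "\<dots> = (y - t) * \<alpha>" unfolding s by (simp add: algebra_simps)
    also have "\<dots> = z * (\<alpha> * \<beta>)" unfolding t by simp
    finally show "\<exists>u. u \<in> (\<lambda>(s, t). s + t * \<alpha>) ` (S \<times> T) \<and> x - u \<in> princ (\<alpha> * \<beta>)"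
      using s t by (intro exI[of _ "s + t * \<alpha>"]) (auto simp: in_princ_iff)
    fix u v assume "u \<in> (\<lambda>(s, t). s + t * \<alpha>) ` (S \<times> T) \<and> x - u \<in> princ (\<alpha> * \<beta>)"
      "v \<in> (\<lambda>(s, t). s + t * \<alpha>) ` (S \<times> T) \<and> x - v \<in> princ (\<alpha> * \<beta>)"
    moreover from this have "(x - v) - (x - u) \<in> princ (\<alpha> * \<beta>)" by (intro princ_diff[OF ab, of "x - v" "x - u"]) blast+
    hence "u - v \<in> princ (\<alpha> * \<beta>)" by simp
    ultimately show "u = v" using uniq by auto
  qed
qed

lemma residue_system_cnj:
  assumes "residue_system \<alpha> S"
  shows "residue_system (cnj \<alpha>) (cnj ` S)"
proof -
  have iff: "x - cnj s \<in> princ (cnj \<alpha>) \<longleftrightarrow> cnj x - s \<in> princ \<alpha>" for x s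
  proof -
    have "(\<exists>z\<in>\<O>. x - cnj s = z * cnj \<alpha>) \<longleftrightarrow> (\<exists>z\<in>\<O>. cnj x - s = z * \<alpha>)"
    proof safe
      fix z assume "z \<in> \<O>" "x - cnj s = z * cnj \<alpha>"
      thus "\<exists>z\<in>\<O>. cnj x - s = z * \<alpha>"
        by (intro bexI[of _ "cnj z"] O_cnj) (metis complex_cnj_cnj complex_cnj_diff complex_cnj_mult)
    next
      fix z assume "z \<in> \<O>" "cnj x - s = z * \<alpha>"
      thus "\<exists>z\<in>\<O>. x - cnj s = z * cnj \<alpha>"
        by (intro bexI[of _ "cnj z"] O_cnj) (metis complex_cnj_cnj complex_cnj_diff complex_cnj_mult)
    qed
    thus ?thesis by (simp add: in_princ_iff)
  qed
  show ?thesis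
    unfolding residue_system_def
  proof (intro conjI ballI)
    show "cnj ` S \<subseteq> \<O>" using assms by (auto simp: residue_system_def intro: O_cnj)
    fix x assume "x \<in> \<O>"
    hence "cnj x \<in> \<O>" by (rule O_cnj)
    then obtain s where s: "s \<in> S" "cnj x - s \<in> princ \<alpha>" "\<And>t. t \<in> S \<Longrightarrow> cnj x - t \<in> princ \<alpha> \<Longrightarrow> t = s"
      using assms unfolding residue_system_def by blast
    show "\<exists>!s. s \<in> cnj ` S \<and> x - s \<in> princ (cnj \<alpha>)"
    proof (rule ex1I[of _ "cnj s"])
      show "cnj s \<in> cnj ` S \<and> x - cnj s \<in> princ (cnj \<alpha>)" using s(1,2) iff by blast
      fix t assume "t \<in> cnj ` S \<and> x - t \<in> princ (cnj \<alpha>)"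
      thus "t = cnj s" using s(3) iff by blast
    qed
  qed
qed

lemma residue_system_of_nat:
  assumes "n > 0"
  shows "residue_system (of_nat n) ((\<lambda>(i, j). of_int i + of_int j * \<omega>) ` ({0..<int n} \<times> {0..<int n}))"
  unfolding residue_system_def
proof (intro conjI ballI ex_ex1I)
  let ?f = "\<lambda>(i, j). of_int i + of_int j * \<omega>"
  have mem: "of_int i + of_int j * \<omega> \<in> princ (of_nat n) \<longleftrightarrow> int n dvd i \<and> int n dvd j" for i j
  proof
    assume "of_int i + of_int j * \<omega> \<in> princ (of_nat n)"
    then obtain k l where "of_int i + of_int j * \<omega> = (of_int k + of_int l * \<omega>) * of_nat n"
      unfolding in_princ_iff by (metis in_O_E)
    also have "\<dots> = of_int (k * int n) + of_int (l * int n) * \<omega>" by (simp add: algebra_simps)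
    finally show "int n dvd i \<and> int n dvd j" unfolding O_coeffs_eq_iff by simp
  next
    assume "int n dvd i \<and> int n dvd j"
    then obtain k l where "i = int n * k" "j = int n * l" by (auto simp: dvd_def)
    hence "of_int i + of_int j * \<omega> = (of_int k + of_int l * \<omega>) * of_nat n" by (simp add: algebra_simps)
    thus "of_int i + of_int j * \<omega> \<in> princ (of_nat n)" unfolding in_princ_iff by blast
  qed
  show "?f ` ({0..<int n} \<times> {0..<int n}) \<subseteq> \<O>" by auto
  fix x assume "x \<in> \<O>"
  then obtain a b where x: "x = of_int a + of_int b * \<omega>" by (rule in_O_E)
  have diff: "x - (of_int i + of_int j * \<omega>) = of_int (a - i) + of_int (b - j) * \<omega>" for i j
    by (simp add: x algebra_simps)
  show "\<exists>s. s \<in> ?f ` ({0..<int n} \<times> {0..<int n}) \<and> x - s \<in> princ (of_nat n)"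
  proof (intro exI conjI)
    show "?f (a mod int n, b mod int n) \<in> ?f ` ({0..<int n} \<times> {0..<int n})" using assms by (intro imageI) auto
    show "x - ?f (a mod int n, b mod int n) \<in> princ (of_nat n)"
      unfolding prod.case diff mem by (simp add: minus_mod_eq_mult_div)
  qed
  fix s t assume "s \<in> ?f ` ({0..<int n} \<times> {0..<int n}) \<and> x - s \<in> princ (of_nat n)"
    "t \<in> ?f ` ({0..<int n} \<times> {0..<int n}) \<and> x - t \<in> princ (of_nat n)"
  then obtain i j k l where *: "s = of_int i + of_int j * \<omega>" "t = of_int k + of_int l * \<omega>"
     "0 \<le> i" "i < int n" "0 \<le> j" "j < int n" "0 \<le> k" "k < int n" "0 \<le> l" "l < int n"
     and st: "x - s \<in> princ (of_nat n)" "x - t \<in> princ (of_nat n)"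
    by auto
  from st have "int n dvd a - i" "int n dvd b - j" "int n dvd a - k" "int n dvd b - l"
    unfolding *(1,2) diff mem by blast+
  hence "i mod int n = k mod int n" "j mod int n = l mod int n"
    by (metis mod_eq_dvd_iff)+
  hence "i = k" "j = l" using * by simp_all
  thus "s = t" using * by simp
qed

text \<open>Conjugation gives \<open>\<alpha>\<close> and \<open>cnj \<alpha>\<close> equally many
  residues, so the square of the index of \<open>\<alpha>\<close> is the index of
  \<open>\<alpha> * cnj \<alpha>\<close>. That product is a positive integer \<open>N\<close>, of
  index \<open>N * N\<close> by coordinates.\<close>

lemma ideal_norm_princ:
  assumes "\<alpha> \<in> \<O>" "\<alpha> \<noteq> 0"
  shows "real (ideal_norm (princ \<alpha>)) = norm \<alpha> ^ 2"
proof -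
  obtain S where S: "residue_system \<alpha> S" using ex_residue_system assms(1) by blast
  obtain m n where mn: "\<alpha> = of_int m + of_int n * \<omega>" using assms(1) by (rule in_O_E)
  define N where "N = nat (m\<^sup>2 + m * n + 2 * n\<^sup>2)"
  have pos: "0 < real_of_int (m\<^sup>2 + m * n + 2 * n\<^sup>2)"
    using assms(2) norm_sq_O[of m n] unfolding mn by (metis norm_eq_zero zero_less_power zero_less_norm_iff)
  hence N: "real N = norm \<alpha> ^ 2" "N > 0" unfolding mn norm_sq_O N_def by (auto simp del: of_int_add)
  have "residue_system (\<alpha> * cnj \<alpha>) ((\<lambda>(s, t). s + t * \<alpha>) ` (S \<times> cnj ` S))"
    using assms S by (intro residue_system_mult residue_system_cnj O_cnj)
  hence "ideal_norm (princ (\<alpha> * cnj \<alpha>)) = card ((\<lambda>(s, t). s + t * \<alpha>) ` (S \<times> cnj ` S))"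
    using assms by (intro ideal_norm_eq_card O_intros O_cnj)
  also have "\<dots> = card (S \<times> cnj ` S)"
    using assms S by (intro card_image residue_system_mult(2)[of \<alpha> "cnj \<alpha>"] residue_system_cnj O_cnj)
  also have "\<dots> = card S * card S"
    by (simp add: card_cartesian_product card_image inj_on_def)
  also have "\<alpha> * cnj \<alpha> = of_nat N"
    using complex_norm_square[of \<alpha>] unfolding N(1)[symmetric] by simp
  also have "ideal_norm (princ (of_nat N)) = card ((\<lambda>(i, j). of_int i + of_int j * \<omega>) ` ({0..<int N} \<times> {0..<int N}))"
    by (intro ideal_norm_eq_card residue_system_of_nat N) auto
  also have "\<dots> = card ({0..<int N} \<times> {0..<int N})"
    by (intro card_image) (auto simp: inj_on_def O_coeffs_eq_iff)
  also have "\<dots> = N * N" by (simp add: card_cartesian_product)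
  finally have "card S = N" by (metis power2_eq_iff_nonneg power2_eq_square zero_le)
  thus ?thesis using N ideal_norm_eq_card[OF assms(1) S] by simp
qed

section \<open>Units, generators and sums over ideals\<close>

lemma O_units:
  assumes "x \<in> \<O>" "y \<in> \<O>" "x * y = 1"
  shows "x = 1 \<or> x = -1"
proof -
  have ne: "x \<noteq> 0" "y \<noteq> 0" using assms by auto
  have ge: "norm x \<ge> 1" "norm y \<ge> 1" using norm_O_ge_1 assms ne by auto
  have "norm x * norm y = 1" using assms(3) by (simp flip: norm_mult)
  moreover have "norm x * norm y \<ge> norm x * 1" using ge by (intro mult_left_mono) auto
  ultimately have nx: "norm x = 1" using ge by simp
  obtain m n where x: "x = of_int m + of_int n * \<omega>" using assms(1) by (rule in_O_E)
  have "real_of_int (m\<^sup>2 + m * n + 2 * n\<^sup>2) = 1" using norm_sq_O[of m n] nx unfolding x by simp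
  hence "m\<^sup>2 + m * n + 2 * n\<^sup>2 = 1" by (simp only: of_int_eq_1_iff)
  \<comment> \<open>Four times the norm form with the square completed; a nonzero \<open>n\<close>
    would already contribute 7.\<close>
  hence eq: "(2 * m + n)\<^sup>2 + 7 * n\<^sup>2 = 4" by (simp add: power2_eq_square algebra_simps)
  have "n = 0"
  proof (rule ccontr)
    assume "n \<noteq> 0"
    hence "n\<^sup>2 > 0" by simp
    thus False using eq zero_le_power2[of "2 * m + n"] by linarith
  qed
  hence "m\<^sup>2 = 1" using eq by (simp add: power2_eq_square)
  thus ?thesis using \<open>n = 0\<close> by (auto simp: x power2_eq_1_iff)
qed

lemma princ_eq_iff:
  assumes "\<alpha> \<in> \<O>" "\<beta> \<in> \<O>"
  shows "princ \<alpha> = princ \<beta> \<longleftrightarrow> \<alpha> = \<beta> \<or> \<alpha> = - \<beta>"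
proof
  assume eq: "princ \<alpha> = princ \<beta>"
  obtain x where x: "x \<in> \<O>" "\<alpha> = x * \<beta>" using princ_self[OF assms(1)] unfolding eq in_princ_iff by blast
  obtain y where y: "y \<in> \<O>" "\<beta> = y * \<alpha>" using princ_self[OF assms(2)] unfolding eq[symmetric] in_princ_iff by blast
  show "\<alpha> = \<beta> \<or> \<alpha> = - \<beta>"
  proof (cases "\<alpha> = 0")
    case True thus ?thesis using y by simp
  next
    case False
    have "\<alpha> * (x * y) = \<alpha> * 1" using x y by (metis mult.assoc mult.commute mult_1_right)
    hence "x * y = 1" using False by simp
    from O_units[OF x(1) y(1) this] show ?thesis using x(2) by auto
  qed
next
  have "princ (- \<beta>) = princ \<beta>" unfolding princ_def
  proof safe
    fix x assume "x \<in> \<O>"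
    thus "x * - \<beta> \<in> (\<lambda>x. x * \<beta>) ` \<O>" "x * \<beta> \<in> (\<lambda>x. x * - \<beta>) ` \<O>"
      by (auto intro!: image_eqI[of _ _ "- x"])
  qed
  thus "\<alpha> = \<beta> \<or> \<alpha> = - \<beta> \<Longrightarrow> princ \<alpha> = princ \<beta>" by auto
qed

text \<open>Contains exactly one of \<open>x\<close> and \<open>- x\<close> for each nonzero
  \<open>x\<close> in \<open>\<O>\<close>, hence one generator of each nonzero ideal.\<close>

definition O_half :: "complex set" where
  "O_half = {x\<in>\<O>. Im x > 0 \<or> Im x = 0 \<and> Re x > 0}"

lemma bij_betw_princ: "bij_betw princ O_half {I. ideal I OK \<and> I \<noteq> {0}}"
proof (rule bij_betwI')
  fix x y assume "x \<in> O_half" "y \<in> O_half"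
  thus "princ x = princ y \<longleftrightarrow> x = y" by (auto simp: O_half_def princ_eq_iff)
next
  fix x assume "x \<in> O_half"
  hence x: "x \<in> \<O>" "x \<noteq> 0" by (auto simp: O_half_def)
  show "princ x \<in> {I. ideal I OK \<and> I \<noteq> {0}}" using ideal_princ[OF x(1)] princ_self[OF x(1)] x(2) by blast
next
  fix I assume "I \<in> {I. ideal I OK \<and> I \<noteq> {0}}"
  then obtain \<alpha> where \<alpha>: "\<alpha> \<in> \<O>" "I = princ \<alpha>" "I \<noteq> {0}" using ideal_OK_principal by blast
  hence "\<alpha> \<noteq> 0" by (auto simp: princ_def intro!: image_eqI[of _ _ 0])
  hence "\<alpha> \<in> O_half \<or> - \<alpha> \<in> O_half" using \<alpha> by (auto simp: O_half_def complex_eq_iff)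
  moreover have "princ (- \<alpha>) = princ \<alpha>" using \<alpha> by (auto simp: princ_eq_iff)
  ultimately show "\<exists>x\<in>O_half. I = princ x" using \<alpha> by metis
qed

text \<open>Each nonzero ideal has the two generators \<open>x\<close> and \<open>- x\<close>, which
  contribute equally because \<open>F\<close> is even; hence the factor 1/2.\<close>

lemma has_sum_ideals:
  fixes F :: "complex \<Rightarrow> complex"
  assumes sum: "(F has_sum S) (\<O> - {0})" and even: "\<And>x. x \<in> \<O> \<Longrightarrow> F (- x) = F x"
    and G: "\<And>x. x \<in> \<O> - {0} \<Longrightarrow> G (princ x) = F x"
  shows "(G has_sum S / 2) {I. ideal I OK \<and> I \<noteq> {0}}"
proof -
  have sub: "O_half \<subseteq> \<O> - {0}" by (auto simp: O_half_def)
  have "F summable_on O_half" using sum sub summable_on_subset has_sum_imp_summable by blast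
  then obtain T where T: "(F has_sum T) O_half" by (auto simp: summable_on_def)
  have "(F has_sum T) (uminus ` O_half)"
  proof (subst has_sum_reindex)
    show "((F \<circ> uminus) has_sum T) O_half"
      by (rule has_sum_cong[THEN iffD1, OF _ T]) (use even sub in auto)
  qed auto
  with T have "(F has_sum (T + T)) (O_half \<union> uminus ` O_half)"
    by (rule has_sum_Un_disjoint) (auto simp: O_half_def)
  also have "O_half \<union> uminus ` O_half = \<O> - {0}"
  proof (intro equalityI subsetI)
    fix x assume "x \<in> \<O> - {0}"
    hence "x \<in> O_half \<or> - x \<in> O_half" by (auto simp: O_half_def complex_eq_iff)
    thus "x \<in> O_half \<union> uminus ` O_half" by (auto intro: image_eqI[of _ _ "- x"])
  qed (auto simp: O_half_def)
  finally have "S = T + T" using sum has_sum_unique by blast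
  hence "(F has_sum S / 2) O_half" using T by simp
  hence "((\<lambda>x. G (princ x)) has_sum S / 2) O_half"
    by (rule has_sum_cong[THEN iffD2, rotated]) (use G sub in auto)
  thus ?thesis using has_sum_reindex_bij_betw[OF bij_betw_princ] by blast
qed

section \<open>The quadratic character\<close>

lemma Legendre_cong: "[a = b] (mod p) \<Longrightarrow> Legendre a p = Legendre b p"
proof -
  assume "[a = b] (mod p)"
  hence "[x = a] (mod p) \<longleftrightarrow> [x = b] (mod p)" "[a = x] (mod p) \<longleftrightarrow> [b = x] (mod p)" for x
    by (metis cong_trans cong_sym)+
  thus ?thesis by (simp add: Legendre_def QuadRes_def)
qed

lemma Legendre_values: "Legendre a p \<in> {-1, 0, 1}"
  by (auto simp: Legendre_def)

lemma cong_imp_eq_small: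
  fixes x y p :: int
  assumes "[x = y] (mod p)" "p > 2" "x \<in> {-1, 0, 1}" "y \<in> {-1, 0, 1}"
  shows "x = y"
proof -
  have "p dvd x - y" using assms(1) by (simp add: cong_iff_dvd_diff)
  hence "x - y = 0 \<or> \<bar>x - y\<bar> \<ge> p" using zdvd_imp_le[of p "\<bar>x - y\<bar>"] by auto
  thus ?thesis using assms by auto
qed

section \<open>Residues and the quadratic character modulo D\<close>

locale split_prime =
  fixes D :: "complex set" and \<pi> :: complex and p :: nat
  assumes pi_O: "\<pi> \<in> \<O>" and D_eq: "D = princ \<pi>" and norm_pi: "norm \<pi> ^ 2 = real p"
    and prime_p: "prime p" and p_mod_4: "p mod 4 = 3" and ideal_norm_D: "ideal_norm D = p"
begin

lemma p_gt_2: "p > 2" and odd_p: "odd p" and odd_half_p: "odd ((p - 1) div 2)"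
  using p_mod_4 by presburger+

lemmas D_intros = princ_zero[OF pi_O, folded D_eq] princ_self[OF pi_O, folded D_eq]
  princ_diff[OF pi_O, folded D_eq] princ_add[OF pi_O, folded D_eq] princ_minus[OF pi_O, folded D_eq]
  princ_mult[OF pi_O, folded D_eq]

lemma D_subset: "D \<subseteq> \<O>" using princ_subset[OF pi_O] by (simp add: D_eq)

lemma pi_nz [simp]: "\<pi> \<noteq> 0" using norm_pi prime_p by auto

lemma pi_cnj: "\<pi> * cnj \<pi> = of_nat p"
  using complex_norm_square[of \<pi>] unfolding norm_pi by simp

lemma p_in_D: "of_int (int p) \<in> D"
  unfolding D_eq in_princ_iff using pi_cnj O_cnj[OF pi_O] by (intro bexI[of _ "cnj \<pi>"]) (auto simp: mult.commute)

lemma one_notin_D: "1 \<notin> D"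
proof
  assume "1 \<in> D"
  then obtain x where x: "x \<in> \<O>" "x * \<pi> = 1" unfolding D_eq in_princ_iff by metis
  hence "\<pi> = 1 \<or> \<pi> = -1" using O_units[of \<pi> x] pi_O by (simp add: mult.commute)
  thus False using norm_pi p_gt_2 by auto
qed

lemma of_int_in_D_iff: "of_int a \<in> D \<longleftrightarrow> int p dvd a"
proof
  assume "int p dvd a"
  then obtain k where "a = k * int p" by (metis dvdE mult.commute)
  thus "of_int a \<in> D" using D_intros(6)[of "of_int k" "of_int (int p)"] p_in_D by simp
next
  assume a: "of_int a \<in> D"
  show "int p dvd a"
  proof (rule ccontr)
    assume "\<not> int p dvd a"
    hence "coprime (int p) a" using prime_p by (intro prime_imp_coprime) auto
    then obtain u v where "u * int p + v * a = 1" using bezout_int[of "int p" a] by auto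
    hence "of_int u * of_int (int p) + of_int v * of_int a = (1::complex)" by (metis of_int_1 of_int_add of_int_mult)
    moreover have "of_int u * of_int (int p) + of_int v * of_int a \<in> D"
      by (intro D_intros a p_in_D O_of_int)
    ultimately show False using one_notin_D by simp
  qed
qed

text \<open>The integers from 0 to \<open>p - 1\<close> lie in distinct classes modulo
  \<open>D\<close>, and the quotient has just \<open>p\<close> elements, so they exhaust it.\<close>

lemma ex_residue:
  assumes "x \<in> \<O>"
  obtains a :: int where "x - of_int a \<in> D"
proof -
  let ?c = "\<lambda>x. (\<lambda>y. y + x) ` D"
  have inj: "inj_on (\<lambda>a. ?c (of_int a)) {0..<int p}"
  proof (rule inj_onI)
    fix a b assume ab: "a \<in> {0..<int p}" "b \<in> {0..<int p}" "?c (of_int a) = ?c (of_int b)"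
    hence "of_int a - of_int b \<in> D" using coset_eq_iff[OF pi_O] by (simp add: D_eq)
    hence "int p dvd a - b" using of_int_in_D_iff[of "a - b"] by simp
    hence "a mod int p = b mod int p" by (simp add: mod_eq_dvd_iff)
    thus "a = b" using ab by simp
  qed
  have carrier: "carrier (OK Quot D) = ?c ` \<O>" using carrier_Quot_OK[of \<pi>] by (simp add: D_eq)
  have "(\<lambda>a. ?c (of_int a)) ` {0..<int p} = carrier (OK Quot D)"
  proof (rule card_subset_eq)
    have "card (carrier (OK Quot D)) = p" using ideal_norm_D by (simp add: ideal_norm_def)
    thus "finite (carrier (OK Quot D))" "card ((\<lambda>a. ?c (of_int a)) ` {0..<int p}) = card (carrier (OK Quot D))"
      using p_gt_2 by (auto intro: card_ge_0_finite simp: card_image[OF inj])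
    show "(\<lambda>a. ?c (of_int a)) ` {0..<int p} \<subseteq> carrier (OK Quot D)" unfolding carrier by auto
  qed
  hence "?c x \<in> (\<lambda>a. ?c (of_int a)) ` {0..<int p}" using assms unfolding carrier by auto
  then obtain a where "?c x = ?c (of_int a)" by auto
  hence "x - of_int a \<in> D" using coset_eq_iff[OF pi_O] by (simp add: D_eq)
  thus ?thesis by (rule that)
qed

lemma residue_unique:
  assumes "x - of_int a \<in> D" "x - of_int b \<in> D"
  shows "[a = b] (mod int p)"
proof -
  have "(x - of_int b) - (x - of_int a) \<in> D" by (intro D_intros assms)
  hence "of_int (a - b) \<in> D" by simp
  thus ?thesis unfolding of_int_in_D_iff by (simp add: cong_iff_dvd_diff)
qed

lemma residue_in_D_iff:
  assumes "x - of_int a \<in> D"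
  shows "x \<in> D \<longleftrightarrow> int p dvd a"
proof -
  have "x \<in> D \<longleftrightarrow> of_int a \<in> D"
    using D_intros(4)[OF assms, of "of_int a"] D_intros(3)[OF _ assms, of x] by auto
  thus ?thesis by (simp add: of_int_in_D_iff)
qed

lemma residue_mult:
  assumes "x \<in> \<O>" "x - of_int a \<in> D" "y - of_int b \<in> D"
  shows "x * y - of_int (a * b) \<in> D"
proof -
  have "x * (y - of_int b) + of_int b * (x - of_int a) \<in> D" by (intro D_intros assms O_of_int)
  thus ?thesis by (simp add: algebra_simps)
qed

lemma D_prime:
  assumes "x \<in> \<O>" "y \<in> \<O>" "x * y \<in> D"
  shows "x \<in> D \<or> y \<in> D"
proof -
  obtain a b where ab: "x - of_int a \<in> D" "y - of_int b \<in> D" using ex_residue assms by metis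
  have "int p dvd a * b" using residue_mult[OF assms(1) ab] assms(3) residue_in_D_iff by blast
  hence "int p dvd a \<or> int p dvd b" using prime_p by (simp add: prime_dvd_mult_iff)
  thus ?thesis using residue_in_D_iff ab by blast
qed

lemma eps_eq_Legendre:
  assumes "x - of_int a \<in> D"
  shows "eps D x = Legendre a (int p)"
  unfolding eps_def ideal_norm_D
proof (rule the_equality)
  show "\<exists>b. x - of_int b \<in> D \<and> Legendre a (int p) = Legendre b (int p)" using assms by blast
  fix e assume "\<exists>b. x - of_int b \<in> D \<and> e = Legendre b (int p)"
  thus "e = Legendre a (int p)" using residue_unique[OF assms] Legendre_cong by metis
qed

lemma eps_of_int: "eps D (of_int a) = Legendre a (int p)"
  using eps_eq_Legendre[of "of_int a" a] D_intros(1) by simp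

lemma eps_eq_0_iff: "x \<in> \<O> \<Longrightarrow> eps D x = 0 \<longleftrightarrow> x \<in> D"
  by (elim ex_residue) (auto simp: eps_eq_Legendre residue_in_D_iff Legendre_def cong_0_iff)

lemma eps_values: "x \<in> \<O> \<Longrightarrow> eps D x \<in> {-1, 0, 1}"
  by (elim ex_residue) (metis eps_eq_Legendre Legendre_values)

lemma eps_cong:
  assumes "x \<in> \<O>" "y \<in> \<O>" "x - y \<in> D"
  shows "eps D x = eps D y"
proof -
  obtain a where a: "x - of_int a \<in> D" using ex_residue assms(1) .
  hence "(x - of_int a) - (x - y) \<in> D" using assms(3) by (rule D_intros(3))
  hence "y - of_int a \<in> D" by simp
  thus ?thesis using a eps_eq_Legendre by simp
qed

text \<open>Euler's criterion makes the two sides congruent modulo \<open>p\<close>; as both lie in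
  {-1, 0, 1} and \<open>p > 2\<close>, they are equal.\<close>

lemma Legendre_mult_p: "Legendre (a * b) (int p) = Legendre a (int p) * Legendre b (int p)"
proof (rule cong_imp_eq_small)
  have e: "[Legendre a (int p) = a ^ ((p - 1) div 2)] (mod int p)" for a
    by (rule euler_criterion[OF prime_p p_gt_2])
  show "[Legendre (a * b) (int p) = Legendre a (int p) * Legendre b (int p)] (mod int p)"
    using cong_trans[OF e[of "a * b", unfolded power_mult_distrib] cong_sym[OF cong_mult[OF e[of a] e[of b]]]] .
qed (use p_gt_2 Legendre_values[of "a * b" "int p"] Legendre_values[of a "int p"] Legendre_values[of b "int p"] in auto)

text \<open>Here \<open>p mod 4 = 3\<close> enters: Euler's criterion raises -1 to the odd power
  \<open>(p - 1) div 2\<close>.\<close>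

lemma Legendre_minus_one: "Legendre (-1) (int p) = -1"
proof (rule cong_imp_eq_small)
  show "[Legendre (-1) (int p) = -1] (mod int p)"
    using euler_criterion[OF prime_p p_gt_2, of "-1"] odd_half_p by simp
qed (use p_gt_2 Legendre_values[of "-1"] in auto)

lemma eps_mult:
  assumes "x \<in> \<O>" "y \<in> \<O>"
  shows "eps D (x * y) = eps D x * eps D y"
proof -
  obtain a b where ab: "x - of_int a \<in> D" "y - of_int b \<in> D" using ex_residue assms by metis
  show ?thesis
    using eps_eq_Legendre[OF residue_mult[OF assms(1) ab]] ab by (simp add: eps_eq_Legendre Legendre_mult_p)
qed

lemma eps_minus: "x \<in> \<O> \<Longrightarrow> eps D (- x) = - eps D x"
  using eps_mult[of "-1" x] eps_of_int[of "-1"] Legendre_minus_one by simp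

text \<open>The definite description is legitimate because the only other generator is
  \<open>- x\<close>, whose sign cancels against the oddness of \<open>eps\<close>. For
  \<open>x\<close> in \<open>D\<close> both sides are 0.\<close>

lemma psi_princ:
  assumes x: "x \<in> \<O>"
  shows "psi D (princ x) = of_int (eps D x) * x"
proof (cases "x \<in> D")
  case True
  have "princ x <+>\<^bsub>OK\<^esub> D \<subseteq> D"
    using True unfolding set_add_def set_mult_def
    by (auto simp: OK_def in_princ_iff intro!: D_intros)
  moreover have "1 \<in> carrier OK" by simp
  ultimately have "princ x <+>\<^bsub>OK\<^esub> D \<noteq> carrier OK" using one_notin_D by blast
  thus ?thesis using True eps_eq_0_iff[OF x] by (simp add: psi_def)
next
  case False
  obtain a where a: "x - of_int a \<in> D" using ex_residue x .
  hence "\<not> int p dvd a" using residue_in_D_iff False by blast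
  hence "coprime (int p) a" using prime_p by (intro prime_imp_coprime) auto
  then obtain u v where "u * int p + v * a = 1" using bezout_int[of "int p" a] by auto
  hence uv: "of_int u * of_int (int p) + of_int v * of_int a = (1::complex)" by (metis of_int_1 of_int_add of_int_mult)
  \<comment> \<open>The Bezout coefficient \<open>v\<close> inverts the residue \<open>a\<close>
    modulo \<open>p\<close>, hence inverts \<open>x\<close> modulo \<open>D\<close>; so
    \<open>x\<close> and \<open>D\<close> together generate 1.\<close>
  have d: "1 - of_int v * x \<in> D"
  proof -
    have "of_int u * of_int (int p) - of_int v * (x - of_int a) \<in> D"
      by (intro D_intros a p_in_D O_of_int)
    also have "of_int u * of_int (int p) - of_int v * (x - of_int a) = 1 - of_int v * x"
      using uv by (simp add: algebra_simps)
    finally show ?thesis .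
  qed
  have "princ x <+>\<^bsub>OK\<^esub> D = carrier OK"
  proof
    show "princ x <+>\<^bsub>OK\<^esub> D \<subseteq> carrier OK"
      using x D_subset by (auto simp: set_add_def set_mult_def in_princ_iff dest!: subsetD[OF D_subset])
    show "carrier OK \<subseteq> princ x <+>\<^bsub>OK\<^esub> D"
    proof
      fix y assume "y \<in> carrier OK"
      hence y: "y \<in> \<O>" by simp
      have "y = (y * of_int v) * x + y * (1 - of_int v * x)" by (simp add: algebra_simps)
      moreover have "(y * of_int v) * x \<in> princ x" using y by (auto simp: in_princ_iff)
      moreover have "y * (1 - of_int v * x) \<in> D" by (intro D_intros y d)
      ultimately show "y \<in> princ x <+>\<^bsub>OK\<^esub> D"
        unfolding set_add_def set_mult_def by (auto simp: OK_def)
    qed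
  qed
  hence "psi D (princ x) = (THE c. \<exists>y\<in>\<O>. princ x = princ y \<and> c = of_int (eps D y) * y)"
    by (simp add: psi_def PIdl_OK)
  also have "\<dots> = of_int (eps D x) * x"
  proof (rule the_equality)
    show "\<exists>y\<in>\<O>. princ x = princ y \<and> of_int (eps D x) * x = of_int (eps D y) * y" using x by blast
    fix c assume "\<exists>y\<in>\<O>. princ x = princ y \<and> c = of_int (eps D y) * y"
    then obtain y where y: "y \<in> \<O>" "princ x = princ y" "c = of_int (eps D y) * y" by blast
    hence "x = y \<or> x = - y" using princ_eq_iff x by blast
    thus "c = of_int (eps D x) * x" using y eps_minus by auto
  qed
  finally show ?thesis .
qed

end

lemma split_prime_primeideal:
  assumes "primeideal D OK" "prime (ideal_norm D)" "[ideal_norm D = 3] (mod 4)"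
  obtains \<pi> where "split_prime D \<pi> (ideal_norm D)"
proof -
  have "ideal D OK" using assms(1) by (rule primeideal.axioms(1))
  then obtain \<pi> where \<pi>: "\<pi> \<in> \<O>" "D = princ \<pi>" by (rule ideal_OK_principal)
  \<comment> \<open>The zero ideal has infinitely many residue classes, and the cardinality of an
    infinite set is 0, which is not a prime.\<close>
  have "\<pi> \<noteq> 0"
  proof
    assume "\<pi> = 0"
    have "residue_system 0 \<O>"
      by (auto simp: residue_system_def in_princ_iff intro!: ex1I bexI[of _ 0])
    hence "ideal_norm D = card \<O>" using ideal_norm_eq_card[of 0 \<O>] \<pi> \<open>\<pi> = 0\<close> by simp
    moreover have "infinite \<O>"
    proof
      assume "finite \<O>"
      moreover have "range (of_int :: int \<Rightarrow> complex) \<subseteq> \<O>" by auto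
      ultimately have "finite (range (of_int :: int \<Rightarrow> complex))" by (rule finite_subset[rotated])
      thus False using finite_imageD[of "of_int :: int \<Rightarrow> complex" UNIV] by (auto simp: inj_on_def infinite_UNIV_int)
    qed
    ultimately show False using assms(2) by simp
  qed
  have "ideal_norm D mod 4 = 3" using assms(3) unfolding unique_euclidean_semiring_class.cong_def by simp
  thus ?thesis
    by (intro that[of \<pi>], unfold_locales)
       (use \<pi> \<open>\<pi> \<noteq> 0\<close> assms ideal_norm_princ in auto)
qed

section \<open>Analytic continuation of lattice sums\<close>

text \<open>The summand \<open>u |u|^(-2s)\<close> of the Hecke series. The base of the power is a
  nonnegative real, so multiplicativity needs no branch correction. At \<open>s = 1\<close> the
  value is \<open>1 / cnj u\<close>, the source of the conjugation.\<close>

definition hterm :: "complex \<Rightarrow> complex \<Rightarrow> complex" where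
  "hterm s u = u * complex_of_real (norm u ^ 2) powr (- s)"

lemma hterm_mult: "hterm s (u * v) = hterm s u * hterm s v"
proof -
  have "complex_of_real (norm (u * v) ^ 2) powr (- s) =
      (complex_of_real (norm u ^ 2) * complex_of_real (norm v ^ 2)) powr (- s)"
    by (simp add: norm_mult power_mult_distrib)
  also have "\<dots> = complex_of_real (norm u ^ 2) powr (- s) * complex_of_real (norm v ^ 2) powr (- s)"
    by (rule powr_times_real) auto
  finally show ?thesis by (simp add: hterm_def)
qed

lemma hterm_0 [simp]: "hterm s 0 = 0" and hterm_minus: "hterm s (- u) = - hterm s u"
  by (simp_all add: hterm_def)

lemma hterm_one: "hterm 1 u = inverse (cnj u)"
proof (cases "u = 0")
  case False
  have "hterm 1 u = u / complex_of_real (norm u ^ 2)"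
    using False by (simp add: hterm_def powr_minus divide_inverse)
  also have "\<dots> = inverse (cnj u)"
    using False by (simp add: complex_norm_square field_simps del: of_real_power)
  finally show ?thesis .
qed auto

lemma norm_hterm: "norm (hterm s u) = (if u = 0 then 0 else norm u powr (1 - 2 * Re s))"
proof (cases "u = 0")
  case False
  have "norm (hterm s u) = norm u * (norm u ^ 2) powr (- Re s)"
    unfolding hterm_def norm_mult by (subst norm_powr_real_powr) auto
  also have "norm u ^ 2 = norm u powr 2" using False by simp
  also have "(norm u powr 2) powr (- Re s) = norm u powr (- 2 * Re s)" by (subst powr_powr) simp
  also have "norm u * norm u powr (- 2 * Re s) = norm u powr 1 * norm u powr (- 2 * Re s)" using False by simp
  also have "\<dots> = norm u powr (1 - 2 * Re s)" by (subst powr_add[symmetric]) simp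
  finally show ?thesis using False by simp
qed auto

lemma holomorphic_hterm [holomorphic_intros]: "(\<lambda>s. hterm s u) holomorphic_on A"
proof (cases "u = 0")
  case False
  thus ?thesis unfolding hterm_def powr_def by (auto intro!: holomorphic_intros)
qed auto

text \<open>Since \<open>|v|^2 = exp (Ln v + cnj (Ln v))\<close>, the exponent is real-linear in
  \<open>Ln v\<close>. Its dependence on \<open>v\<close> is not holomorphic, so Taylor expansion
  has to go through this form.\<close>

lemma hterm_exp:
  assumes "v \<noteq> 0"
  shows "hterm s v = exp (Ln v - s * (Ln v + cnj (Ln v)))"
proof -
  have "complex_of_real (norm v ^ 2) powr (- s) = exp (- s * Ln (complex_of_real (norm v ^ 2)))"
    using assms by (simp add: powr_def)
  also have "Ln (complex_of_real (norm v ^ 2)) = complex_of_real (ln (norm v ^ 2))"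
    using assms by (intro Ln_of_real) auto
  also have "ln (norm v ^ 2) = 2 * Re (Ln v)" using assms by (simp add: ln_realpow)
  also have "complex_of_real (2 * Re (Ln v)) = Ln v + cnj (Ln v)" by (simp add: complex_add_cnj)
  finally show ?thesis using assms by (simp add: hterm_def exp_diff exp_minus divide_inverse)
qed

text \<open>The constant produced by the Taylor estimate: \<open>2 B + 4 B^2 exp B\<close> with
  \<open>B = 1 + 2 r\<close> and \<open>r\<close> the norm of \<open>s\<close>. Monotonicity makes
  it uniform on discs in \<open>s\<close>.\<close>

definition hbound :: "real \<Rightarrow> real" where
  "hbound r = 2 * (1 + 2 * r) + 4 * (1 + 2 * r) ^ 2 * exp (1 + 2 * r)"

lemma hbound_mono: "0 \<le> r \<Longrightarrow> r \<le> r' \<Longrightarrow> hbound r \<le> hbound r'"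
  unfolding hbound_def by (intro add_mono mult_mono power_mono) auto

lemma hbound_nonneg: "0 \<le> r \<Longrightarrow> hbound r \<ge> 0"
  by (simp add: hbound_def)

text \<open>First-order expansion at 1, where \<open>c\<close> is the real-linear coefficient. The
  linear term is odd in \<open>\<tau>\<close>, so it cancels in the second difference and only the
  quadratic error survives.\<close>

lemma hterm_taylor:
  fixes s u \<tau> :: complex
  assumes u: "norm u \<ge> 2" and \<tau>: "\<tau> = 1 \<or> \<tau> = -1"
  defines "c \<equiv> 1 / u - s * (1 / u + cnj (1 / u))"
  shows "norm (hterm s (1 + \<tau> / u) - 1 - \<tau> * c) \<le> hbound (norm s) / norm u ^ 2"
proof -
  define a where "a = Ln (1 + \<tau> / u)"
  define \<delta> where "\<delta> = a - \<tau> / u"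
  define B where "B = 1 + 2 * norm s"
  have n\<tau>: "norm \<tau> = 1" "cnj \<tau> = \<tau>" using \<tau> by auto
  have nu: "norm (\<tau> / u) = 1 / norm u" by (simp add: norm_divide n\<tau>)
  have half: "1 / norm u \<le> 1 / 2" by (rule frac_le) (use u in auto)
  have u0: "norm u > 0" using u by linarith
  have \<delta>: "norm \<delta> \<le> 2 / norm u ^ 2"
  proof -
    have "norm \<delta> \<le> norm (\<tau> / u) ^ 2 / (1 - norm (\<tau> / u))"
      unfolding \<delta>_def a_def by (rule Ln_approx_linear) (use half in \<open>simp add: nu\<close>)
    also have "\<dots> \<le> norm (\<tau> / u) ^ 2 / (1 / 2)"
      unfolding nu by (intro divide_left_mono) (use half in auto)
    finally show ?thesis unfolding nu by (simp add: power_divide)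
  qed
  \<comment> \<open>\<open>E\<close> is the exponent of \<open>hterm s (1 + \<tau> / u)\<close>: its
    linear part is \<open>\<tau> * c\<close>, and \<open>\<eta>\<close> is what the error
    \<open>\<delta>\<close> of the logarithm turns into.\<close>
  define E where "E = a - s * (a + cnj a)"
  define \<eta> where "\<eta> = \<delta> - s * (\<delta> + cnj \<delta>)"
  have E_eq: "E = \<tau> * c + \<eta>"
    unfolding E_def \<eta>_def \<delta>_def c_def by (simp add: algebra_simps n\<tau> divide_inverse)
  have lin: "norm (w - s * (w + cnj w)) \<le> B * norm w" for w
  proof -
    have "norm (w - s * (w + cnj w)) \<le> norm w + norm s * norm (w + cnj w)"
      using norm_triangle_ineq4[of w "s * (w + cnj w)"] by (simp add: norm_mult)
    also have "norm s * norm (w + cnj w) \<le> norm s * (2 * norm w)"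
      using norm_triangle_ineq[of w "cnj w"] by (intro mult_left_mono) auto
    finally show ?thesis by (simp add: B_def algebra_simps)
  qed
  have B: "B \<ge> 1" by (simp add: B_def)
  have \<eta>: "norm \<eta> \<le> 2 * B / norm u ^ 2"
  proof -
    have "norm \<eta> \<le> B * norm \<delta>" unfolding \<eta>_def by (rule lin)
    also have "\<dots> \<le> B * (2 / norm u ^ 2)" using \<delta> B by (intro mult_left_mono) auto
    finally show ?thesis by (simp add: mult.commute)
  qed
  have "norm E \<le> B * norm a" unfolding E_def by (rule lin)
  also have "norm a \<le> norm \<delta> + norm (\<tau> / u)" unfolding \<delta>_def using norm_triangle_ineq[of "a - \<tau> / u" "\<tau> / u"] by simp
  also have "\<dots> \<le> 2 / norm u"
  proof -
    have "2 / norm u ^ 2 = (2 / norm u) * (1 / norm u)" by (simp add: power2_eq_square)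
    also have "\<dots> \<le> 1 * (1 / norm u)" using divide_le_eq_1_pos[OF u0] u by (intro mult_right_mono) auto
    finally show ?thesis using \<delta> unfolding nu by simp
  qed
  finally have E: "norm E \<le> 2 * B / norm u" using B by (simp add: mult_left_mono mult.commute)
  have EB: "norm E \<le> B"
  proof -
    have "2 * B / norm u = 2 * B * (1 / norm u)" by simp
    also have "\<dots> \<le> 2 * B * (1 / 2)" using half B by (intro mult_left_mono) auto
    finally show ?thesis using E by simp
  qed
  have exp: "norm (exp E - 1 - E) \<le> 4 * B ^ 2 * exp B / norm u ^ 2"
  proof -
    have "norm (exp E - (\<Sum>i\<le>1. E ^ i / fact i)) \<le> exp \<bar>Re E\<bar> * norm E ^ Suc 1 / fact 1"
      by (rule Taylor_exp)
    hence "norm (exp E - 1 - E) \<le> exp \<bar>Re E\<bar> * norm E ^ 2" by (simp add: algebra_simps power2_eq_square)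
    also have "\<dots> \<le> exp B * (2 * B / norm u) ^ 2"
      using E EB abs_Re_le_cmod[of E] by (intro mult_mono power_mono) auto
    finally show ?thesis by (simp add: power_divide power_mult_distrib mult_ac)
  qed
  have ne: "1 + \<tau> / u \<noteq> 0"
  proof
    assume "1 + \<tau> / u = 0"
    hence "norm (\<tau> / u) = 1" by (metis add_eq_0_iff norm_minus_cancel norm_one)
    thus False using half nu by simp
  qed
  have "hterm s (1 + \<tau> / u) = exp E" unfolding E_def a_def by (rule hterm_exp[OF ne])
  hence "hterm s (1 + \<tau> / u) - 1 - \<tau> * c = (exp E - 1 - E) + \<eta>" using E_eq by simp
  also have "norm \<dots> \<le> 4 * B ^ 2 * exp B / norm u ^ 2 + 2 * B / norm u ^ 2"
    by (rule norm_triangle_le[OF add_mono[OF exp \<eta>]])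
  also have "\<dots> = hbound (norm s) / norm u ^ 2" by (simp add: hbound_def B_def add_divide_distrib)
  finally show ?thesis .
qed

text \<open>Multiplicativity factors out \<open>hterm s u\<close> and leaves arguments
  \<open>1 + 1 / u\<close> and \<open>1 - 1 / u\<close>, whose linear terms cancel. The exponent
  \<open>1 + 2 * Re s\<close> exceeds 2 exactly for \<open>Re s > 1/2\<close>.\<close>

lemma norm_second_diff_hterm:
  assumes u: "norm u \<ge> 2"
  shows "norm (second_diff (hterm s) u) \<le> 2 * hbound (norm s) * norm u powr (- 1 - 2 * Re s)"
proof -
  define c where "c = 1 / u - s * (1 / u + cnj (1 / u))"
  have ne: "u \<noteq> 0" using u by auto
  have "u + 1 = u * (1 + 1 / u)" "u - 1 = u * (1 + (-1) / u)" using ne by (simp_all add: field_simps)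
  hence "second_diff (hterm s) u = hterm s u * ((hterm s (1 + 1 / u) - 1 - 1 * c) + (hterm s (1 + (-1) / u) - 1 - (-1) * c))"
    unfolding second_diff_def by (simp only: hterm_mult) (simp add: algebra_simps)
  hence "norm (second_diff (hterm s) u) = norm (hterm s u) *
     norm ((hterm s (1 + 1 / u) - 1 - 1 * c) + (hterm s (1 + (-1) / u) - 1 - (-1) * c))"
    by (simp only: norm_mult)
  also have "\<dots> \<le> norm (hterm s u) * (hbound (norm s) / norm u ^ 2 + hbound (norm s) / norm u ^ 2)"
    unfolding c_def
    by (intro mult_left_mono norm_triangle_le add_mono hterm_taylor u) auto
  also have "\<dots> = 2 * hbound (norm s) * (norm u powr (1 - 2 * Re s) * norm u powr (-2))"
    using ne by (simp add: norm_hterm powr_minus divide_inverse)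
  also have "norm u powr (1 - 2 * Re s) * norm u powr (-2) = norm u powr (- 1 - 2 * Re s)"
    by (subst powr_add[symmetric]) simp
  finally show ?thesis .
qed

section \<open>Continuation of series over shifted lattices\<close>

lemma norm_shift_ge:
  fixes z x :: complex
  assumes "norm x > 2 * norm z + 4"
  shows "norm (z + x) \<ge> norm x - (2 * norm z + 4) / 2" "norm (z + x) \<ge> 2" "norm x - (2 * norm z + 4) / 2 > 0"
proof -
  have "norm (z + x) \<ge> norm x - norm z" using norm_diff_ineq[of x z] by (simp add: add.commute)
  moreover have "(2 * norm z + 4) / 2 = norm z + 2" by simp
  ultimately show "norm (z + x) \<ge> norm x - (2 * norm z + 4) / 2" "norm (z + x) \<ge> 2"
    "norm x - (2 * norm z + 4) / 2 > 0"
    using assms norm_ge_zero[of z] by linarith+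
qed

lemma summable_on_O_shifted_powr:
  fixes z :: complex
  assumes "t > 2"
  shows "(\<lambda>x. norm (z + x) powr (- t)) summable_on \<O>"
proof -
  let ?r = "2 * norm z + 4"
  let ?F = "{x\<in>\<O>. norm x \<le> ?r}"
  have "(\<lambda>x. if norm x \<le> ?r then 0 else (norm x - ?r / 2) powr (- t)) summable_on \<O>"
    by (rule summable_on_O_shift[OF assms]) (use norm_ge_zero[of z] in linarith)
  hence "(\<lambda>x. if norm x \<le> ?r then 0 else (norm x - ?r / 2) powr (- t)) summable_on (\<O> - ?F)"
    by (rule summable_on_subset) auto
  hence "(\<lambda>x. norm (z + x) powr (- t)) summable_on (\<O> - ?F)"
  proof (rule summable_on_comparison_test)
    fix x assume "x \<in> \<O> - ?F"
    hence x: "norm x > ?r" by auto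
    have "norm (z + x) powr (- t) \<le> (norm x - ?r / 2) powr (- t)"
      using norm_shift_ge[OF x] assms by (intro powr_mono2') auto
    thus "norm (z + x) powr (- t) \<le> (if norm x \<le> ?r then 0 else (norm x - ?r / 2) powr (- t))"
      using x by simp
  qed auto
  moreover have "(\<lambda>x. norm (z + x) powr (- t)) summable_on ?F"
    by (intro summable_on_finite finite_O_norm_le)
  ultimately have "(\<lambda>x. norm (z + x) powr (- t)) summable_on (\<O> - ?F) \<union> ?F" by (rule summable_on_union)
  also have "(\<O> - ?F) \<union> ?F = \<O>" by auto
  finally show ?thesis .
qed

lemma summable_on_hterm:
  assumes "Re s > 3/2" and bd: "\<And>x. x \<in> \<O> \<Longrightarrow> norm (\<phi> x) \<le> B"
  shows "(\<lambda>x. \<phi> x * hterm s (z + x)) summable_on \<O>"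
proof (rule abs_summable_summable)
  have "(\<lambda>x. norm (z + x) powr (- (2 * Re s - 1))) summable_on \<O>"
    by (rule summable_on_O_shifted_powr) (use assms(1) in auto)
  hence "(\<lambda>x. B * norm (z + x) powr (- (2 * Re s - 1))) summable_on \<O>" by (rule summable_on_cmult_right)
  thus "(\<lambda>x. norm (\<phi> x * hterm s (z + x))) summable_on \<O>"
  proof (rule summable_on_comparison_test)
    fix x assume x: "x \<in> \<O>"
    have "norm (\<phi> x * hterm s (z + x)) \<le> B * norm (hterm s (z + x))"
      unfolding norm_mult by (intro mult_right_mono bd x) auto
    also have "norm (hterm s (z + x)) \<le> norm (z + x) powr (- (2 * Re s - 1))" by (simp add: norm_hterm)
    finally show "norm (\<phi> x * hterm s (z + x)) \<le> B * norm (z + x) powr (- (2 * Re s - 1))"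
      using order_trans[OF norm_ge_zero bd[OF x]] by (simp add: mult_left_mono)
  qed auto
qed

text \<open>The series of \<open>second_diff \<phi> x * hterm s (z + x)\<close> after summation by
  parts. For bounded \<open>\<phi>\<close> it converges on a half-plane that contains 1.\<close>

definition diff_series :: "(complex \<Rightarrow> complex) \<Rightarrow> complex \<Rightarrow> complex \<Rightarrow> complex" where
  "diff_series \<phi> z s = (\<Sum>\<^sub>\<infinity>x\<in>\<O>. \<phi> x * second_diff (hterm s) (z + x))"

lemma holomorphic_diff_series:
  assumes bd: "\<And>x. x \<in> \<O> \<Longrightarrow> norm (\<phi> x) \<le> B"
  shows "diff_series \<phi> z holomorphic_on {s. Re s > 1/2}"
  unfolding diff_series_def[abs_def]
proof (rule holomorphic_on_infsum)
  show "open {s. Re s > 1/2}" by (rule open_halfspace_Re_gt)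
  show "(\<lambda>s. \<phi> x * second_diff (hterm s) (z + x)) holomorphic_on {s. Re s > 1/2}" for x
    unfolding second_diff_def by (intro holomorphic_intros)
  fix s0 assume "s0 \<in> {s. Re s > 1/2}"
  hence s0: "Re s0 > 1/2" by simp
  \<comment> \<open>Half the distance to the boundary line, so that \<open>Re s\<close> stays above
    some \<open>\<sigma> > 1/2\<close> on the whole disc.\<close>
  define r where "r = (Re s0 - 1/2) / 2"
  define \<sigma> where "\<sigma> = Re s0 - r"
  have r: "r > 0" "\<sigma> > 1/2" using s0 by (auto simp: r_def \<sigma>_def field_simps)
  have Re_ge: "Re s \<ge> \<sigma>" if "s \<in> cball s0 r" for s
    using that abs_Re_le_cmod[of "s0 - s"] by (auto simp: \<sigma>_def dist_norm)
  define C where "C = 2 * hbound (norm s0 + r)"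
  define M where "M = (\<lambda>x. B * (C * norm (z + x) powr (- (1 + 2 * \<sigma>))))"
  have B0: "B \<ge> 0" using order_trans[OF norm_ge_zero bd[of 0]] by simp
  have "(\<lambda>x. norm (z + x) powr (- (1 + 2 * \<sigma>))) summable_on \<O>"
    by (rule summable_on_O_shifted_powr) (use r in auto)
  hence M: "M summable_on \<O>" unfolding M_def by (intro summable_on_cmult_right)
  have le: "norm (\<phi> x * second_diff (hterm s) (z + x)) \<le> M x"
    if x: "x \<in> \<O> - {x\<in>\<O>. norm x \<le> 2 * norm z + 4}" and s: "s \<in> cball s0 r" for x s
  proof -
    have ge: "norm (z + x) \<ge> 2" using x by (intro norm_shift_ge) auto
    have ns: "norm s \<le> norm s0 + r"
      using s norm_triangle_ineq3[of s s0] by (auto simp: dist_norm norm_minus_commute)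
    have "norm (second_diff (hterm s) (z + x)) \<le> 2 * hbound (norm s) * norm (z + x) powr (- 1 - 2 * Re s)"
      by (rule norm_second_diff_hterm[OF ge])
    also have "\<dots> \<le> C * norm (z + x) powr (- (1 + 2 * \<sigma>))"
      unfolding C_def using ns Re_ge[OF s] ge hbound_mono[of "norm s" "norm s0 + r"] hbound_nonneg[of "norm s0 + r"] hbound_nonneg[of "norm s"] r
      by (intro mult_mono powr_mono) auto
    finally show ?thesis unfolding M_def norm_mult using bd[of x] x B0 by (intro mult_mono) auto
  qed
  have sub: "cball s0 r \<subseteq> {s. Re s > 1/2}" using Re_ge r(2) by fastforce
  have "cball s0 r \<subseteq> {s. Re s > 1/2} \<and> finite {x\<in>\<O>. norm x \<le> 2 * norm z + 4} \<and> M summable_on \<O> \<and>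
     (\<forall>x\<in>\<O> - {x\<in>\<O>. norm x \<le> 2 * norm z + 4}. \<forall>s\<in>cball s0 r. norm (\<phi> x * second_diff (hterm s) (z + x)) \<le> M x)"
    by (intro conjI ballI sub finite_O_norm_le M le)
  thus "\<exists>r>0. \<exists>F M. cball s0 r \<subseteq> {s. Re s > 1/2} \<and> finite F \<and> M summable_on \<O> \<and>
          (\<forall>x\<in>\<O> - F. \<forall>s\<in>cball s0 r. norm (\<phi> x * second_diff (hterm s) (z + x)) \<le> M x)"
    by (intro exI[of _ r] conjI[OF r(1)] exI[of _ "{x\<in>\<O>. norm x \<le> 2 * norm z + 4}"] exI[of _ M])
qed

text \<open>Summation by parts. For \<open>Re s > 3/2\<close> the series converge absolutely, so the
  difference expands into three sums, and the lattice translations by 1 and -1 move it from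
  \<open>hterm\<close> to \<open>\<phi>\<close>.\<close>

lemma diff_series_eq:
  assumes s: "Re s > 3/2" and bd: "\<And>x. x \<in> \<O> \<Longrightarrow> norm (\<phi> x) \<le> B"
  shows "((\<lambda>x. second_diff \<phi> x * hterm s (z + x)) has_sum diff_series \<phi> z s) \<O>"
proof -
  define F where "F = (\<lambda>\<psi>. \<Sum>\<^sub>\<infinity>x\<in>\<O>. \<psi> x * hterm s (z + x) :: complex)"
  define up where "up = (\<lambda>x. \<phi> (x + 1))"
  define down where "down = (\<lambda>x. \<phi> (x - 1))"
  have hs: "((\<lambda>x. \<psi> x * hterm s (z + x)) has_sum F \<psi>) \<O>"
    if "\<And>x. x \<in> \<O> \<Longrightarrow> norm (\<psi> x) \<le> B" for \<psi>
    using summable_on_hterm[OF s that] by (simp add: F_def)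
  have 0: "((\<lambda>x. \<phi> x * hterm s (z + x)) has_sum F \<phi>) \<O>" by (rule hs[OF bd])
  have 1: "((\<lambda>x. up x * hterm s (z + x)) has_sum F up) \<O>" by (rule hs) (auto simp: up_def intro!: bd)
  have 2: "((\<lambda>x. down x * hterm s (z + x)) has_sum F down) \<O>" by (rule hs) (auto simp: down_def intro!: bd)
  have 3: "((\<lambda>x. \<phi> x * hterm s (z + x - 1)) has_sum F up) \<O>"
    by (rule has_sum_reindex_bij_witness[where i = "\<lambda>x. x + 1" and j = "\<lambda>x. x - 1", THEN iffD2, OF _ _ _ _ _ _ 1])
       (auto simp: up_def algebra_simps)
  have 4: "((\<lambda>x. \<phi> x * hterm s (z + x + 1)) has_sum F down) \<O>"
    by (rule has_sum_reindex_bij_witness[where i = "\<lambda>x. x - 1" and j = "\<lambda>x. x + 1", THEN iffD2, OF _ _ _ _ _ _ 2])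
       (auto simp: down_def algebra_simps)
  have "((\<lambda>x. up x * hterm s (z + x) + (-2) * (\<phi> x * hterm s (z + x)) + down x * hterm s (z + x))
      has_sum F up + (-2) * F \<phi> + F down) \<O>"
    by (intro has_sum_add has_sum_cmult_right 0 1 2)
  hence A: "((\<lambda>x. second_diff \<phi> x * hterm s (z + x)) has_sum F up + (-2) * F \<phi> + F down) \<O>"
    by (simp add: second_diff_def up_def down_def algebra_simps)
  have "((\<lambda>x. \<phi> x * hterm s (z + x - 1) + (-2) * (\<phi> x * hterm s (z + x)) + \<phi> x * hterm s (z + x + 1))
      has_sum F up + (-2) * F \<phi> + F down) \<O>"
    by (intro has_sum_add has_sum_cmult_right 0 3 4)
  hence "((\<lambda>x. \<phi> x * second_diff (hterm s) (z + x)) has_sum F up + (-2) * F \<phi> + F down) \<O>"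
    by (simp add: second_diff_def algebra_simps)
  hence "diff_series \<phi> z s = F up + (-2) * F \<phi> + F down" unfolding diff_series_def by (rule infsumI)
  with A show ?thesis by simp
qed

text \<open>Partial sums over one period close up because \<open>g\<close> has total 0. Subtracting
  their mean \<open>\<mu>\<close> restores total 0, so that the construction can be
  iterated.\<close>

lemma periodic_antidifference:
  fixes g :: "int \<Rightarrow> complex" and m :: nat
  assumes "m > 0" and per: "\<And>n. g (n mod int m) = g n" and sum: "(\<Sum>j<m. g (int j)) = 0"
  obtains h where "\<And>n. h (n mod int m) = h n" "\<And>n. h (n + 1) - h n = g n" "(\<Sum>j<m. h (int j)) = 0"
proof -
  define h0 where "h0 = (\<lambda>n. \<Sum>j<nat (n mod int m). g (int j))"
  define \<mu> where "\<mu> = (\<Sum>j<m. h0 (int j)) / of_nat m"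
  have h0: "h0 (n + 1) - h0 n = g n" for n
  proof -
    define k where "k = nat (n mod int m)"
    have k: "int k = n mod int m" "k < m" using assms(1) by (auto simp: k_def nat_less_iff)
    have gk: "g (int k) = g n" using per[of n] k by simp
    have k1: "(n + 1) mod int m = (int k + 1) mod int m" unfolding k(1) by (simp add: mod_add_left_eq)
    show ?thesis
    proof (cases "Suc k = m")
      \<comment> \<open>Here \<open>n + 1\<close> wraps around to residue 0; the increment is still
        \<open>g n\<close> because the sum over a full period vanishes.\<close>
      case True
      hence "(n + 1) mod int m = 0" using k1 by (metis of_nat_Suc add.commute mod_self)
      hence "h0 (n + 1) = 0" by (simp add: h0_def)
      moreover have "h0 n + g (int k) = (\<Sum>j<m. g (int j))" unfolding True[symmetric] by (simp add: h0_def k_def)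
      hence "g n = - h0 n" using sum gk by (simp add: eq_neg_iff_add_eq_0 add.commute)
      ultimately show ?thesis by simp
    next
      case False
      hence "(n + 1) mod int m = int (Suc k)" using k k1 by simp
      hence "h0 (n + 1) = (\<Sum>j<Suc k. g (int j))" by (simp only: h0_def nat_int)
      thus ?thesis using gk by (simp add: h0_def k_def)
    qed
  qed
  show ?thesis
  proof (rule that[of "\<lambda>n. h0 n - \<mu>"])
    show "(\<Sum>j<m. h0 (int j) - \<mu>) = 0" using assms(1) by (simp add: sum_subtractf \<mu>_def)
  qed (use h0 in \<open>auto simp: h0_def\<close>)
qed

section \<open>The L-function\<close>

lemma kappa_eq_1_iff: "x \<in> \<O> \<Longrightarrow> \<kappa> x = 1 \<longleftrightarrow> (\<exists>y\<in>\<O>. x = \<omega> * y)"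
proof
  assume "x \<in> \<O>" and 1: "\<kappa> x = 1"
  then obtain m n where x: "x = of_int m + of_int n * \<omega>" by (auto elim: in_O_E)
  have "even m" using 1 unfolding x kappa_eq by (auto split: if_splits)
  then obtain k where k: "m = 2 * k" by (elim evenE)
  have "x = \<omega> * (of_int k * (1 - \<omega>) + of_int n)"
  proof -
    have "\<omega> * (of_int k * (1 - \<omega>) + of_int n) = of_int k * (\<omega> * (1 - \<omega>)) + of_int n * \<omega>"
      by (simp only: algebra_simps)
    thus ?thesis by (simp add: x k omega_mult_conj)
  qed
  moreover have "of_int k * (1 - \<omega>) + of_int n \<in> \<O>" by (intro O_intros O_of_int O_omega)
  ultimately show "\<exists>y\<in>\<O>. x = \<omega> * y" by blast
next
  assume "\<exists>y\<in>\<O>. x = \<omega> * y"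
  thus "\<kappa> x = 1" using kappa_mult[OF O_omega] by auto
qed

text \<open>Any two continuations agree far to the right, where both represent the series. The
  identity theorem on the smaller of the two half-planes, which still contains \<open>s\<close>,
  makes them agree at \<open>s\<close>.\<close>

lemma hecke_L_eqI:
  assumes f: "f holomorphic_on {z. \<sigma> < Re z}" "\<sigma> < Re s"
    and series: "\<And>z. c < Re z \<Longrightarrow>
      ((\<lambda>C. \<phi> C * of_nat (ideal_norm C) powr (- z)) has_sum f z) {C. ideal C OK \<and> C \<noteq> {0}}"
  shows "hecke_L \<phi> s = f s"
  unfolding hecke_L_def
proof (rule the_equality)
  show "\<exists>g \<sigma> c. \<sigma> < Re s \<and> g holomorphic_on {z. \<sigma> < Re z} \<and> (\<forall>z. c < Re z \<longrightarrow>
      ((\<lambda>C. \<phi> C * of_nat (ideal_norm C) powr (- z)) has_sum g z) {C. ideal C OK \<and> C \<noteq> {0}}) \<and> f s = g s"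
    using assms by blast
  fix v assume "\<exists>g \<sigma> c. \<sigma> < Re s \<and> g holomorphic_on {z. \<sigma> < Re z} \<and> (\<forall>z. c < Re z \<longrightarrow>
      ((\<lambda>C. \<phi> C * of_nat (ideal_norm C) powr (- z)) has_sum g z) {C. ideal C OK \<and> C \<noteq> {0}}) \<and> v = g s"
  then obtain g \<sigma>' c' where g: "\<sigma>' < Re s" "g holomorphic_on {z. \<sigma>' < Re z}" "v = g s"
    and g_series: "\<And>z. c' < Re z \<Longrightarrow>
      ((\<lambda>C. \<phi> C * of_nat (ideal_norm C) powr (- z)) has_sum g z) {C. ideal C OK \<and> C \<noteq> {0}}" by blast
  define \<tau> where "\<tau> = max \<sigma> \<sigma>'"
  define T where "T = max \<tau> (max c c')"
  have "g s = f s"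
  proof (rule analytic_continuation_open[of "{z. T < Re z}" "{z. \<tau> < Re z}" g f s])
    show "{z. T < Re z} \<noteq> {}" using gt_ex[of T] by (auto intro: exI[of _ "complex_of_real _"])
    show "connected {z. \<tau> < Re z}" by (intro convex_connected convex_halfspace_Re_gt)
    show "g z = f z" if "z \<in> {z. T < Re z}" for z
      using that series[of z] g_series[of z] by (auto simp: T_def intro: has_sum_unique)
    show "f holomorphic_on {z. \<tau> < Re z}" by (rule holomorphic_on_subset[OF f(1)]) (auto simp: \<tau>_def)
    show "g holomorphic_on {z. \<tau> < Re z}" by (rule holomorphic_on_subset[OF g(2)]) (auto simp: \<tau>_def)
  qed (rule open_halfspace_Re_gt | use f g in \<open>force simp: T_def \<tau>_def\<close>)+
  thus "v = f s" using g by simp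
qed

section \<open>The Hecke series as a lattice sum\<close>

context split_prime
begin

lemma sum_Legendre: "(\<Sum>j<p. Legendre (int j) (int p)) = 0"
proof -
  let ?S = "\<Sum>j\<in>{1..<p}. Legendre (int j) (int p)"
  have "?S = (\<Sum>j\<in>{1..<p}. - Legendre (int j) (int p))"
  proof (rule sum.reindex_bij_witness[of _ "\<lambda>j. p - j" "\<lambda>j. p - j"])
    fix j assume j: "j \<in> {1..<p}"
    have "[int (p - j) = -1 * int j] (mod int p)" using j by (simp add: of_nat_diff cong_iff_dvd_diff)
    hence "Legendre (int (p - j)) (int p) = Legendre (-1 * int j) (int p)" by (rule Legendre_cong)
    thus "- Legendre (int (p - j)) (int p) = Legendre (int j) (int p)"
      unfolding Legendre_mult_p Legendre_minus_one by simp
  qed auto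
  hence "?S = 0" by (simp add: sum_negf)
  moreover have "{..<p} = insert 0 {1..<p}" using p_gt_2 by auto
  ultimately show ?thesis by (simp add: Legendre_def)
qed

text \<open>Adding 1 to \<open>x\<close> adds 1 to its integer residue, so \<open>eps\<close>
  behaves like a \<open>p\<close>-periodic function on the integers. It has mean 0, so two periodic
  antidifferences exist, and periodic functions are bounded.\<close>

lemma eps_second_difference:
  obtains \<delta> B where "\<forall>x\<in>\<O>. norm (\<delta> x) \<le> B" "\<forall>x\<in>\<O>. second_diff \<delta> x = of_int (eps D x)"
proof -
  define g where "g = (\<lambda>n. of_int (Legendre n (int p)) :: complex)"
  have p0: "p > 0" using p_gt_2 by simp
  have "Legendre (n mod int p) (int p) = Legendre n (int p)" for n
    by (rule Legendre_cong) (simp add: cong_mod_left)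
  moreover have "(\<Sum>j<p. g (int j)) = 0" unfolding g_def using sum_Legendre by (metis of_int_sum of_int_0)
  ultimately obtain h1 where h1: "\<And>n. h1 (n mod int p) = h1 n" "\<And>n. h1 (n + 1) - h1 n = g n" "(\<Sum>j<p. h1 (int j)) = 0"
    using periodic_antidifference[OF p0, of g] unfolding g_def by metis
  obtain h2 where h2: "\<And>n. h2 (n mod int p) = h2 n" "\<And>n. h2 (n + 1) - h2 n = h1 n" "(\<Sum>j<p. h2 (int j)) = 0"
    using periodic_antidifference[OF p0 h1(1) h1(3)] by metis
  define r where "r = (\<lambda>x. SOME a :: int. x - of_int a \<in> D)"
  have r: "x - of_int (r x) \<in> D" if "x \<in> \<O>" for x
    unfolding r_def using ex_residue[OF that] by (metis someI)
  \<comment> \<open>The shift by 1 compensates for \<open>second_diff\<close> being centred while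
    the antidifferences are forward ones.\<close>
  define \<delta> where "\<delta> = (\<lambda>x. h2 (r x + 1))"
  have \<delta>: "\<delta> x = h2 (a + 1)" if "x \<in> \<O>" "x - of_int a \<in> D" for x a
  proof -
    have "[r x + 1 = a + 1] (mod int p)" using residue_unique[OF r[OF that(1)] that(2)] by (rule cong_add) simp
    hence "(r x + 1) mod int p = (a + 1) mod int p" by (simp add: unique_euclidean_semiring_class.cong_def)
    thus ?thesis unfolding \<delta>_def by (metis h2(1))
  qed
  show ?thesis
  proof (rule that[of \<delta> "\<Sum>j<p. norm (h2 (int j))"]; rule ballI)
    fix x assume x: "x \<in> \<O>"
    define k where "k = nat ((r x + 1) mod int p)"
    have k: "int k = (r x + 1) mod int p" "k < p" using p0 by (auto simp: k_def nat_less_iff)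
    have "\<delta> x = h2 (int k)" unfolding k \<delta>_def h2(1) ..
    thus "norm (\<delta> x) \<le> (\<Sum>j<p. norm (h2 (int j)))"
      using k(2) member_le_sum[of k "{..<p}" "\<lambda>j. norm (h2 (int j))"] by simp
    obtain a where a: "x - of_int a \<in> D" using ex_residue x .
    have "\<delta> (x + 1) = h2 (a + 1 + 1)" "\<delta> x = h2 (a + 1)" "\<delta> (x - 1) = h2 (a - 1 + 1)"
      by (intro \<delta>; use x a in simp)+
    moreover have "h2 (a + 1 + 1) - h2 (a + 1) = h1 (a + 1)" "h2 (a + 1) - h2 a = h1 a" "h1 (a + 1) - h1 a = g a"
      by (rule h2 h1)+
    ultimately have "second_diff \<delta> x = g a" by (simp add: second_diff_def algebra_simps)
    thus "second_diff \<delta> x = of_int (eps D x)" using eps_eq_Legendre[OF a] by (simp add: g_def)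
  qed
qed

text \<open>The factor 2 counts the two generators of each ideal, which contribute equally because
  \<open>eps\<close> and \<open>hterm\<close> are both odd.\<close>

lemma ex_L_function:
  obtains L where "L holomorphic_on {s. Re s > 1/2}" "hecke_L (psi D) 1 = L 1"
    "\<And>s. Re s > 3/2 \<Longrightarrow> ((\<lambda>x. of_int (eps D x) * hterm s x) has_sum 2 * L s) \<O>"
proof -
  obtain \<delta> B where "\<forall>x\<in>\<O>. norm (\<delta> x) \<le> B" "\<forall>x\<in>\<O>. second_diff \<delta> x = of_int (eps D x)"
    by (rule eps_second_difference)
  hence \<delta>: "\<And>x. x \<in> \<O> \<Longrightarrow> norm (\<delta> x) \<le> B"
    "\<And>x. x \<in> \<O> \<Longrightarrow> second_diff \<delta> x = of_int (eps D x)" by auto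
  define L where "L = (\<lambda>s. diff_series \<delta> 0 s / 2)"
  have hol: "L holomorphic_on {s. Re s > 1/2}"
    unfolding L_def by (intro holomorphic_intros holomorphic_diff_series[of \<delta> B] \<delta>) auto
  have sum: "((\<lambda>x. of_int (eps D x) * hterm s x) has_sum 2 * L s) \<O>" if "Re s > 3/2" for s
  proof -
    have "((\<lambda>x. second_diff \<delta> x * hterm s x) has_sum 2 * L s) \<O>"
      using diff_series_eq[OF that \<delta>(1), where z = 0] by (simp add: L_def)
    thus ?thesis by (rule has_sum_cong[THEN iffD1, rotated]) (simp add: \<delta>)
  qed
  have "hecke_L (psi D) 1 = L 1"
  proof (rule hecke_L_eqI[OF hol])
    fix z :: complex assume z: "3/2 < Re z"
    have "((\<lambda>x. of_int (eps D x) * hterm z x) has_sum 2 * L z) (\<O> - {0})"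
      using sum[OF z] by (rule has_sum_cong_neutral[THEN iffD1, rotated -1]) auto
    hence "((\<lambda>C. psi D C * of_nat (ideal_norm C) powr (- z)) has_sum 2 * L z / 2) {C. ideal C OK \<and> C \<noteq> {0}}"
    proof (rule has_sum_ideals)
      show "of_int (eps D (- x)) * hterm z (- x) = of_int (eps D x) * hterm z x" if "x \<in> \<O>" for x
        using that by (simp add: eps_minus hterm_minus)
      fix x assume x: "x \<in> \<O> - {0}"
      have "of_nat (ideal_norm (princ x)) = complex_of_real (norm x ^ 2)"
        using ideal_norm_princ[of x] x by (metis DiffE of_real_of_nat_eq singletonI)
      thus "psi D (princ x) * of_nat (ideal_norm (princ x)) powr (- z) = of_int (eps D x) * hterm z x"
        using psi_princ[of x] x by (simp add: hterm_def)
    qed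
    thus "((\<lambda>C. psi D C * of_nat (ideal_norm C) powr (- z)) has_sum L z) {C. ideal C OK \<and> C \<noteq> {0}}" by simp
  qed simp
  with hol sum show ?thesis using that by blast
qed

section \<open>The L-value as a combination of values of H\<close>

lemma odd_prime_notin_D: "2 \<notin> D" "\<omega> \<notin> D" "1 - \<omega> \<notin> D"
proof -
  have "\<not> int p dvd 2" using p_gt_2 by (auto dest: zdvd_imp_le)
  thus 2: "2 \<notin> D" using of_int_in_D_iff[of 2] by simp
  have "\<omega> * (1 - \<omega>) \<notin> D" using 2 omega_mult_conj by simp
  thus "\<omega> \<notin> D" "1 - \<omega> \<notin> D"
    using D_intros(6)[of \<omega> "1 - \<omega>"] D_intros(6)[of "1 - \<omega>" \<omega>] by (auto simp: mult.commute)
qed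

text \<open>If \<open>\<pi>\<close> were in the kernel, so would be
  \<open>\<pi> * cnj \<pi> = p\<close>, but \<open>p\<close> is odd.\<close>

lemma kappa_pi: "\<kappa> \<pi> = -1"
proof (rule ccontr)
  assume "\<kappa> \<pi> \<noteq> -1"
  hence "\<kappa> (\<pi> * cnj \<pi>) = 1" using kappa_mult[OF pi_O O_cnj[OF pi_O]] kappa_cases[of \<pi>] by simp
  thus False using kappa_of_int[of "int p"] odd_p unfolding pi_cnj by simp
qed

text \<open>\<open>\<omega>\<close> is invertible modulo \<open>D\<close>, so the multiples
  \<open>\<omega> a\<close> represent all residues. Representatives divisible by
  \<open>\<omega>\<close> are chosen so that \<open>\<kappa>\<close> of the lattice point depends on
  \<open>x\<close> alone.\<close>

lemma bij_betw_residues: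
  "bij_betw (\<lambda>(a, x). \<omega> * of_nat a + \<pi> * x) ({..<p} \<times> \<O>) \<O>"
proof (rule bij_betw_imageI)
  show "inj_on (\<lambda>(a, x). \<omega> * of_nat a + \<pi> * x) ({..<p} \<times> \<O>)"
  proof (rule inj_onI, clarify)
    fix a b x y assume *: "a < p" "x \<in> \<O>" "b < p" "y \<in> \<O>"
      "\<omega> * of_nat a + \<pi> * x = \<omega> * of_nat b + \<pi> * y"
    have "\<omega> * of_int (int a - int b) = (y - x) * \<pi>" using *(5) by (simp add: algebra_simps)
    also have "\<dots> \<in> D" by (intro D_intros O_intros *)
    finally have "of_int (int a - int b) \<in> D" using D_prime[of \<omega> "of_int (int a - int b)"] odd_prime_notin_D by auto
    hence "int p dvd int a - int b" by (simp only: of_int_in_D_iff)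
    hence "int a mod int p = int b mod int p" by (simp add: mod_eq_dvd_iff)
    hence "a = b" using * by simp
    thus "a = b \<and> x = y" using *(5) by simp
  qed
  show "(\<lambda>(a, x). \<omega> * of_nat a + \<pi> * x) ` ({..<p} \<times> \<O>) = \<O>"
  proof
    show "(\<lambda>(a, x). \<omega> * of_nat a + \<pi> * x) ` ({..<p} \<times> \<O>) \<subseteq> \<O>" using pi_O by auto
    show "\<O> \<subseteq> (\<lambda>(a, x). \<omega> * of_nat a + \<pi> * x) ` ({..<p} \<times> \<O>)"
    proof
      fix y assume y: "y \<in> \<O>"
      obtain w where w: "\<omega> - of_int w \<in> D" using ex_residue O_omega .
      obtain b where b: "y - of_int b \<in> D" using ex_residue y .
      have "\<not> int p dvd w" using residue_in_D_iff[OF w] odd_prime_notin_D by blast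
      hence "coprime w (int p)" using prime_p by (metis coprime_commute prime_imp_coprime prime_nat_int_transfer)
      then obtain v where v: "[w * v = 1] (mod int p)" using cong_solve_coprime_int by blast
      define a where "a = nat ((v * b) mod int p)"
      have a: "int a = (v * b) mod int p" "a < p" using p_gt_2 by (auto simp: a_def nat_less_iff)
      have "\<omega> * of_nat a - of_int (w * int a) \<in> D"
        using residue_mult[OF O_omega w, of "of_nat a" "int a"] D_intros(1) by simp
      hence "(y - of_int b) - (\<omega> * of_nat a - of_int (w * int a)) \<in> D" by (rule D_intros(3)[OF b])
      hence "(y - \<omega> * of_nat a) - of_int (b - w * int a) \<in> D" by (simp add: algebra_simps)
      moreover have "[w * int a = b] (mod int p)"
      proof -
        have "[w * int a = w * (v * b)] (mod int p)" unfolding a by (intro cong_mult cong_refl) (simp add: cong_mod_left)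
        also have "w * (v * b) = (w * v) * b" by simp
        also have "[(w * v) * b = 1 * b] (mod int p)" by (intro cong_mult v cong_refl)
        finally show ?thesis by simp
      qed
      hence "int p dvd b - w * int a" by (simp add: cong_iff_dvd_diff dvd_diff_commute)
      ultimately have "y - \<omega> * of_nat a \<in> D" using residue_in_D_iff by blast
      then obtain x where "x \<in> \<O>" "y - \<omega> * of_nat a = x * \<pi>" unfolding D_eq in_princ_iff by blast
      thus "y \<in> (\<lambda>(a, x). \<omega> * of_nat a + \<pi> * x) ` ({..<p} \<times> \<O>)"
        using a(2) by (intro image_eqI[of _ _ "(a, x)"]) (auto simp: algebra_simps)
    qed
  qed
qed

text \<open>The bridge between the two sides: for \<open>Re s > 3/2\<close> it regroups a lattice
  sum proportional to the L-series, and at \<open>s = 1\<close> it is a sum of conjugated values of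
  \<open>H\<close>.\<close>

definition G :: "complex \<Rightarrow> complex" where
  "G s = (\<Sum>a<p. of_int (eps D (of_nat a)) * diff_series (\<lambda>x. - (1/4) * \<kappa> x) (\<omega> * of_nat a / \<pi>) s)"

lemma holomorphic_G: "G holomorphic_on {s. Re s > 1/2}"
  unfolding G_def[abs_def]
  by (intro holomorphic_intros holomorphic_diff_series[of _ "1/4"]) (auto simp: norm_mult)

text \<open>\<open>hterm 1 u\<close> is \<open>inverse (cnj u)\<close> and \<open>\<kappa>\<close>
  is real, so at \<open>s = 1\<close> the difference series is the conjugate of the series defining
  \<open>H\<close>.\<close>

lemma G_1: "G 1 = (\<Sum>a<p. of_int (eps D (of_nat a)) * cnj (H (\<omega> * of_nat a / \<pi>)))"
proof -
  have "diff_series (\<lambda>x. - (1/4) * \<kappa> x) z 1 = cnj (H z)" for z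
  proof -
    have "second_diff (hterm 1) u = cnj (second_diff inverse u)" for u
      by (simp add: second_diff_def hterm_one complex_cnj_inverse)
    moreover have "cnj (\<kappa> x) = \<kappa> x" for x by (simp add: \<kappa>_def)
    ultimately have "diff_series (\<lambda>x. - (1/4) * \<kappa> x) z 1 =
        (\<Sum>\<^sub>\<infinity>x\<in>\<O>. cnj (- (1/4) * (\<kappa> x * second_diff inverse (z + x))))"
      unfolding diff_series_def by (simp add: mult_ac)
    also have "\<dots> = cnj (\<Sum>\<^sub>\<infinity>x\<in>\<O>. - (1/4) * (\<kappa> x * second_diff inverse (z + x)))" by (rule infsum_cnj)
    also have "(\<Sum>\<^sub>\<infinity>x\<in>\<O>. - (1/4) * (\<kappa> x * second_diff inverse (z + x))) = H z"
      unfolding H_def H_sum_def by (rule infsum_cmult_right')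
    finally show ?thesis .
  qed
  thus ?thesis by (simp add: G_def)
qed

text \<open>Regrouping over \<open>y = \<omega> a + \<pi> x\<close> turns \<open>G\<close> into a
  multiple of the L-series twisted by \<open>\<kappa>\<close>. Since \<open>\<kappa> + 1\<close> is
  twice the indicator of \<open>\<omega> \<O>\<close>, the twisted and plain sums \<open>m\<close>
  and \<open>l\<close> add up to \<open>2 * eps D \<omega> * hterm s \<omega> * l\<close>.\<close>

lemma G_eq_L:
  assumes s: "Re s > 3/2" and L: "((\<lambda>x. of_int (eps D x) * hterm s x) has_sum l) \<O>"
  shows "G s = hterm s (1 / \<pi>) * of_int (eps D \<omega>) * (2 * of_int (eps D \<omega>) * hterm s \<omega> - 1) * l"
proof -
  let ?e = "\<lambda>x. of_int (eps D x) :: complex"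
  let ?t = "\<lambda>x. ?e x * hterm s x"
  let ?b = "\<lambda>(a, x). \<omega> * of_nat a + \<pi> * x"
  have e2: "?e \<omega> * ?e \<omega> = 1"
    using eps_values[OF O_omega] eps_eq_0_iff[OF O_omega] odd_prime_notin_D by auto
  have summ: "(\<lambda>x. ?e x * \<kappa> x * hterm s x) summable_on \<O>"
    using summable_on_hterm[OF s, of "\<lambda>x. ?e x * \<kappa> x" 1 0] eps_values by (fastforce simp: norm_mult)
  define m where "m = (\<Sum>\<^sub>\<infinity>x\<in>\<O>. ?e x * \<kappa> x * hterm s x)"
  \<comment> \<open>Homogeneity of \<open>hterm\<close> pulls out \<open>1 / \<pi>\<close>. For
    \<open>y = \<omega> a + \<pi> x\<close> one has \<open>\<kappa> y = \<kappa> x\<close> and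
    \<open>eps D y = eps D \<omega> * eps D a\<close>, and \<open>eps D \<omega>\<close> squares to
    1.\<close>
  have term_eq: "?e (of_nat a) * (\<kappa> x * hterm s (\<omega> * of_nat a / \<pi> + x)) =
      hterm s (1 / \<pi>) * ?e \<omega> * (?e (?b (a, x)) * \<kappa> (?b (a, x)) * hterm s (?b (a, x)))" if x: "x \<in> \<O>" for a x
  proof -
    have y: "\<omega> * of_nat a + \<pi> * x \<in> \<O>" using pi_O x by auto
    have "\<omega> * of_nat a / \<pi> + x = (1 / \<pi>) * (\<omega> * of_nat a + \<pi> * x)" by (simp add: field_simps)
    hence 1: "hterm s (\<omega> * of_nat a / \<pi> + x) = hterm s (1 / \<pi>) * hterm s (\<omega> * of_nat a + \<pi> * x)"
      by (simp only: hterm_mult)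
    have "\<kappa> (\<omega> * of_nat a + \<pi> * x) = \<kappa> (\<omega> * of_nat a) * \<kappa> (\<pi> * x)" using pi_O x by (intro kappa_add) auto
    also have "\<dots> = \<kappa> x" using kappa_mult[OF O_omega O_of_nat] kappa_mult[OF pi_O x] kappa_pi by simp
    finally have 2: "\<kappa> (\<omega> * of_nat a + \<pi> * x) = \<kappa> x" .
    have "(\<omega> * of_nat a + \<pi> * x) - \<omega> * of_nat a \<in> D" using D_intros(6)[OF x D_intros(2)] by (simp add: mult.commute)
    hence "eps D (\<omega> * of_nat a + \<pi> * x) = eps D (\<omega> * of_nat a)" using y by (intro eps_cong) auto
    hence 3: "?e (\<omega> * of_nat a + \<pi> * x) = ?e \<omega> * ?e (of_nat a)" by (simp add: eps_mult)
    have 4: "?e \<omega> * ?e (\<omega> * of_nat a + \<pi> * x) = ?e (of_nat a)"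
      by (simp only: 3 mult.assoc[symmetric] e2 mult_1)
    have 5: "A * ?e \<omega> * (?e (\<omega> * of_nat a + \<pi> * x) * k * h) = ?e (of_nat a) * (k * (A * h))" for A k h
      unfolding 4[symmetric] by (simp only: mult_ac)
    show ?thesis unfolding prod.case 1 2 by (rule 5[symmetric])
  qed
  have "diff_series (\<lambda>x. - (1/4) * \<kappa> x) z s = (\<Sum>\<^sub>\<infinity>x\<in>\<O>. \<kappa> x * hterm s (z + x))" for z
  proof -
    have "second_diff (\<lambda>x. - (1/4) * \<kappa> x) x = \<kappa> x" if "x \<in> \<O>" for x
      using kappa_add[OF that, of 1] kappa_add[OF that, of "-1"] by (simp add: second_diff_def)
    moreover have "((\<lambda>x. second_diff (\<lambda>x. - (1/4) * \<kappa> x) x * hterm s (z + x)) has_sum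
        diff_series (\<lambda>x. - (1/4) * \<kappa> x) z s) \<O>"
      by (rule diff_series_eq[OF s, of _ "1/4"]) (simp add: norm_mult)
    ultimately show ?thesis by (metis (mono_tags, lifting) infsumI infsum_cong)
  qed
  hence "G s = (\<Sum>a<p. \<Sum>\<^sub>\<infinity>x\<in>\<O>. ?e (of_nat a) * (\<kappa> x * hterm s (\<omega> * of_nat a / \<pi> + x)))"
    unfolding G_def by (simp add: infsum_cmult_right')
  also have "\<dots> = (\<Sum>a<p. \<Sum>\<^sub>\<infinity>x\<in>\<O>. hterm s (1 / \<pi>) * ?e \<omega> * (?e (?b (a, x)) * \<kappa> (?b (a, x)) * hterm s (?b (a, x))))"
    using term_eq by (intro sum.cong refl infsum_cong)
  also have "\<dots> = hterm s (1 / \<pi>) * ?e \<omega> * (\<Sum>a<p. \<Sum>\<^sub>\<infinity>x\<in>\<O>. ?e (?b (a, x)) * \<kappa> (?b (a, x)) * hterm s (?b (a, x)))"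
    unfolding infsum_cmult_right' by (rule sum_distrib_left[symmetric])
  also have "(\<Sum>a<p. \<Sum>\<^sub>\<infinity>x\<in>\<O>. ?e (?b (a, x)) * \<kappa> (?b (a, x)) * hterm s (?b (a, x))) =
      (\<Sum>\<^sub>\<infinity>a\<in>{..<p}. \<Sum>\<^sub>\<infinity>x\<in>\<O>. ?e (?b (a, x)) * \<kappa> (?b (a, x)) * hterm s (?b (a, x)))" by simp
  also have "\<dots> = (\<Sum>\<^sub>\<infinity>y\<in>{..<p} \<times> \<O>. ?e (?b y) * \<kappa> (?b y) * hterm s (?b y))"
    by (rule infsum_Sigma_banach)
       (use summ summable_on_reindex_bij_betw[OF bij_betw_residues, of "\<lambda>x. ?e x * \<kappa> x * hterm s x"] in simp)
  also have "\<dots> = m"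
    unfolding m_def by (rule infsum_reindex_bij_betw[OF bij_betw_residues])
  finally have G: "G s = hterm s (1 / \<pi>) * ?e \<omega> * m" .
  have m: "((\<lambda>x. ?e x * \<kappa> x * hterm s x) has_sum m) \<O>" unfolding m_def using summ by simp
  \<comment> \<open>Where \<open>\<kappa> x = - 1\<close> the two terms cancel; what remains runs
    over \<open>\<omega> \<O>\<close> and is pulled back along multiplication by
    \<open>\<omega>\<close>.\<close>
  have "((\<lambda>x. ?e x * \<kappa> x * hterm s x + ?t x) has_sum m + l) \<O>" by (rule has_sum_add[OF m L])
  hence 1: "((\<lambda>x. ?e x * \<kappa> x * hterm s x + ?t x) has_sum m + l) ((*) \<omega> ` \<O>)"
  proof (rule has_sum_cong_neutral[THEN iffD1, rotated -1])
    fix x assume "x \<in> \<O> - (*) \<omega> ` \<O>"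
    hence "\<kappa> x \<noteq> 1" using kappa_eq_1_iff[of x] by auto
    hence "\<kappa> x = -1" using kappa_cases by blast
    thus "?e x * \<kappa> x * hterm s x + ?t x = 0" by simp
  qed auto
  have "((\<lambda>x. (2 * ?e \<omega> * hterm s \<omega>) * ?t x) has_sum m + l) \<O>"
  proof -
    have "(((\<lambda>x. ?e x * \<kappa> x * hterm s x + ?t x) \<circ> (*) \<omega>) has_sum m + l) \<O>"
      using 1 by (subst (asm) has_sum_reindex) (auto simp: inj_on_def)
    thus ?thesis
    proof (rule has_sum_cong[THEN iffD1, rotated])
      fix x assume x: "x \<in> \<O>"
      have "\<kappa> (\<omega> * x) = 1" using kappa_mult[OF O_omega x] by simp
      thus "((\<lambda>x. ?e x * \<kappa> x * hterm s x + ?t x) \<circ> (*) \<omega>) x = (2 * ?e \<omega> * hterm s \<omega>) * ?t x"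
        using x by (simp add: eps_mult hterm_mult)
    qed
  qed
  moreover have "((\<lambda>x. (2 * ?e \<omega> * hterm s \<omega>) * ?t x) has_sum (2 * ?e \<omega> * hterm s \<omega>) * l) \<O>"
    by (rule has_sum_cmult_right[OF L])
  ultimately have "m + l = (2 * ?e \<omega> * hterm s \<omega>) * l" using has_sum_unique by blast
  hence "m = (2 * ?e \<omega> * hterm s \<omega> - 1) * l" by (simp add: algebra_simps eq_diff_eq)
  thus ?thesis using G by (simp only: mult.assoc)
qed

text \<open>The proportionality between \<open>G\<close> and \<open>L\<close>, known for
  \<open>Re s > 3/2\<close>, extends to \<open>Re s > 1/2\<close> by analytic continuation, so a
  zero of \<open>L\<close> at 1 is a zero of \<open>G\<close>.\<close>

lemma L_zero_imp_sum_zero: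
  assumes "hecke_L (psi D) 1 = 0"
  shows "(\<Sum>a<p. of_int (eps D (of_nat a)) * H (\<omega> * of_nat a / \<pi>)) = 0"
proof -
  obtain L where L: "L holomorphic_on {s. Re s > 1/2}" "hecke_L (psi D) 1 = L 1"
    "\<And>s. Re s > 3/2 \<Longrightarrow> ((\<lambda>x. of_int (eps D x) * hterm s x) has_sum 2 * L s) \<O>"
    using ex_L_function by metis
  define f where "f = (\<lambda>s. hterm s (1 / \<pi>) * of_int (eps D \<omega>) * (2 * of_int (eps D \<omega>) * hterm s \<omega> - 1) * (2 * L s))"
  have "G 1 = f 1"
  proof (rule analytic_continuation_open[of "{z. Re z > 3/2}" "{z. Re z > 1/2}" G f 1])
    show "{z. Re z > 3/2} \<noteq> {}" by (auto intro: exI[of _ 2])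
    show "connected {z. Re z > 1/2}" by (intro convex_connected convex_halfspace_Re_gt)
    show "f holomorphic_on {z. Re z > 1/2}" unfolding f_def by (intro holomorphic_intros L)
    show "G z = f z" if "z \<in> {z. Re z > 3/2}" for z
      unfolding f_def using that by (intro G_eq_L L) auto
  qed (rule open_halfspace_Re_gt holomorphic_G | force)+
  also have "f 1 = 0" using assms L(2) by (simp add: f_def)
  finally have "cnj (G 1) = 0" by simp
  thus ?thesis by (simp add: G_1)
qed

end

section \<open>Integrality at the torsion points\<close>

text \<open>For non-integral \<open>w\<close> the inverse \<open>v\<close> lies in the maximal ideal
  \<open>M\<close>, and the recursion reads \<open>v' = v * (v + 2) / d\<close> with a unit
  \<open>d\<close>. Each step thus multiplies \<open>v\<close> by an element of \<open>M\<close>; a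
  closed orbit would force 1 into \<open>M\<close>.\<close>

lemma orbit_integral:
  fixes w :: "nat \<Rightarrow> complex"
  assumes sub: "is_subring R" and val: "\<And>x. x \<in> R \<or> inverse x \<in> R"
    and omega: "\<omega> \<in> R" "inverse (1 - \<omega>) \<notin> R"
    and rec: "\<And>k. w (Suc k) * (1 + 2 * w k) = w k * (\<omega> * w k - (1 - \<omega>))"
    and per: "w n = w 0" "n > 0"
  shows "w 0 \<in> R"
proof (rule ccontr)
  assume w0: "w 0 \<notin> R"
  note intros = is_subring_intros[OF sub]
  \<comment> \<open>The non-units of \<open>R\<close>. That they form an ideal uses the valuation
    property: of two nonzero non-units, one divides the other.\<close>
  define M where "M = {x\<in>R. x = 0 \<or> inverse x \<notin> R}"
  have M_R: "x \<in> R" if "x \<in> M" for x using that by (simp add: M_def)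
  have M_mult: "x * y \<in> M" if "x \<in> R" "y \<in> M" for x y
  proof -
    have "x = 0 \<or> y = 0 \<or> inverse (x * y) \<notin> R"
    proof (rule ccontr)
      assume *: "\<not> (x = 0 \<or> y = 0 \<or> inverse (x * y) \<notin> R)"
      hence "x * inverse (x * y) \<in> R" using that by (intro intros) auto
      also have "x * inverse (x * y) = inverse y" using * by (simp add: field_simps)
      finally show False using that * by (simp add: M_def)
    qed
    thus ?thesis using that intros(3)[of x y] by (auto simp: M_def)
  qed
  have M_add: "x + y \<in> M" if "x \<in> M" "y \<in> M" for x y
  proof -
    have *: "x + y \<in> M" if xy: "x \<in> M" "y \<in> M" "y \<noteq> 0" "x * inverse y \<in> R" for x y
    proof -
      have "(x * inverse y + 1) * y \<in> M" by (rule M_mult[OF intros(6)[OF xy(4) intros(1)] xy(2)])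
      moreover have "(x * inverse y + 1) * y = x + y" using xy(3) by (simp add: distrib_right mult.assoc)
      ultimately show ?thesis by simp
    qed
    consider "x = 0" | "y = 0" | "x \<noteq> 0" "y \<noteq> 0" by blast
    thus ?thesis
    proof cases
      case 3
      have "x * inverse y \<in> R \<or> inverse (x * inverse y) \<in> R" by (rule val)
      thus ?thesis using *[of x y] *[of y x] that 3 by (auto simp: mult.commute add.commute)
    qed (use that in auto)
  qed
  have one_notin: "1 \<notin> M" using intros(1) by (simp add: M_def)
  have unit: "1 + x \<noteq> 0 \<and> inverse (1 + x) \<in> R" if "x \<in> M" for x
  proof (rule ccontr)
    assume "\<not> (1 + x \<noteq> 0 \<and> inverse (1 + x) \<in> R)"
    hence "1 + x \<in> M" using that intros by (auto simp: M_def)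
    moreover have "- 1 * x \<in> M" using that by (intro M_mult intros)
    ultimately have "(1 + x) + (- 1 * x) \<in> M" by (rule M_add)
    thus False using one_notin by simp
  qed
  have conj_M: "1 - \<omega> \<in> M" using omega intros(2)[OF intros(1) omega(1)] by (simp add: M_def)
  have two_M: "2 \<in> M" using M_mult[OF omega(1) conj_M] by (simp add: omega_mult_conj)
  define v where "v = (\<lambda>k. inverse (w k))"
  have step: "v (Suc k) \<noteq> 0 \<and> (\<exists>m\<in>M. v (Suc k) = v k * m)" if v: "v k \<in> M" "v k \<noteq> 0" for k
  proof -
    \<comment> \<open>Equal to \<open>1 - (1 - \<omega>) * (1 + v k)\<close>, which differs from 1
      by an element of \<open>M\<close> and so is a unit.\<close>
    define d where "d = \<omega> - (1 - \<omega>) * v k"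
    have "- (1 - \<omega>) * (1 + v k) \<in> M"
      using M_mult[of "- (1 + v k)" "1 - \<omega>"] conj_M v M_R[OF v(1)] intros by (simp add: algebra_simps)
    hence d: "d \<noteq> 0" "inverse d \<in> R"
      using unit[of "- (1 - \<omega>) * (1 + v k)"] by (simp_all add: d_def algebra_simps)
    have w: "w k \<noteq> 0" "v k * w k = 1" using v by (auto simp: v_def)
    have "\<omega> * w k - (1 - \<omega>) = w k * d" unfolding d_def using w(2) by (simp add: algebra_simps)
    hence rec': "w (Suc k) * (1 + 2 * w k) = w k * w k * d" using rec[of k] by simp
    hence ne: "w (Suc k) \<noteq> 0" "1 + 2 * w k \<noteq> 0" using w d by auto
    have "v (Suc k) * (w (Suc k) * (1 + 2 * w k)) = 1 + 2 * w k" using ne by (simp add: v_def)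
    hence "v (Suc k) * (w k * w k * d) = 1 + 2 * w k" unfolding rec' .
    hence "v k * v k * inverse d * (v (Suc k) * (w k * w k * d)) = v k * v k * inverse d * (1 + 2 * w k)" by simp
    moreover have "v k * v k * inverse d * (v (Suc k) * (w k * w k * d)) = v (Suc k)"
    proof -
      have "v k * v k * inverse d * (v (Suc k) * (w k * w k * d)) =
          (v k * w k) * (v k * w k) * (inverse d * d) * v (Suc k)" by (simp only: mult_ac)
      thus ?thesis using w(2) d(1) by simp
    qed
    moreover have "v k * v k * inverse d * (1 + 2 * w k) = v k * (inverse d * (v k + 2 * (v k * w k)))"
      by (simp add: algebra_simps)
    ultimately have "v (Suc k) = v k * (inverse d * (v k + 2))" unfolding w(2) by simp
    moreover have "inverse d * (v k + 2) \<in> M" by (intro M_mult M_add v two_M d)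
    ultimately show ?thesis using ne(1) by (auto simp: v_def)
  qed
  have "w 0 \<noteq> 0" using w0 intros by auto
  hence v0: "v 0 \<in> M" "v 0 \<noteq> 0" using val[of "w 0"] w0 by (auto simp: v_def M_def)
  have "v k \<in> M \<and> v k \<noteq> 0 \<and> (k > 0 \<longrightarrow> (\<exists>m\<in>M. v k = v 0 * m))" for k
  proof (induction k)
    case (Suc k)
    then obtain m where m: "m \<in> M" "v (Suc k) = v k * m" "v (Suc k) \<noteq> 0" using step by blast
    have "v (Suc k) \<in> M" unfolding m(2) using Suc m M_mult M_R by blast
    moreover have "\<exists>m\<in>M. v (Suc k) = v 0 * m"
    proof (cases "k = 0")
      case False
      then obtain m' where "m' \<in> M" "v k = v 0 * m'" using Suc by blast
      thus ?thesis using m M_mult[OF M_R[of m'] m(1)] by (intro bexI[of _ "m' * m"]) (auto simp: mult.assoc)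
    qed (use m in auto)
    ultimately show ?case using m by blast
  qed (use v0 in simp)
  from this[of n] obtain m where "m \<in> M" "v n = v 0 * m" using per(2) by blast
  hence "m = 1" using per(1) v0 by (simp add: v_def)
  thus False using \<open>m \<in> M\<close> one_notin by simp
qed

section \<open>Non-vanishing of the sum over torsion points\<close>

context split_prime
begin

definition h :: "complex \<Rightarrow> complex" where "h x = H (\<omega> * x / \<pi>)"

text \<open>The factor \<open>\<omega>\<close> in the argument turns a change of \<open>x\<close> by
  \<open>D\<close> into a translation by \<open>\<omega> \<O>\<close>, on which
  \<open>\<kappa>\<close> is 1.\<close>

lemma h_cong:
  assumes "x - y \<in> D"
  shows "h x = h y"
proof -
  obtain z where z: "z \<in> \<O>" "x - y = z * \<pi>" using assms unfolding D_eq in_princ_iff by blast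
  have "\<omega> * x / \<pi> = \<omega> * (y + (x - y)) / \<pi>" by simp
  also have "\<dots> = \<omega> * y / \<pi> + \<omega> * z" unfolding z by (simp add: field_simps)
  finally have "h x = \<kappa> (\<omega> * z) * h y" unfolding h_def using H_add[of "\<omega> * z" "\<omega> * y / \<pi>"] z(1) by simp
  thus ?thesis using kappa_mult[OF O_omega z(1)] by simp
qed

lemma h_minus: "h (- x) = - h x"
  using H_minus[of "\<omega> * x / \<pi>"] by (simp add: h_def)

text \<open>Residues outside \<open>D\<close> avoid the exceptional set:
  \<open>(1 - \<omega>) \<omega> x / \<pi> = 2 x / \<pi>\<close> is integral only if
  \<open>2 x\<close>, hence \<open>x\<close>, lies in \<open>D\<close>.\<close>

lemma h_isogeny:
  obtains c where "c \<noteq> 0"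
    "\<forall>x\<in>\<O> - D. h ((1 - \<omega>) * x) * h x = h x ^ 2 / (1 - \<omega>) + c"
proof (rule H_isogeny)
  fix c assume c: "c \<noteq> 0"
    "\<And>z. (1 - \<omega>) * z \<notin> \<O> \<Longrightarrow> H ((1 - \<omega>) * z) * H z = H z ^ 2 / (1 - \<omega>) + c"
  show ?thesis
  proof (rule that[OF c(1)], rule ballI)
    fix x assume x: "x \<in> \<O> - D"
    have "(1 - \<omega>) * (\<omega> * x / \<pi>) \<notin> \<O>"
    proof
      assume "(1 - \<omega>) * (\<omega> * x / \<pi>) \<in> \<O>"
      moreover have "(1 - \<omega>) * (\<omega> * x / \<pi>) = (\<omega> * (1 - \<omega>)) * x / \<pi>" by simp
      ultimately have "2 * x / \<pi> \<in> \<O>" by (simp only: omega_mult_conj)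
      hence "2 * x \<in> D" unfolding D_eq in_princ_iff by (intro bexI[of _ "2 * x / \<pi>"]) auto
      thus False using D_prime[of 2 x] x odd_prime_notin_D by auto
    qed
    from c(2)[OF this] show "h ((1 - \<omega>) * x) * h x = h x ^ 2 / (1 - \<omega>) + c"
      by (simp add: h_def mult_ac)
  qed
qed

text \<open>Fermat's theorem for the residue of \<open>1 - \<omega>\<close>, obtained by squaring
  Euler's criterion. It closes the orbits of multiplication by \<open>1 - \<omega>\<close> after
  \<open>p - 1\<close> steps.\<close>

lemma conj_omega_power_cong: "(1 - \<omega>) ^ (p - 1) - 1 \<in> D"
proof -
  have O: "1 - \<omega> \<in> \<O>" by blast
  obtain a where a: "(1 - \<omega>) - of_int a \<in> D" using ex_residue O .
  have pow: "(1 - \<omega>) ^ k - of_int (a ^ k) \<in> D" for k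
  proof (induction k)
    case (Suc k)
    thus ?case using residue_mult[OF O a Suc] by simp
  qed (use D_intros(1) in simp)
  have "\<not> int p dvd a" using residue_in_D_iff[OF a] odd_prime_notin_D by blast
  hence "Legendre a (int p) ^ 2 = 1" by (auto simp: Legendre_def cong_0_iff)
  moreover have "[Legendre a (int p) ^ 2 = (a ^ ((p - 1) div 2)) ^ 2] (mod int p)"
    by (intro cong_pow euler_criterion prime_p p_gt_2)
  moreover have "(a ^ ((p - 1) div 2)) ^ 2 = a ^ (p - 1)"
    using odd_p by (simp flip: power_mult)
  ultimately have "int p dvd a ^ (p - 1) - 1"
    by (metis cong_iff_dvd_diff cong_sym)
  hence "of_int (a ^ (p - 1) - 1) \<in> D" by (simp only: of_int_in_D_iff)
  from D_intros(4)[OF pow[of "p - 1"] this] show ?thesis by simp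
qed

lemma sum_eps_h_nonzero: "(\<Sum>a<p. of_int (eps D (of_nat a)) * h (of_nat a)) \<noteq> 0"
proof
  let ?e = "\<lambda>x. of_int (eps D x) :: complex"
  assume zero: "(\<Sum>a<p. ?e (of_nat a) * h (of_nat a)) = 0"
  obtain c where c: "c \<noteq> 0" "\<forall>x\<in>\<O> - D. h ((1 - \<omega>) * x) * h x = h x ^ 2 / (1 - \<omega>) + c"
    by (rule h_isogeny)
  \<comment> \<open>With this scaling the values \<open>h = l\<close> and \<open>h = - l\<close> are
    fixed by the map that the formula for \<open>1 - \<omega>\<close> induces. In the coordinate
    \<open>w\<close> the first fixed point becomes 0, so the recursion has no constant term and a
    factor 4 divides out.\<close>
  define l where "l = csqrt (- c * (1 - \<omega>) / \<omega>)"
  have l: "l ^ 2 = - c * (1 - \<omega>) / \<omega>" "l \<noteq> 0" using c(1) by (auto simp: l_def)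
  hence c_eq: "c = - (l ^ 2) * \<omega> / (1 - \<omega>)" by simp
  define w where "w = (\<lambda>x. (h x / l - 1) / 2)"
  have h_eq: "h x = l * (1 + 2 * w x)" for x using l(2) by (simp add: w_def field_simps)
  have rec: "w ((1 - \<omega>) * x) * (1 + 2 * w x) = w x * (\<omega> * w x - (1 - \<omega>))" if "x \<in> \<O> - D" for x
  proof -
    define a where "a = w x"
    define b where "b = w ((1 - \<omega>) * x)"
    have "l * (1 + 2 * b) * (l * (1 + 2 * a)) = (l * (1 + 2 * a)) ^ 2 / (1 - \<omega>) + - (l ^ 2) * \<omega> / (1 - \<omega>)"
      using c(2) that unfolding a_def b_def h_eq[symmetric] c_eq[symmetric] by blast
    moreover have "l ^ 2 * ((1 - \<omega>) * ((1 + 2 * b) * (1 + 2 * a))) = (1 - \<omega>) * (l * (1 + 2 * b) * (l * (1 + 2 * a)))"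
      by (simp only: power2_eq_square mult_ac)
    moreover have "u * (x / u + y / u) = x + y" if "u \<noteq> 0" for u x y :: complex
      using that by (simp add: field_simps)
    ultimately have "l ^ 2 * ((1 - \<omega>) * ((1 + 2 * b) * (1 + 2 * a))) = (l * (1 + 2 * a)) ^ 2 + - (l ^ 2) * \<omega>"
      using omega_nz(2) by metis
    hence "l ^ 2 * ((1 - \<omega>) * ((1 + 2 * b) * (1 + 2 * a))) = l ^ 2 * ((1 + 2 * a) ^ 2 - \<omega>)"
      by (simp add: power_mult_distrib right_diff_distrib)
    hence "(1 - \<omega>) * ((1 + 2 * b) * (1 + 2 * a)) = (1 + 2 * a) ^ 2 - \<omega>" using l(2) by simp
    hence "\<omega> * ((1 - \<omega>) * ((1 + 2 * b) * (1 + 2 * a))) = \<omega> * ((1 + 2 * a) ^ 2 - \<omega>)" by simp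
    hence "(\<omega> * (1 - \<omega>)) * ((1 + 2 * b) * (1 + 2 * a)) = \<omega> * (1 + 2 * a) ^ 2 - \<omega> * \<omega>"
      by (simp only: mult.assoc[of \<omega> "1 - \<omega>"] right_diff_distrib[of \<omega> "(1 + 2 * a) ^ 2"])
    hence "2 * ((1 + 2 * b) * (1 + 2 * a)) = \<omega> * (1 + 2 * a) ^ 2 - (\<omega> - 2)"
      unfolding omega_mult_conj omega_sq .
    hence "4 * (b * (1 + 2 * a)) = 4 * (a * (\<omega> * a - (1 - \<omega>)))"
      by (simp add: algebra_simps power2_eq_square)
    thus ?thesis unfolding a_def b_def by simp
  qed
  have notin: "inverse (1 - \<omega>) \<notin> \<O>"
  proof
    assume "inverse (1 - \<omega>) \<in> \<O>"
    from norm_O_ge_1[OF this] have "1 \<le> inverse (sqrt 2)" by (simp add: norm_inverse norm_omega)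
    moreover have "inverse (sqrt 2) < 1" by (rule inverse_less_1_iff[THEN iffD2]) simp
    ultimately show False by linarith
  qed
  \<comment> \<open>A place of the complex field above \<open>1 - \<omega>\<close>: it exists
    because \<open>inverse (1 - \<omega>)\<close> has absolute value below 1 and so is not in
    \<open>\<O>\<close>.\<close>
  obtain R where R: "is_subring R" "\<O> \<subseteq> R" "inverse (1 - \<omega>) \<notin> R" "\<And>x. x \<in> R \<or> inverse x \<in> R"
    by (rule exists_valuation_ring[OF is_subring_O _ notin]) auto
  note intros = is_subring_intros[OF R(1)]
  have integral: "w x \<in> R" if x: "x \<in> \<O> - D" for x
  proof -
    define s where "s = (\<lambda>k. w ((1 - \<omega>) ^ k * x))"
    have orbit: "(1 - \<omega>) ^ k * x \<in> \<O> - D" for k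
    proof (induction k)
      case (Suc k)
      have "(1 - \<omega>) * ((1 - \<omega>) ^ k * x) \<in> \<O>" using Suc by blast
      moreover have "(1 - \<omega>) * ((1 - \<omega>) ^ k * x) \<notin> D"
        using D_prime[of "1 - \<omega>" "(1 - \<omega>) ^ k * x"] Suc odd_prime_notin_D by blast
      ultimately show ?case by (simp add: mult.assoc)
    qed (use x in simp)
    have "s 0 \<in> R"
    proof (rule orbit_integral[OF R(1) R(4) _ R(3)])
      show "\<omega> \<in> R" using R(2) by blast
      show "s (Suc k) * (1 + 2 * s k) = s k * (\<omega> * s k - (1 - \<omega>))" for k
        using rec[OF orbit[of k]] by (simp add: s_def mult.assoc)
      have "x * ((1 - \<omega>) ^ (p - 1) - 1) \<in> D" using x by (intro D_intros(6) conj_omega_power_cong) auto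
      hence "(1 - \<omega>) ^ (p - 1) * x - x \<in> D" by (simp add: algebra_simps)
      thus "s (p - 1) = s 0" using h_cong by (simp add: s_def w_def)
      show "0 < p - 1" using p_gt_2 by simp
    qed
    thus ?thesis by (simp add: s_def)
  qed
  define q where "q = (p - 1) div 2"
  have p_eq: "p = 2 * q + 1" and odd_q: "odd q" using odd_p odd_half_p p_gt_2 by (auto simp: q_def)
  \<comment> \<open>A negative sign of \<open>eps\<close> is absorbed by passing from
    \<open>a\<close> to \<open>- a\<close>, as \<open>h\<close> is odd; so every term has the shape
    \<open>l * (1 + 2 * u)\<close> whatever the sign.\<close>
  have "\<exists>u\<in>R. ?e (of_nat a) * h (of_nat a) = l * (1 + 2 * u)" if a: "a \<in> {1..q}" for a
  proof -
    have nD: "of_nat a \<notin> D"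
    proof
      assume "of_nat a \<in> D"
      hence "int p dvd int a" using of_int_in_D_iff[of "int a"] by simp
      thus False using a p_eq by (auto dest: zdvd_imp_le)
    qed
    moreover have "- of_nat a \<notin> D"
    proof
      assume "- of_nat a \<in> D"
      hence "- (- of_nat a) \<in> D" by (rule D_intros(5))
      thus False using nD by simp
    qed
    ultimately have "w (of_nat a) \<in> R" "w (- of_nat a) \<in> R" by (auto intro!: integral)
    moreover have "eps D (of_nat a) = 1 \<or> eps D (of_nat a) = -1"
      using eps_values[of "of_nat a"] eps_eq_0_iff[of "of_nat a"] nD by auto
    moreover have "- h (of_nat a) = l * (1 + 2 * w (- of_nat a))" using h_eq[of "- of_nat a"] h_minus by simp
    ultimately show ?thesis
      using h_eq[of "of_nat a"] by (metis mult_1 mult_minus1 of_int_1 of_int_minus)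
  qed
  then obtain u where u: "\<And>a. a \<in> {1..q} \<Longrightarrow> u a \<in> R"
    "\<And>a. a \<in> {1..q} \<Longrightarrow> ?e (of_nat a) * h (of_nat a) = l * (1 + 2 * u a)" by metis
  define U where "U = (\<Sum>a\<in>{1..q}. u a)"
  have U: "U \<in> R" unfolding U_def by (intro is_subring_sum[OF R(1)] u)
  let ?t = "\<lambda>a. ?e (of_nat a) * h (of_nat a)"
  have "{..<p} = {0} \<union> {1..q} \<union> {q + 1..2 * q}" using p_eq by auto
  hence "(\<Sum>a<p. ?t a) = sum ?t ({0} \<union> {1..q} \<union> {q + 1..2 * q})" by simp
  also have "\<dots> = sum ?t ({0} \<union> {1..q}) + sum ?t {q + 1..2 * q}" by (rule sum.union_disjoint) auto
  also have "sum ?t ({0} \<union> {1..q}) = sum ?t {0} + sum ?t {1..q}" by (rule sum.union_disjoint) auto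
  also have "sum ?t {0} = 0" using eps_eq_0_iff[of 0] D_intros(1) by simp
  \<comment> \<open>Replacing \<open>a\<close> by \<open>p - a\<close> changes the sign of both
    \<open>eps\<close> and \<open>h\<close>, so the two halves of the sum coincide.\<close>
  also have "sum ?t {q + 1..2 * q} = sum ?t {1..q}"
  proof (rule sum.reindex_bij_witness[of _ "\<lambda>a. p - a" "\<lambda>a. p - a"])
    fix a assume a: "a \<in> {q + 1..2 * q}"
    have "of_nat (p - a) - (- of_nat a) = (of_int (int p) :: complex)" using a p_eq by (simp add: of_nat_diff)
    hence d: "of_nat (p - a) - (- of_nat a) \<in> D" using p_in_D by simp
    have "eps D (of_nat (p - a)) = eps D (- of_nat a)" by (rule eps_cong[OF _ _ d]) auto
    moreover have "h (of_nat (p - a)) = h (- of_nat a)" by (rule h_cong[OF d])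
    ultimately show "?t (p - a) = ?t a" by (simp add: eps_minus h_minus)
  qed (use p_eq in auto)
  also have "sum ?t {1..q} = (\<Sum>a\<in>{1..q}. l * (1 + 2 * u a))" using u(2) by (rule sum.cong[OF refl])
  also have "\<dots> = l * (of_nat q + 2 * U)" by (simp add: U_def sum_distrib_left[symmetric] sum.distrib)
  finally have "of_nat q + 2 * U = 0" using zero l(2) by simp
  moreover obtain j where "q = 2 * j + 1" using odd_q by (elim oddE)
  ultimately have "1 + 2 * of_nat j + 2 * U = 0" by simp
  moreover have "2 * (- of_nat j - U) = 1 - (1 + 2 * of_nat j + 2 * U)" by (simp add: algebra_simps)
  \<comment> \<open>This makes 2 invertible in \<open>R\<close>; as
    \<open>2 = \<omega> (1 - \<omega>)\<close>, also \<open>1 - \<omega>\<close> would be, which the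
    choice of \<open>R\<close> excludes.\<close>
  ultimately have "1 = 2 * (- of_nat j - U)" by simp
  hence half: "1 / 2 = - of_nat j - U" by (simp add: field_simps)
  have "- of_nat j - U \<in> R" using R(2) U by (intro intros) auto
  hence "\<omega> * (1 / 2) \<in> R" unfolding half using R(2) by (intro intros(3)) auto
  moreover have "inverse (1 - \<omega>) = \<omega> * (1 / 2)"
    using omega_mult_conj by (simp add: field_simps)
  ultimately have "inverse (1 - \<omega>) \<in> R" by (simp only:)
  thus False using R(3) by blast
qed

end

theorem theorem61:
  fixes D :: "complex set"
  assumes "primeideal D OK"
    and "prime (ideal_norm D)"
    and "[ideal_norm D = 3] (mod 4)"
    and "ideal_norm D \<noteq> 7"
  shows "hecke_L (psi D) 1 \<noteq> 0"
proof -
  obtain \<pi> where "split_prime D \<pi> (ideal_norm D)"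
    by (rule split_prime_primeideal[OF assms(1-3)])
  then interpret split_prime D \<pi> "ideal_norm D" .
  show ?thesis using L_zero_imp_sum_zero sum_eps_h_nonzero unfolding h_def by blast
qed

end
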